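(* Let $X\subset\mathbb{P}^2$ be a planar elliptic curve (a smooth plane cubic) such that $X(\mathbb{R})$ has two connected components $X_1$ and $X_2$, and let $X'\subset\mathbb{P}^5$ be the image of $X$ under the second Veronese embedding $\mathbb{P}^2\to\mathbb{P}^5$. Then there are $3$-dimensional linear subspaces $L_1,L_2\subset\mathbb{P}^5$ such that $X'$ is hyperbolic with respect to both $L_1$ and $L_2$, the projections from $L_1$ and $L_2$ realize the degree partitions $(4,2)$ and $(2,4)$, respectively, on $(X_1,X_2)$, and $L_1$ and $L_2$ do not lie in the same connected component of the hyperbolicity locus $\mathcal{H}(X')$. In particular, $\mathcal{H}(X')$ is not connected.
   Context: A curve is a non-singular, projective, geometrically irreducible algebraic curve over $\mathbb{R}$; projective spaces, morphisms and linear subspaces are defined over $\mathbb{R}$. A morphism $f\colon X\to\mathbb{P}^1$ is separating if $f^{-1}(\mathbb{P}^1(\mathbb{R}))=X(\mathbb{R})$ (preimage taken in $X(\mathbb{C})$). Such a morphism is unramified at all points of $X(\mathbb{R})$, so it restricts to a covering $X_i\to\mathbb{P}^1(\mathbb{R})$ on each connected component $X_i$ of $X(\mathbb{R})$; the degree partition of $f$ is the tuple of the degrees (numbers of sheets) of these coverings. A curve $X\subset\mathbb{P}^n$ is hyperbolic with respect to a linear subspace $L\subset\mathbb{P}^n$ of codimension two with $L\cap X=\emptyset$ if the linear projection $X\to\mathbb{P}^1$ from $L$ is separating. For a curve $X\subset\mathbb{P}^n$ not contained in a hyperplane, the hyperbolicity locus is $\mathcal{H}(X)=\{L : X\text{ is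 hyperbolic with respect to }L\}\subset\mathrm{Gr}(n-1,n+1)$, where $\mathrm{Gr}(n-1,n+1)$ is the space of (real) codimension-two linear subspaces of $\mathbb{P}^n$, with its Euclidean topology. *)

theory Defs
  imports "HOL-Analysis.Analysis"
begin

section \<open>Complex projective space with its Euclidean topology\<close>

text \<open>
  The type \<open>'n cproj\<close> is the set of complex points of the projective space of dimension
  \<open>CARD('n) - 1\<close>. A real variety is represented by its set of complex points, and
  its real points are those that have a representative with real coordinates.
\<close>

definition proj_rel :: "complex^'n \<Rightarrow> complex^'n \<Rightarrow> bool" where
  "proj_rel x y \<longleftrightarrow> x \<noteq> 0 \<and> y \<noteq> 0 \<and> (\<exists>c. c \<noteq> 0 \<and> y = c *s x)"

lemma part_equivp_proj_rel: "part_equivp (proj_rel :: complex^'n \<Rightarrow> complex^'n \<Rightarrow> bool)"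
proof (rule part_equivpI)
  have "proj_rel 1 (1 :: complex^'n)"
    unfolding proj_rel_def by (auto simp: vec_eq_iff intro: exI[of _ 1])
  then show "\<exists>x :: complex^'n. proj_rel x x" by blast
  show "symp (proj_rel :: complex^'n \<Rightarrow> complex^'n \<Rightarrow> bool)"
  proof (rule sympI)
    fix x y :: "complex^'n" assume "proj_rel x y"
    then obtain c where "x \<noteq> 0" "y \<noteq> 0" "c \<noteq> 0" "y = c *s x"
      unfolding proj_rel_def by blast
    then have "inverse c \<noteq> 0 \<and> x = inverse c *s y" by (simp add: vec_eq_iff)
    then show "proj_rel y x" using \<open>x \<noteq> 0\<close> \<open>y \<noteq> 0\<close> unfolding proj_rel_def by blast
  qed
  show "transp (proj_rel :: complex^'n \<Rightarrow> complex^'n \<Rightarrow> bool)"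
  proof (rule transpI)
    fix x y z :: "complex^'n" assume "proj_rel x y" "proj_rel y z"
    then obtain c d where "x \<noteq> 0" "z \<noteq> 0" "c \<noteq> 0" "d \<noteq> 0" "y = c *s x" "z = d *s y"
      unfolding proj_rel_def by blast
    then have "d * c \<noteq> 0 \<and> z = (d * c) *s x" by (simp add: vec_eq_iff mult.assoc)
    then show "proj_rel x z" using \<open>x \<noteq> 0\<close> \<open>z \<noteq> 0\<close> unfolding proj_rel_def by blast
  qed
qed

quotient_type 'n cproj = "complex^'n" / partial: proj_rel
  by (rule part_equivp_proj_rel)

text \<open>
  For \<open>x \<noteq> 0\<close>, \<open>abs_cproj x\<close> is the point with homogeneous coordinates \<open>x\<close>, and
  \<open>rep_cproj p\<close> is some vector of homogeneous coordinates of \<open>p\<close>.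
\<close>

lemma abs_cproj_eq_iff:
  assumes "x \<noteq> 0" and "y \<noteq> 0"
  shows "abs_cproj x = abs_cproj y \<longleftrightarrow> (\<exists>c. c \<noteq> 0 \<and> y = c *s x)"
proof -
  have "proj_rel x x" "proj_rel y y"
    using assms unfolding proj_rel_def by (auto intro!: exI[of _ 1])
  then show ?thesis
    using Quotient_rel[OF Quotient_cproj, of x y] assms by (auto simp: proj_rel_def)
qed

lemma rep_cproj_nonzero: "rep_cproj p \<noteq> 0"
  using Quotient_rep_reflp[OF Quotient_cproj, of p] by (simp add: proj_rel_def)

lemma abs_rep_cproj: "abs_cproj (rep_cproj p) = p"
  by (rule Quotient_abs_rep[OF Quotient_cproj])

instantiation cproj :: (finite) topological_space
begin

definition open_cproj :: "'a cproj set \<Rightarrow> bool" where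
  "open_cproj U \<longleftrightarrow> open {x. x \<noteq> 0 \<and> abs_cproj x \<in> U}"

instance
proof
  have "{x :: complex^'a. x \<noteq> 0 \<and> abs_cproj x \<in> UNIV} = - {0}" by auto
  then show "open (UNIV :: 'a cproj set)"
    unfolding open_cproj_def by (simp only: open_Compl closed_singleton)
next
  fix S T :: "'a cproj set"
  assume "open S" "open T"
  moreover have "{x. x \<noteq> 0 \<and> abs_cproj x \<in> S \<inter> T}
      = {x. x \<noteq> 0 \<and> abs_cproj x \<in> S} \<inter> {x. x \<noteq> 0 \<and> abs_cproj x \<in> T}" by auto
  ultimately show "open (S \<inter> T)" unfolding open_cproj_def by auto
next
  fix K :: "'a cproj set set"
  assume "\<forall>S\<in>K. open S"
  moreover have "{x. x \<noteq> 0 \<and> abs_cproj x \<in> \<Union>K}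
      = (\<Union>S\<in>K. {x. x \<noteq> 0 \<and> abs_cproj x \<in> S})" by auto
  ultimately show "open (\<Union>K)" unfolding open_cproj_def by auto
qed

end

definition real_points :: "('n::finite) cproj set" where
  "real_points = {abs_cproj x |x. x \<noteq> 0 \<and> (\<forall>i. x $ i \<in> \<real>)}"


section \<open>Smooth plane curves\<close>

text \<open>
  A real form of degree \<open>d\<close> is given by its coefficients, indexed by the exponent
  functions \<open>m\<close> with \<open>sum m UNIV = d\<close>; coefficients at other exponents are ignored.
\<close>

definition form_eval :: "nat \<Rightarrow> (('n::finite \<Rightarrow> nat) \<Rightarrow> real) \<Rightarrow> complex^'n \<Rightarrow> complex" where
  "form_eval d c x = (\<Sum>m | sum m UNIV = d. of_real (c m) * (\<Prod>i\<in>UNIV. (x $ i) ^ m i))"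

definition form_partial ::
    "nat \<Rightarrow> (('n::finite \<Rightarrow> nat) \<Rightarrow> real) \<Rightarrow> 'n \<Rightarrow> complex^'n \<Rightarrow> complex" where
  "form_partial d c j x =
     (\<Sum>m | sum m UNIV = d. of_real (c m) * of_nat (m j) *
        (\<Prod>i\<in>UNIV. (x $ i) ^ (if i = j then m i - 1 else m i)))"

lemma finite_exponents: "finite {m :: 'n::finite \<Rightarrow> nat. sum m UNIV = d}"
proof (rule finite_subset)
  show "{m :: 'n \<Rightarrow> nat. sum m UNIV = d} \<subseteq> (\<Pi>\<^sub>E i\<in>UNIV. {..d})"
    by (auto intro: member_le_sum)
  show "finite (\<Pi>\<^sub>E i\<in>(UNIV::'n set). {..d})" by (intro finite_PiE) auto
qed

lemma form_partial_is_derivative: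
  "((\<lambda>t. form_eval d c (\<chi> i. if i = j then t else x $ i))
      has_field_derivative form_partial d c j x) (at (x $ j))"
proof -
  have split: "(\<Prod>i\<in>UNIV. (f i :: complex)) = f j * (\<Prod>i\<in>UNIV - {j}. f i)" for f
    by (rule prod.remove) auto
  have "((\<lambda>t. t ^ k) has_field_derivative of_nat k * (x $ j) ^ (k - 1)) (at (x $ j))" for k
    by (auto intro!: derivative_eq_intros)
  then have 1: "((\<lambda>t. of_real (c m) * (t ^ m j * (\<Prod>i\<in>UNIV - {j}. (x $ i) ^ m i)))
      has_field_derivative
        of_real (c m) * (of_nat (m j) * (x $ j) ^ (m j - 1) * (\<Prod>i\<in>UNIV - {j}. (x $ i) ^ m i)))
      (at (x $ j))" for m
    by (intro DERIV_cmult DERIV_cmult_right)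
  have 2: "form_eval d c (\<chi> i. if i = j then t else x $ i) =
      (\<Sum>m | sum m UNIV = d. of_real (c m) * (t ^ m j * (\<Prod>i\<in>UNIV - {j}. (x $ i) ^ m i)))" for t
    unfolding form_eval_def split by (intro sum.cong) auto
  have 3: "form_partial d c j x = (\<Sum>m | sum m UNIV = d. of_real (c m) *
        (of_nat (m j) * (x $ j) ^ (m j - 1) * (\<Prod>i\<in>UNIV - {j}. (x $ i) ^ m i)))"
    unfolding form_partial_def split by (intro sum.cong) (auto simp: mult.assoc)
  show ?thesis unfolding 2 3 by (rule DERIV_sum) (rule 1)
qed

text \<open>
  The Jacobian criterion is imposed at all complex points. It excludes the zero form and
  makes the plane curve geometrically irreducible.
\<close>

definition smooth_plane_curve :: "nat \<Rightarrow> 3 cproj set \<Rightarrow> bool" where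
  "smooth_plane_curve d X \<longleftrightarrow>
     (\<exists>c. X = {abs_cproj x |x. x \<noteq> 0 \<and> form_eval d c x = 0} \<and>
          (\<forall>x. x \<noteq> 0 \<and> form_eval d c x = 0 \<longrightarrow> (\<exists>j. form_partial d c j x \<noteq> 0)))"


section \<open>The second Veronese embedding of the plane\<close>

definition veronese_vec :: "complex^3 \<Rightarrow> complex^6" where
  "veronese_vec x =
     vector [x$1 * x$1, x$1 * x$2, x$1 * x$3, x$2 * x$2, x$2 * x$3, x$3 * x$3]"

lemma veronese_vec_nth:
  "veronese_vec x $ 1 = x$1 * x$1" "veronese_vec x $ 2 = x$1 * x$2"
  "veronese_vec x $ 3 = x$1 * x$3" "veronese_vec x $ 4 = x$2 * x$2"
  "veronese_vec x $ 5 = x$2 * x$3" "veronese_vec x $ 6 = x$3 * x$3"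
  unfolding veronese_vec_def vector_def by simp_all

definition veronese :: "3 cproj \<Rightarrow> 6 cproj" where
  "veronese p = abs_cproj (veronese_vec (rep_cproj p))"


section \<open>Linear subspaces and linear projections\<close>

text \<open>A real linear subspace of projective space is represented by its affine cone.\<close>

definition linear_subspaces :: "nat \<Rightarrow> (real^'n) set set" where
  "linear_subspaces k = {L. subspace L \<and> dim L = k + 1}"

definition codim2_subspaces :: "(real^'n) set set" where
  "codim2_subspaces = {L. subspace L \<and> dim L + 2 = CARD('n)}"

text \<open>The complexification of \<open>L\<close> consists of the vectors with real and imaginary part in \<open>L\<close>.\<close>

definition complex_points :: "(real^'n) set \<Rightarrow> 'n cproj set" where
  "complex_points L =
     {abs_cproj x |x. x \<noteq> 0 \<and> (\<chi> i. Re (x $ i)) \<in> L \<and> (\<chi> i. Im (x $ i)) \<in> L}"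

definition common_zeros :: "real^'n \<Rightarrow> real^'n \<Rightarrow> (real^'n) set" where
  "common_zeros a b = {v. a \<bullet> v = 0 \<and> b \<bullet> v = 0}"

definition linear_form :: "real^'n \<Rightarrow> complex^'n \<Rightarrow> complex" where
  "linear_form a x = (\<Sum>i\<in>UNIV. of_real (a $ i) * x $ i)"

text \<open>
  The values of \<open>pencil_map a b\<close> are meaningful only off \<open>common_zeros a b\<close>. The projections
  from \<open>L\<close> are the maps obtained from the pairs of linear forms defining \<open>L\<close>; any two of
  them differ by a real projective automorphism of the target line.
\<close>

definition pencil_map :: "real^'n \<Rightarrow> real^'n \<Rightarrow> 'n cproj \<Rightarrow> 2 cproj" where
  "pencil_map a b p =
     abs_cproj (vector [linear_form a (rep_cproj p), linear_form b (rep_cproj p)])"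

definition projections_from :: "(real^'n) set \<Rightarrow> ('n cproj \<Rightarrow> 2 cproj) set" where
  "projections_from L = {pencil_map a b |a b. common_zeros a b = L}"

lemma projections_from_nonempty:
  fixes L :: "(real^'n) set"
  assumes "L \<in> codim2_subspaces"
  shows "projections_from L \<noteq> {}"
proof -
  have L: "subspace L" "dim L + 2 = CARD('n)"
    using assms unfolding codim2_subspaces_def by auto
  let ?P = "L\<^sup>\<bottom>"
  have "dim ?P + dim L = CARD('n)"
    using dim_subspace_orthogonal_to_vectors[OF L(1) subspace_UNIV]
    by (simp add: orthogonal_comp_def orthogonal_commute)
  then have "dim ?P = 2" using L(2) by simp
  then obtain B where B: "B \<subseteq> ?P" "?P \<subseteq> span B" "card B = 2"
    using basis_exists[of ?P] by metis
  then obtain a b where ab: "B = {a, b}" by (auto simp: card_2_iff)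
  have "common_zeros a b = L"
  proof
    show "L \<subseteq> common_zeros a b"
      using B(1) ab by (auto simp: common_zeros_def orthogonal_comp_def orthogonal_def inner_commute)
    show "common_zeros a b \<subseteq> L"
    proof
      fix v assume v: "v \<in> common_zeros a b"
      have "orthogonal v w" if "w \<in> ?P" for w
        using orthogonal_to_span[of w B v] that B(2) v
        by (auto simp: ab common_zeros_def orthogonal_def inner_commute)
      then have "v \<in> ?P\<^sup>\<bottom>" by (auto simp: orthogonal_comp_def orthogonal_commute)
      then show "v \<in> L" using orthogonal_comp_self[OF L(1)] by simp
    qed
  qed
  then show ?thesis unfolding projections_from_def by auto
qed


section \<open>Separating morphisms and hyperbolicity\<close>

definition separating :: "('n::finite) cproj set \<Rightarrow> ('n cproj \<Rightarrow> 2 cproj) \<Rightarrow> bool" where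
  "separating X f \<longleftrightarrow> {p \<in> X. f p \<in> real_points} = X \<inter> real_points"

definition covering_of_degree :: "('n::finite) cproj set \<Rightarrow> ('n cproj \<Rightarrow> 2 cproj) \<Rightarrow> nat \<Rightarrow> bool" where
  "covering_of_degree S f d \<longleftrightarrow>
     covering_space S f real_points \<and>
     (\<forall>q\<in>real_points. finite {p \<in> S. f p = q} \<and> card {p \<in> S. f p = q} = d)"

definition degree_partition ::
    "('n::finite) cproj set list \<Rightarrow> ('n cproj \<Rightarrow> 2 cproj) \<Rightarrow> nat list \<Rightarrow> bool" where
  "degree_partition Ss f ds \<longleftrightarrow> list_all2 (\<lambda>S d. covering_of_degree S f d) Ss ds"

definition hyperbolic_wrt :: "'n cproj set \<Rightarrow> (real^'n) set \<Rightarrow> bool" where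
  "hyperbolic_wrt X L \<longleftrightarrow>
     L \<in> codim2_subspaces \<and> complex_points L \<inter> X = {} \<and>
     (\<forall>f\<in>projections_from L. separating X f)"

definition hyperbolicity_locus :: "'n cproj set \<Rightarrow> (real^'n) set set" where
  "hyperbolicity_locus X = {L. hyperbolic_wrt X L}"


section \<open>The Grassmannian of codimension-two subspaces\<close>

text \<open>
  Its Euclidean topology is the quotient topology for \<open>common_zeros\<close> from the space of
  linearly independent pairs of linear forms, that is, from the pairs whose common zeros have
  codimension two.
\<close>

definition form_pairs :: "((real^'n) \<times> (real^'n)) set" where
  "form_pairs = {(a, b). common_zeros a b \<in> codim2_subspaces}"

definition grassmannian :: "(real^'n) set topology" where
  "grassmannian = topology (\<lambda>U. U \<subseteq> codim2_subspaces \<and>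
     openin (top_of_set form_pairs) {(a, b) \<in> form_pairs. common_zeros a b \<in> U})"

lemma openin_grassmannian:
  fixes U :: "(real^'n) set set"
  shows "openin grassmannian U \<longleftrightarrow> U \<subseteq> codim2_subspaces \<and>
     openin (top_of_set form_pairs) {(a, b) \<in> form_pairs. common_zeros a b \<in> U}"
proof -
  let ?P = "\<lambda>U :: (real^'n) set set. {(a, b) \<in> form_pairs. common_zeros a b \<in> U}"
  have "istopology (\<lambda>U. U \<subseteq> codim2_subspaces \<and> openin (top_of_set form_pairs) (?P U))"
    unfolding istopology_def
  proof (intro conjI allI impI)
    fix S T :: "(real^'n) set set"
    assume S: "S \<subseteq> codim2_subspaces \<and> openin (top_of_set form_pairs) (?P S)"
      and T: "T \<subseteq> codim2_subspaces \<and> openin (top_of_set form_pairs) (?P T)"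
    show "S \<inter> T \<subseteq> codim2_subspaces" using S by blast
    have "?P (S \<inter> T) = ?P S \<inter> ?P T" by auto
    then show "openin (top_of_set form_pairs) (?P (S \<inter> T))"
      using S T by (simp only: openin_Int)
  next
    fix K :: "(real^'n) set set set"
    assume K: "\<forall>S\<in>K. S \<subseteq> codim2_subspaces \<and> openin (top_of_set form_pairs) (?P S)"
    show "\<Union>K \<subseteq> codim2_subspaces" using K by blast
    have "?P (\<Union>K) = \<Union>(?P ` K)" by auto
    moreover have "openin (top_of_set form_pairs) (\<Union>(?P ` K))"
      using K by (intro openin_Union) auto
    ultimately show "openin (top_of_set form_pairs) (?P (\<Union>K))" by simp
  qed
  then show ?thesis unfolding grassmannian_def by (simp add: topology_inverse')
qed

lemma topspace_grassmannian:
  "topspace (grassmannian :: (real^'n) set topology) = codim2_subspaces"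
proof
  show "topspace (grassmannian :: (real^'n) set topology) \<subseteq> codim2_subspaces"
    using openin_grassmannian openin_topspace by blast
  have "{(a, b) \<in> form_pairs. common_zeros a b \<in> codim2_subspaces}
      = (form_pairs :: ((real^'n) \<times> (real^'n)) set)"
    unfolding form_pairs_def by auto
  then have "openin grassmannian (codim2_subspaces :: (real^'n) set set)"
    unfolding openin_grassmannian by (simp only: openin_subtopology_self subset_refl simp_thms)
  then show "codim2_subspaces \<subseteq> topspace (grassmannian :: (real^'n) set topology)"
    by (rule openin_subset)
qed

end

theory Submission
  imports Defs
begin

text \<open>
  Projections of \<open>X'\<close> are pencils of conics in the plane. A real flex, found by applying the
  Borsuk--Ulam theorem to the cubic and its Hessian on the sphere, brings the cubic to the form
  \<open>y\<^sup>2 = x (x - a) (x - b)\<close> with \<open>0 < a < b\<close>; with a single real root the real curve would be connected.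
  Every line through a point \<open>e\<close> inside the oval meets the oval in two points and the other
  component in one. If \<open>l\<close> and \<open>m\<close> are linear forms defining \<open>e\<close>, every member of the real pencil of
  \<open>l\<^sup>2 - m\<^sup>2\<close> and \<open>2 l m\<close> is a pair of real lines through \<open>e\<close>, so this pencil has degrees 4 on the
  oval and 2 on the other component. Translation by a two-torsion point on the oval exchanges the two components and
  preserves \<open>2 H\<close>, hence extends to a linear automorphism of the projective 5-space, which carries the
  first pencil to one with degrees 2 and 4.

  A pencil \<open>(q1, q2)\<close> without base points on the oval has a winding number, that of the loop
  \<open>q1 + i q2\<close> along the oval. Up to sign it is locally constant on the hyperbolicity locus, and its
  parity, read off from whether a continuous square root of the loop closes up, is even for
  \<open>(l\<^sup>2 - m\<^sup>2) + i (2 l m) = (l + i m)\<^sup>2\<close> and odd for the translated pencil.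
\<close>

lemma exhaust_6:
  fixes x :: 6
  shows "x = 1 \<or> x = 2 \<or> x = 3 \<or> x = 4 \<or> x = 5 \<or> x = 6"
proof (induct x)
  case (of_int z)
  then have "z = 0 \<or> z = 1 \<or> z = 2 \<or> z = 3 \<or> z = 4 \<or> z = 5" by fastforce
  then show ?case by auto
qed

lemma forall_6: "(\<forall>i::6. P i) \<longleftrightarrow> P 1 \<and> P 2 \<and> P 3 \<and> P 4 \<and> P 5 \<and> P 6"
  by (metis exhaust_6)

lemma UNIV_6: "UNIV = {1, 2, 3, 4, 5, 6::6}"
  using exhaust_6 by auto

lemma sum_6: "sum f (UNIV::6 set) = f 1 + f 2 + f 3 + f 4 + f 5 + f 6"
  unfolding UNIV_6 by (simp add: ac_simps)

lemma vector_6: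
  "(vector [x1, x2, x3, x4, x5, x6] :: 'a::zero^6) $ 1 = x1"
  "(vector [x1, x2, x3, x4, x5, x6] :: 'a::zero^6) $ 2 = x2"
  "(vector [x1, x2, x3, x4, x5, x6] :: 'a::zero^6) $ 3 = x3"
  "(vector [x1, x2, x3, x4, x5, x6] :: 'a::zero^6) $ 4 = x4"
  "(vector [x1, x2, x3, x4, x5, x6] :: 'a::zero^6) $ 5 = x5"
  "(vector [x1, x2, x3, x4, x5, x6] :: 'a::zero^6) $ 6 = x6"
  unfolding vector_def by simp_all

lemma rep_abs_cproj:
  assumes "x \<noteq> 0"
  obtains k where "k \<noteq> 0" "rep_cproj (abs_cproj x) = k *s x"
  using abs_cproj_eq_iff[OF assms rep_cproj_nonzero] abs_rep_cproj by metis

lemma abs_cproj_scale: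
  assumes "x \<noteq> 0" "k \<noteq> 0"
  shows "abs_cproj (k *s x) = abs_cproj x"
  using abs_cproj_eq_iff[of x "k *s x"] assms by (metis vector_mul_eq_0)

lemma open_cproj_iff: "open U \<longleftrightarrow> open {x. x \<noteq> 0 \<and> abs_cproj x \<in> U}"
  by (fact open_cproj_def)

lemma continuous_on_abs_cproj: "continuous_on (- {0}) (abs_cproj :: complex^'n \<Rightarrow> 'n cproj)"
proof (rule continuous_on_open_invariant[THEN iffD2], intro allI impI)
  fix B :: "'n cproj set" assume "open B"
  then have "open {x. x \<noteq> 0 \<and> abs_cproj x \<in> B}" by (simp add: open_cproj_iff)
  then show "\<exists>A. open A \<and> A \<inter> - {0} = abs_cproj -` B \<inter> - {0}"
    by (intro exI[of _ "{x. x \<noteq> 0 \<and> abs_cproj x \<in> B}"]) auto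
qed

lemma continuous_on_compose_abs_cproj:
  assumes "continuous_on S g" "\<And>s. s \<in> S \<Longrightarrow> g s \<noteq> 0"
  shows "continuous_on S (\<lambda>s. abs_cproj (g s))"
  by (rule continuous_on_compose2[OF continuous_on_abs_cproj assms(1)]) (use assms(2) in auto)

lemma rep_abs_homogeneous:
  assumes "x \<noteq> 0" "\<And>k x. k \<noteq> 0 \<Longrightarrow> P (k *s x) \<longleftrightarrow> P x"
  shows "P (rep_cproj (abs_cproj x)) \<longleftrightarrow> P x"
  using rep_abs_cproj[OF assms(1)] assms(2) by metis

lemma open_homogeneous:
  assumes "\<And>k x. k \<noteq> 0 \<Longrightarrow> P (k *s x) \<longleftrightarrow> P x" "open {x. P x}"
  shows "open {p. P (rep_cproj p)}"
proof -
  have "{x. x \<noteq> 0 \<and> abs_cproj x \<in> {p. P (rep_cproj p)}} = - {0} \<inter> {x. P x}"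
    using rep_abs_homogeneous[of _ P] assms(1) by auto
  then show ?thesis using assms(2) by (simp only: open_cproj_iff open_Int open_Compl closed_singleton)
qed

lemma proportional_iff_minors:
  fixes x y :: "complex^'n"
  assumes "x \<noteq> 0" "y \<noteq> 0"
  shows "(\<exists>c. c \<noteq> 0 \<and> y = c *s x) \<longleftrightarrow> (\<forall>i j. x $ i * y $ j = x $ j * y $ i)"
proof
  assume m: "\<forall>i j. x $ i * y $ j = x $ j * y $ i"
  obtain i where i: "x $ i \<noteq> 0" using assms(1) by (auto simp: vec_eq_iff)
  have "y = (y $ i / x $ i) *s x"
  proof (subst vec_eq_iff, intro allI)
    fix j
    show "y $ j = ((y $ i / x $ i) *s x) $ j"
      using m[rule_format, of i j] i by (simp add: field_simps)
  qed
  moreover have "y $ i / x $ i \<noteq> 0" using calculation assms(2) by auto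
  ultimately show "\<exists>c. c \<noteq> 0 \<and> y = c *s x" by blast
qed auto

instance cproj :: (finite) t2_space
proof
  fix p q :: "'a cproj" assume "p \<noteq> q"
  define x where "x = rep_cproj p"
  define h where "h = (\<lambda>y. (\<Sum>i\<in>UNIV. \<Sum>j\<in>UNIV. (norm (x $ i * y $ j - x $ j * y $ i))^2))"
  define y where "y = rep_cproj q"
  have xy: "x \<noteq> 0" "y \<noteq> 0" "p = abs_cproj x" "q = abs_cproj y"
    unfolding x_def y_def by (simp_all add: rep_cproj_nonzero abs_rep_cproj)
  then obtain i j where "x $ i * y $ j \<noteq> x $ j * y $ i"
    using \<open>p \<noteq> q\<close> abs_cproj_eq_iff proportional_iff_minors by metis
  then have "0 < (norm (x $ i * y $ j - x $ j * y $ i))^2" by simp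
  also have "\<dots> \<le> (\<Sum>j\<in>UNIV. (norm (x $ i * y $ j - x $ j * y $ i))^2)"
    by (rule member_le_sum) auto
  also have "\<dots> \<le> h y" unfolding h_def by (rule member_le_sum) (auto intro: sum_nonneg)
  finally have hy: "0 < h y" .
  define t where "t = h y / (2 * norm y ^ 2)"
  have t: "0 < t" "t * norm y ^ 2 < h y" using hy xy(2) by (simp_all add: t_def)
  let ?U = "{p. t * norm (rep_cproj p) ^ 2 > h (rep_cproj p)}"
  let ?V = "{p. t * norm (rep_cproj p) ^ 2 < h (rep_cproj p)}"
  have hk: "h (k *s y) = (norm k)^2 * h y" for k y
  proof -
    have "x $ i * (k *s y) $ j - x $ j * (k *s y) $ i = k * (x $ i * y $ j - x $ j * y $ i)" for i j
      by (simp add: algebra_simps)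
    then show ?thesis
      unfolding h_def by (simp only: norm_mult power_mult_distrib sum_distrib_left)
  qed
  have nk: "t * norm (k *s y) ^ 2 = (norm k)^2 * (t * norm y ^ 2)" for k and y :: "complex^'a"
    by (simp add: norm_vec_def L2_set_def sum_nonneg norm_mult power_mult_distrib sum_distrib_left ac_simps)
  have "open {y. t * norm y ^ 2 > h y}" "open {y. t * norm y ^ 2 < h y}"
    unfolding h_def by (intro open_Collect_less continuous_intros)+
  then have "open ?U" "open ?V"
    by (intro open_homogeneous; simp add: hk nk)+
  moreover have "p \<in> ?U"
    using t(1) xy(1) by (simp add: h_def x_def[symmetric] mult.commute)
  moreover have "q \<in> ?V" using t(2) by (simp add: y_def)
  ultimately show "\<exists>U V. open U \<and> open V \<and> p \<in> U \<and> q \<in> V \<and> U \<inter> V = {}"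
    by (intro exI[of _ ?U] exI[of _ ?V]) auto
qed

section \<open>Linear forms and pencils\<close>

lemma linear_form_scale: "linear_form a (k *s x) = k * linear_form a x"
  unfolding linear_form_def by (simp add: sum_distrib_left ac_simps)

lemma linear_form_combination:
  "linear_form (s *\<^sub>R a + t *\<^sub>R b) x = of_real s * linear_form a x + of_real t * linear_form b x"
  unfolding linear_form_def by (simp add: sum_distrib_left sum.distrib algebra_simps)

lemma continuous_on_linear_form [continuous_intros]:
  "continuous_on S g \<Longrightarrow> continuous_on S (\<lambda>s. linear_form a (g s))"
  unfolding linear_form_def by (intro continuous_intros)

definition complex_vec :: "real^'n \<Rightarrow> complex^'n" where
  "complex_vec v = (\<chi> i. of_real (v $ i))"

lemma complex_vec_nth [simp]: "complex_vec v $ i = of_real (v $ i)"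
  by (simp add: complex_vec_def)

lemma complex_vec_eq_0_iff [simp]: "complex_vec v = 0 \<longleftrightarrow> v = 0"
  by (simp add: vec_eq_iff)

lemma linear_form_complex_vec [simp]: "linear_form a (complex_vec v) = of_real (a \<bullet> v)"
  by (simp add: linear_form_def inner_vec_def)

lemma real_points_eq: "real_points = {abs_cproj (complex_vec v) |v. v \<noteq> 0}"
proof -
  have "\<exists>v. x = complex_vec v \<and> v \<noteq> 0" if "x \<noteq> 0" "\<forall>i. x $ i \<in> \<real>" for x :: "complex^'n"
    using that by (intro exI[of _ "\<chi> i. Re (x $ i)"]) (auto simp: vec_eq_iff complex_is_Real_iff complex_eq_iff)
  moreover have "complex_vec v \<noteq> 0 \<and> (\<forall>i. complex_vec v $ i \<in> \<real>)" if "v \<noteq> 0" for v :: "real^'n"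
    using that by simp
  ultimately show ?thesis unfolding real_points_def by blast
qed

lemma vec2_eq_0_iff: "(vector [u, w] :: 'a::zero^2) = 0 \<longleftrightarrow> u = 0 \<and> w = 0"
  by (simp add: vec_eq_iff forall_2)

lemma abs_cproj_pair_eq_iff:
  assumes "u1 \<noteq> 0 \<or> u2 \<noteq> 0" "w1 \<noteq> 0 \<or> w2 \<noteq> 0"
  shows "abs_cproj (vector [u1, u2] :: complex^2) = abs_cproj (vector [w1, w2]) \<longleftrightarrow> u1 * w2 = u2 * w1"
  using assms by (subst abs_cproj_eq_iff) (auto simp: proportional_iff_minors vec2_eq_0_iff forall_2 ac_simps)

lemma pencil_map_abs:
  assumes "linear_form a x \<noteq> 0 \<or> linear_form b x \<noteq> 0"
  shows "pencil_map a b (abs_cproj x) = abs_cproj (vector [linear_form a x, linear_form b x])"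
proof -
  have "x \<noteq> 0" using assms by (auto simp: linear_form_def)
  then obtain k where k: "k \<noteq> 0" "rep_cproj (abs_cproj x) = k *s x" by (rule rep_abs_cproj)
  show ?thesis unfolding pencil_map_def k(2) linear_form_scale
    using k(1) assms by (subst abs_cproj_pair_eq_iff) auto
qed

lemma continuous_on_vec_components:
  "(\<And>i. continuous_on S (\<lambda>s. f s $ i)) \<Longrightarrow> continuous_on S f"
  using continuous_on_vec_lambda[of S "\<lambda>i s. f s $ i"] by simp

lemma continuous_on_vector_2 [continuous_intros]:
  fixes f g :: "'a::topological_space \<Rightarrow> 'b::{topological_space,zero}"
  assumes "continuous_on S f" "continuous_on S g"
  shows "continuous_on S (\<lambda>s. vector [f s, g s] :: 'b^2)"
proof (rule continuous_on_vec_components)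
  show "continuous_on S (\<lambda>s. (vector [f s, g s] :: 'b^2) $ i)" for i
    using exhaust_2[of i] assms by auto
qed

lemma continuous_on_vector_3 [continuous_intros]:
  fixes f g h :: "'a::topological_space \<Rightarrow> 'b::{topological_space,zero}"
  assumes "continuous_on S f" "continuous_on S g" "continuous_on S h"
  shows "continuous_on S (\<lambda>s. vector [f s, g s, h s] :: 'b^3)"
proof (rule continuous_on_vec_components)
  show "continuous_on S (\<lambda>s. (vector [f s, g s, h s] :: 'b^3) $ i)" for i
    using exhaust_3[of i] assms by auto
qed

lemma continuous_on_veronese_vec [continuous_intros]:
  assumes "continuous_on S g"
  shows "continuous_on S (\<lambda>s. veronese_vec (g s))"
proof (rule continuous_on_vec_components)
  have g: "continuous_on S (\<lambda>s. g s $ i)" for i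
    using assms by (intro continuous_intros)
  show "continuous_on S (\<lambda>s. veronese_vec (g s) $ i)" for i
    using exhaust_6[of i] by (auto simp: veronese_vec_nth intro!: continuous_on_mult g)
qed

lemma continuous_on_pencil_map:
  "continuous_on {p. linear_form a (rep_cproj p) \<noteq> 0 \<or> linear_form b (rep_cproj p) \<noteq> 0} (pencil_map a b)"
proof -
  let ?P = "\<lambda>x. linear_form a x \<noteq> 0 \<or> linear_form b x \<noteq> 0"
  let ?D = "{p. ?P (rep_cproj p)}" and ?E = "{x. ?P x}"
  have inv: "?P (k *s x) \<longleftrightarrow> ?P x" if "k \<noteq> 0" for k x
    using that by (simp add: linear_form_scale)
  have D: "x \<noteq> 0 \<and> abs_cproj x \<in> ?D \<longleftrightarrow> x \<in> ?E" for x
    using rep_abs_homogeneous[of x ?P] inv by (cases "x = 0") (auto simp: linear_form_def)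
  have E: "open ?E"
    by (intro open_Collect_disj open_Collect_neq continuous_intros)
  then have o: "open ?D" using inv by (intro open_homogeneous)
  show "continuous_on ?D (pencil_map a b)"
  proof (rule continuous_on_open_vimage[OF o, THEN iffD2], intro allI impI)
    fix B :: "2 cproj set" assume B: "open B"
    let ?g = "\<lambda>x. abs_cproj (vector [linear_form a x, linear_form b x] :: complex^2)"
    have "continuous_on ?E ?g"
      by (intro continuous_on_compose_abs_cproj continuous_intros) (auto simp: vec2_eq_0_iff)
    then have "open (?g -` B \<inter> ?E)" using E B by (simp add: continuous_on_open_vimage)
    moreover have "{x. x \<noteq> 0 \<and> abs_cproj x \<in> pencil_map a b -` B \<inter> ?D} = ?g -` B \<inter> ?E"
    proof -
      have "x \<noteq> 0 \<and> abs_cproj x \<in> pencil_map a b -` B \<inter> ?D \<longleftrightarrow> x \<in> ?g -` B \<inter> ?E" for x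
      proof (cases "x \<in> ?E")
        case True
        then have "pencil_map a b (abs_cproj x) = ?g x" by (intro pencil_map_abs) simp
        then show ?thesis using D[of x] True by (simp only: Int_iff vimage_eq) blast
      next
        case False
        then show ?thesis using D[of x] by (simp only: Int_iff) blast
      qed
      then show ?thesis by blast
    qed
    ultimately show "open (pencil_map a b -` B \<inter> ?D)" by (simp add: open_cproj_iff)
  qed
qed

lemma open_positive_product:
  "open {p. 0 < Re (linear_form a (rep_cproj p) * cnj (linear_form b (rep_cproj p)))}" (is ?open)
  and positive_product_abs:
  "x \<noteq> 0 \<Longrightarrow>
    0 < Re (linear_form a (rep_cproj (abs_cproj x)) * cnj (linear_form b (rep_cproj (abs_cproj x))))
    \<longleftrightarrow> 0 < Re (linear_form a x * cnj (linear_form b x))" (is "_ \<Longrightarrow> ?abs")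
proof -
  let ?P = "\<lambda>x. 0 < Re (linear_form a x * cnj (linear_form b x))"
  have inv: "?P (k *s x) \<longleftrightarrow> ?P x" if "k \<noteq> 0" for k x
  proof -
    have "k * u * cnj (k * w) = of_real ((norm k)^2) * (u * cnj w)" for u w
      unfolding complex_norm_square by (simp add: ac_simps)
    then have "Re (k * u * cnj (k * w)) = (norm k)^2 * Re (u * cnj w)" for u w
      by (metis Re_complex_of_real scaleR_complex.sel(1) scaleR_conv_of_real)
    then show ?thesis unfolding linear_form_scale using that
      by (simp only: zero_less_mult_iff) (simp del: complex_cnj_mult times_complex.sel)
  qed
  show "x \<noteq> 0 \<Longrightarrow> ?abs" using rep_abs_homogeneous[of x ?P] inv by blast
  have "open {x. ?P x}" by (intro open_Collect_less continuous_intros)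
  with inv show ?open by (intro open_homogeneous)
qed

lemma finite_disjoint_neighbourhoods:
  fixes F :: "'a::t2_space set"
  assumes "finite F"
  obtains W where "\<And>p. p \<in> F \<Longrightarrow> open (W p)" "\<And>p. p \<in> F \<Longrightarrow> p \<in> W p"
    "\<And>p q. p \<in> F \<Longrightarrow> q \<in> F \<Longrightarrow> p \<noteq> q \<Longrightarrow> W p \<inter> W q = {}"
proof -
  have "\<forall>p q :: 'a. \<exists>U V. p \<noteq> q \<longrightarrow> open U \<and> open V \<and> p \<in> U \<and> q \<in> V \<and> U \<inter> V = {}"
    using hausdorff by metis
  then obtain U V where UV: "\<And>p q :: 'a. p \<noteq> q \<Longrightarrow>
      open (U p q) \<and> open (V p q) \<and> p \<in> U p q \<and> q \<in> V p q \<and> U p q \<inter> V p q = {}"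
    by metis
  define W where "W p = (\<Inter>q\<in>F - {p}. U p q \<inter> V q p)" for p
  show ?thesis
  proof
    show "open (W p)" for p
      unfolding W_def using assms UV by (intro open_INT) auto
    have "p \<in> U p q \<inter> V q p" if "q \<noteq> p" for p q
      using UV[of p q] UV[of q p] that by auto
    then show "p \<in> W p" for p unfolding W_def by auto
    show "W p \<inter> W q = {}" if "p \<in> F" "q \<in> F" "p \<noteq> q" for p q
      unfolding W_def using that UV[of p q] by blast
  qed
qed

text \<open>
  Near a point of \<open>T\<close> all fibres lie in the chosen disjoint neighbourhoods of one fibre, at most one
  point in each, hence exactly one point in each because the fibres are equinumerous.
\<close>

lemma covering_space_of_locally_injective:
  fixes f :: "'a::t2_space \<Rightarrow> 'b::t2_space"
  assumes S: "compact S" and f: "continuous_on S f" and T: "f ` S = T"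
    and inj: "\<And>p. p \<in> S \<Longrightarrow> \<exists>U. open U \<and> p \<in> U \<and> inj_on f (S \<inter> U)"
    and card: "\<And>q. q \<in> T \<Longrightarrow> finite {p \<in> S. f p = q} \<and> card {p \<in> S. f p = q} = n"
  shows "covering_space S f T"
  unfolding covering_space_def
proof (intro conjI ballI f T)
  fix q assume q: "q \<in> T"
  define F where "F = {p \<in> S. f p = q}"
  have F: "finite F" "card F = n" using card[OF q] by (simp_all add: F_def)
  obtain U where U: "\<And>p. p \<in> S \<Longrightarrow> open (U p) \<and> p \<in> U p \<and> inj_on f (S \<inter> U p)"
    using inj by metis
  obtain W' where W': "\<And>p. p \<in> F \<Longrightarrow> open (W' p)" "\<And>p. p \<in> F \<Longrightarrow> p \<in> W' p"
    "\<And>p q. p \<in> F \<Longrightarrow> q \<in> F \<Longrightarrow> p \<noteq> q \<Longrightarrow> W' p \<inter> W' q = {}"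
    using finite_disjoint_neighbourhoods[OF F(1)] by metis
  define W where "W p = W' p \<inter> U p" for p
  have FS: "p \<in> S" if "p \<in> F" for p using that by (simp add: F_def)
  have W: "open (W p)" "p \<in> W p" "inj_on f (S \<inter> W p)" if "p \<in> F" for p
    using W'[of p] U[OF FS[OF that]] that by (auto simp: W_def intro: inj_on_subset)
  have disj: "p = p'" if "p \<in> F" "p' \<in> F" "x \<in> W p" "x \<in> W p'" for p p' x
    using W'(3)[of p p'] that by (auto simp: W_def)
  have closed_image: "closed (f ` (S \<inter> C))" if "closed C" for C
    by (intro compact_imp_closed compact_continuous_image compact_Int_closed S that)
      (use f continuous_on_subset in blast)
  have oW: "open (\<Union>p\<in>G. W p)" if "G \<subseteq> F" for G using W that by blast
  define N where "N = T \<inter> - f ` (S \<inter> - (\<Union>p\<in>F. W p))"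
  have cl: "closed (f ` (S \<inter> - (\<Union>p\<in>F. W p)))"
    by (rule closed_image) (simp only: closed_Compl oW subset_refl)
  have inN: "\<exists>p\<in>F. x \<in> W p" if "x \<in> S" "f x \<in> N" for x
    using that unfolding N_def by blast
  have pre: "S \<inter> f -` N = S \<inter> f -` (- f ` (S \<inter> - (\<Union>p\<in>F. W p)))"
    using T by (auto simp: N_def)
  have opre: "openin (top_of_set S) (S \<inter> f -` N)"
    unfolding pre using continuous_openin_preimage_gen[OF f] cl by (simp add: open_Compl)
  define v where "v = (\<lambda>p. S \<inter> W p \<inter> f -` N) ` F"
  show "\<exists>N. q \<in> N \<and> openin (top_of_set T) N \<and>
        (\<exists>v. \<Union>v = S \<inter> f -` N \<and> (\<forall>u\<in>v. openin (top_of_set S) u) \<and> pairwise disjnt v \<and>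
          (\<forall>u\<in>v. \<exists>g. homeomorphism u N f g))"
  proof (intro exI[of _ N] conjI exI[of _ v])
    show "q \<in> N" using q W(2) by (auto simp: N_def F_def)
    show "openin (top_of_set T) N" unfolding N_def using cl by (simp add: openin_open_Int open_Compl)
    show "\<Union>v = S \<inter> f -` N" using inN by (auto simp: v_def)
    have "S \<inter> W p \<inter> f -` N = (S \<inter> f -` N) \<inter> W p" for p by auto
    then show "\<forall>u\<in>v. openin (top_of_set S) u"
      using opre W(1) by (auto simp: v_def intro: openin_Int_open)
    show "pairwise disjnt v"
      unfolding pairwise_def disjnt_def v_def using disj by blast
    show "\<forall>u\<in>v. \<exists>g. homeomorphism u N f g"
    proof
      fix u assume "u \<in> v"
      then obtain p where p: "p \<in> F" "u = S \<inter> W p \<inter> f -` N" by (auto simp: v_def)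
      show "\<exists>g. homeomorphism u N f g"
      proof (rule homeomorphism_injective_closed_map)
        show "continuous_on u f" using f by (rule continuous_on_subset) (auto simp: p)
        show "inj_on f u" using W(3)[OF p(1)] by (rule inj_on_subset) (auto simp: p)
        show "f ` u = N"
        proof
          show "N \<subseteq> f ` u"
          proof
            fix r assume r: "r \<in> N"
            define R where "R = {x \<in> S. f x = r}"
            have R: "finite R" "card R = n" using card[of r] r by (simp_all add: R_def N_def)
            have "\<exists>p\<in>F. x \<in> W p" if "x \<in> R" for x using inN that r by (auto simp: R_def)
            then obtain \<pi> where \<pi>: "\<And>x. x \<in> R \<Longrightarrow> \<pi> x \<in> F \<and> x \<in> W (\<pi> x)" by metis
            have "inj_on \<pi> R"
            proof (rule inj_onI)
              fix x y assume xy: "x \<in> R" "y \<in> R" "\<pi> x = \<pi> y"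
              then have "x \<in> S \<inter> W (\<pi> x)" "y \<in> S \<inter> W (\<pi> x)" "f x = f y"
                using \<pi>[of x] \<pi>[of y] by (auto simp: R_def)
              then show "x = y" using W(3) \<pi> xy(1) by (meson inj_onD)
            qed
            then have "\<pi> ` R = F"
              using \<pi> F R by (intro card_subset_eq) (auto simp: card_image)
            then obtain x where x: "x \<in> R" "\<pi> x = p" using p(1) by blast
            then show "r \<in> f ` u" using \<pi>[of x] r by (auto simp: R_def p)
          qed
        qed (auto simp: p)
      next
        fix C assume "closedin (top_of_set u) C"
        then obtain D where D: "closed D" "C = u \<inter> D" by (auto simp: closedin_closed)
        have "f ` C = N \<inter> f ` (S \<inter> (D \<inter> - (\<Union>p'\<in>F - {p}. W p')))"
        proof
          show "f ` C \<subseteq> N \<inter> f ` (S \<inter> (D \<inter> - (\<Union>p'\<in>F - {p}. W p')))"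
            using disj[OF p(1)] by (auto simp: D p intro!: imageI)
          show "N \<inter> f ` (S \<inter> (D \<inter> - (\<Union>p'\<in>F - {p}. W p'))) \<subseteq> f ` C"
            using inN by (fastforce simp: D p)
        qed
        moreover have "closed (D \<inter> - (\<Union>p'\<in>F - {p}. W p'))"
          by (intro closed_Int D(1)) (simp only: closed_Compl oW Diff_subset)
        ultimately show "closedin (top_of_set N) (f ` C)"
          using closed_image by (simp add: closedin_closed_Int)
      qed blast
    qed
  qed
qed

section \<open>Monodromy of the square root along a loop\<close>

definition sqrt_monodromy :: "complex \<Rightarrow> (real \<Rightarrow> complex) \<Rightarrow> bool" where
  "sqrt_monodromy \<sigma> z \<longleftrightarrow>
    (\<exists>w. continuous_on {0..1} w \<and> w 1 = \<sigma> * w 0 \<and> (\<forall>t\<in>{0..1}. z t = (w t)^2))"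

lemma sqrt_monodromy_unique:
  assumes nz: "\<And>t. t \<in> {0..1} \<Longrightarrow> z t \<noteq> 0"
    and "sqrt_monodromy \<sigma> z" "sqrt_monodromy \<tau> z"
  shows "\<sigma> = \<tau>"
proof -
  obtain w where w: "continuous_on {0..1} w" "w 1 = \<sigma> * w 0" "\<And>t. t \<in> {0..1} \<Longrightarrow> z t = (w t)^2"
    using assms(2) unfolding sqrt_monodromy_def by blast
  obtain v where v: "continuous_on {0..1} v" "v 1 = \<tau> * v 0" "\<And>t. t \<in> {0..1} \<Longrightarrow> z t = (v t)^2"
    using assms(3) unfolding sqrt_monodromy_def by blast
  have vnz: "v t \<noteq> 0" if "t \<in> {0..1}" for t using nz v(3) that by force
  have wnz: "w t \<noteq> 0" if "t \<in> {0..1}" for t using nz w(3) that by force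
  let ?r = "\<lambda>t. w t / v t"
  have "(?r t)^2 = 1" if "t \<in> {0..1}" for t
    using w(3)[OF that] v(3)[OF that] vnz[OF that] wnz[OF that] by (simp add: power_divide)
  then have r: "?r t \<in> {1, -1}" if "t \<in> {0..1}" for t
    using that by (metis insert_iff power2_eq_1_iff)
  have "?r constant_on {0..1}"
  proof (rule continuous_finite_range_constant)
    show "continuous_on {0..1} ?r" using w(1) v(1) vnz by (intro continuous_on_divide) auto
    show "finite (?r ` {0..1})" by (rule finite_subset[of _ "{1, -1}"]) (use r in blast, simp)
  qed simp
  then have "?r 0 = ?r 1" by (auto simp: constant_on_def)
  moreover have "v 1 \<noteq> 0" "v 0 \<noteq> 0" "w 0 \<noteq> 0" "w 1 \<noteq> 0" using vnz wnz by auto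
  ultimately show ?thesis using w(2) v(2) by (simp add: field_simps)
qed

lemma sqrt_monodromy_exists:
  assumes "continuous_on {0..1} z" "\<And>t. t \<in> {0..1} \<Longrightarrow> z t \<noteq> 0" "z 0 = z 1"
  shows "sqrt_monodromy 1 z \<or> sqrt_monodromy (-1) z"
proof -
  obtain w where w: "continuous_on {0..1} w" "\<And>t. t \<in> {0..1::real} \<Longrightarrow> z t = (w t)^2"
    by (rule continuous_sqrt_on_contractible[OF assms(1) _ assms(2)])
      (auto intro: convex_imp_contractible)
  have "(w 1)^2 = (w 0)^2" using w(2)[of 0] w(2)[of 1] assms(3) by simp
  then have "w 1 = w 0 \<or> w 1 = - w 0" by (simp add: power2_eq_iff)
  then show ?thesis unfolding sqrt_monodromy_def using w by auto
qed

lemma sqrt_monodromy_perturb: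
  assumes "sqrt_monodromy \<sigma> z" "continuous_on {0..1} u" "\<And>t. t \<in> {0..1} \<Longrightarrow> 0 < Re (u t)"
    "u 0 = u 1" "\<And>t. t \<in> {0..1} \<Longrightarrow> z' t = k * z t * u t"
  shows "sqrt_monodromy \<sigma> z'"
proof -
  obtain w where w: "continuous_on {0..1} w" "w 1 = \<sigma> * w 0" "\<And>t. t \<in> {0..1} \<Longrightarrow> z t = (w t)^2"
    using assms(1) unfolding sqrt_monodromy_def by blast
  have "continuous_on {0..1} (\<lambda>t. csqrt (u t))"
  proof (rule continuous_on_compose2[OF _ assms(2)])
    show "continuous_on {c. 0 < Re c} csqrt"
      by (intro continuous_at_imp_continuous_on ballI continuous_at_csqrt) (auto simp: complex_nonpos_Reals_iff)
    show "u ` {0..1} \<subseteq> {c. 0 < Re c}" using assms(3) by auto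
  qed
  then show ?thesis
    unfolding sqrt_monodromy_def using w assms(4,5)
    by (intro exI[of _ "\<lambda>t. csqrt k * w t * csqrt (u t)"])
      (auto intro!: continuous_intros simp: power_mult_distrib)
qed

lemma sqrt_monodromy_cnj:
  assumes "sqrt_monodromy \<sigma> z" "\<sigma> \<in> \<real>"
  shows "sqrt_monodromy \<sigma> (\<lambda>t. cnj (z t))"
proof -
  obtain w where w: "continuous_on {0..1} w" "w 1 = \<sigma> * w 0" "\<And>t. t \<in> {0..1} \<Longrightarrow> z t = (w t)^2"
    using assms(1) unfolding sqrt_monodromy_def by blast
  then show ?thesis unfolding sqrt_monodromy_def using assms(2)
    by (intro exI[of _ "\<lambda>t. cnj (w t)"]) (auto intro!: continuous_intros simp: Reals_cnj_iff)
qed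

lemma sqrt_monodromy_real_linear:
  fixes x y :: "real \<Rightarrow> real"
  assumes \<sigma>: "\<sigma> \<in> \<real>" and m: "sqrt_monodromy \<sigma> (\<lambda>t. Complex (x t) (y t))"
    and c: "continuous_on {0..1} x" "continuous_on {0..1} y"
    and nz: "\<And>t. t \<in> {0..1} \<Longrightarrow> Complex (x t) (y t) \<noteq> 0"
    and closed: "x 0 = x 1" "y 0 = y 1"
    and det: "g11 * g22 - g12 * g21 \<noteq> (0::real)"
  shows "sqrt_monodromy \<sigma> (\<lambda>t. Complex (g11 * x t + g12 * y t) (g21 * x t + g22 * y t))"
proof -
  define \<alpha> where "\<alpha> = Complex ((g11 + g22) / 2) ((g21 - g12) / 2)"
  define \<beta> where "\<beta> = Complex ((g11 - g22) / 2) ((g21 + g12) / 2)"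
  have eq: "Complex (g11 * X + g12 * Y) (g21 * X + g22 * Y) = \<alpha> * Complex X Y + \<beta> * cnj (Complex X Y)" for X Y
    by (simp add: \<alpha>_def \<beta>_def complex_eq_iff algebra_simps add_divide_distrib diff_divide_distrib)
  have nrm: "(norm \<alpha>)^2 - (norm \<beta>)^2 = g11 * g22 - g12 * g21"
    unfolding \<alpha>_def \<beta>_def cmod_power2 complex.sel by (simp add: power2_eq_square field_simps)
  have pos: "0 < Re (1 + s * (cnj Z / Z))" if "norm s < 1" "Z \<noteq> 0" for s Z
  proof -
    have "norm (s * (cnj Z / Z)) < 1" using that by (simp add: norm_mult norm_divide)
    then show ?thesis using abs_Re_le_cmod[of "s * (cnj Z / Z)"] by simp
  qed
  let ?z = "\<lambda>t. Complex (x t) (y t)"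
  have cz: "continuous_on {0..1} ?z"
    using c by (intro continuous_on_Complex)
  show ?thesis
  proof (cases "norm \<beta> < norm \<alpha>")
    case True
    then have "\<alpha> \<noteq> 0" using norm_ge_zero[of \<beta>] by auto
    moreover have "norm (\<beta> / \<alpha>) < 1" using True calculation by (simp add: norm_divide)
    ultimately have ab: "\<alpha> \<noteq> 0" "norm (\<beta> / \<alpha>) < 1" by simp_all
    show ?thesis
    proof (rule sqrt_monodromy_perturb[OF m, where u = "\<lambda>t. 1 + \<beta> / \<alpha> * (cnj (?z t) / ?z t)" and k = \<alpha>])
      show "continuous_on {0..1} (\<lambda>t. 1 + \<beta> / \<alpha> * (cnj (?z t) / ?z t))"
        using c nz by (intro continuous_intros) auto
      show "0 < Re (1 + \<beta> / \<alpha> * (cnj (?z t) / ?z t))" if "t \<in> {0..1}" for t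
        using pos ab nz that by blast
      show "Complex (g11 * x t + g12 * y t) (g21 * x t + g22 * y t)
          = \<alpha> * ?z t * (1 + \<beta> / \<alpha> * (cnj (?z t) / ?z t))" if "t \<in> {0..1}" for t
        using ab(1) nz[OF that] unfolding eq by (simp add: distrib_left)
    qed (simp add: closed)
  next
    case False
    moreover have "norm \<beta> \<noteq> norm \<alpha>" using nrm det by auto
    ultimately have lt: "norm \<alpha> < norm \<beta>" by simp
    then have "\<beta> \<noteq> 0" using norm_ge_zero[of \<alpha>] by auto
    then have *: "\<beta> \<noteq> 0" "norm (\<alpha> / \<beta>) < 1" using lt by (simp_all add: norm_divide)
    show ?thesis
    proof (rule sqrt_monodromy_perturb[OF sqrt_monodromy_cnj[OF m \<sigma>],
          where u = "\<lambda>t. 1 + \<alpha> / \<beta> * (?z t / cnj (?z t))" and k = \<beta>])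
      show "continuous_on {0..1} (\<lambda>t. 1 + \<alpha> / \<beta> * (?z t / cnj (?z t)))"
        using c nz by (intro continuous_intros) auto
      show "0 < Re (1 + \<alpha> / \<beta> * (?z t / cnj (?z t)))" if "t \<in> {0..1}" for t
        using pos[OF *(2), of "cnj (?z t)"] nz[OF that]
        by (simp only: complex_cnj_cnj complex_cnj_zero_iff not_False_eq_True)
      show "Complex (g11 * x t + g12 * y t) (g21 * x t + g22 * y t)
          = \<beta> * cnj (?z t) * (1 + \<alpha> / \<beta> * (?z t / cnj (?z t)))" if "t \<in> {0..1}" for t
      proof -
        have "cnj (?z t) \<noteq> 0" using nz[OF that] by (simp only: complex_cnj_zero_iff not_False_eq_True)
        then show ?thesis using *(1) unfolding eq by (simp add: distrib_left del: complex_cnj)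
      qed
    qed (simp add: closed)
  qed
qed

section \<open>Independent pairs of linear forms\<close>

lemma common_zeros_eq: "common_zeros a b = (span {a, b})\<^sup>\<bottom>"
proof -
  have "orthogonal v w" if "a \<bullet> v = 0" "b \<bullet> v = 0" "w \<in> span {a, b}" for v w
    using orthogonal_to_span[of w "{a, b}" v] that by (auto simp: orthogonal_def inner_commute)
  then show ?thesis
    by (auto simp: common_zeros_def orthogonal_comp_def orthogonal_commute)
      (metis inner_commute insertI1 insertI2 orthogonal_def span_base)+
qed

lemma dim_common_zeros:
  fixes a b :: "real^'n"
  shows "dim (common_zeros a b) + dim {a, b} = CARD('n)"
  using dim_subspace_orthogonal_to_vectors[of "span {a, b}" UNIV]
  unfolding common_zeros_eq orthogonal_comp_def
  by (simp add: orthogonal_commute)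

lemma subspace_common_zeros: "subspace (common_zeros a b)"
  unfolding common_zeros_eq by (rule subspace_orthogonal_comp)

lemma codim2_iff:
  fixes a b :: "real^'n"
  shows "common_zeros a b \<in> codim2_subspaces \<longleftrightarrow>
    (\<forall>s t. s *\<^sub>R a + t *\<^sub>R b = 0 \<longrightarrow> s = 0 \<and> t = 0)"
proof -
  have "common_zeros a b \<in> codim2_subspaces \<longleftrightarrow> dim {a, b} = 2"
    using dim_common_zeros[of a b] by (auto simp: codim2_subspaces_def subspace_common_zeros)
  also have "\<dots> \<longleftrightarrow> (\<forall>s t. s *\<^sub>R a + t *\<^sub>R b = 0 \<longrightarrow> s = 0 \<and> t = 0)"
  proof
    assume d: "dim {a, b} = 2"
    show "\<forall>s t. s *\<^sub>R a + t *\<^sub>R b = 0 \<longrightarrow> s = 0 \<and> t = 0"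
    proof (intro allI impI)
      fix s t assume st: "s *\<^sub>R a + t *\<^sub>R b = 0"
      have one: "dim {a, b} \<le> 1" if "a \<in> span {c} \<and> b \<in> span {c}" for c
        using dim_subset[of "{a, b}" "span {c}"] that dim_le_card'[of "{c}"] by simp
      have "s = 0"
      proof (rule ccontr)
        assume "s \<noteq> 0"
        have "a = (1 / s) *\<^sub>R (s *\<^sub>R a)" using \<open>s \<noteq> 0\<close> by simp
        also have "s *\<^sub>R a = (- t) *\<^sub>R b" using st by (simp add: add_eq_0_iff)
        finally have "a \<in> span {b}" by (metis insertI1 span_base span_scale)
        then have "dim {a, b} \<le> 1" using one[of b] by (simp add: span_base)
        then show False using d by simp
      qed
      moreover have "t = 0" if "s = 0"
      proof (rule ccontr)
        assume "t \<noteq> 0"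
        then have "b = 0" using st that by simp
        then have "a \<in> span {a} \<and> b \<in> span {a}" by (simp add: span_base span_zero)
        then show False using one d by fastforce
      qed
      ultimately show "s = 0 \<and> t = 0" by blast
    qed
  next
    assume i: "\<forall>s t. s *\<^sub>R a + t *\<^sub>R b = 0 \<longrightarrow> s = 0 \<and> t = 0"
    have "a \<noteq> b" using i[rule_format, of 1 "-1"] by auto
    moreover have "independent {a, b}"
    proof (rule independent_insertI)
      show "a \<notin> span {b}"
      proof
        assume "a \<in> span {b}"
        then obtain k where "a = k *\<^sub>R b" by (auto simp: span_singleton)
        then show False using i[rule_format, of 1 "-k"] by simp
      qed
      show "independent {b}" using i[rule_format, of 0 1] by (auto simp: dependent_single)
    qed
    ultimately show "dim {a, b} = 2" by (simp add: dim_eq_card_independent)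
  qed
  finally show ?thesis .
qed

lemma common_zeros_eq_imp_combination:
  fixes a b a' b' :: "real^'n"
  assumes "common_zeros a b = common_zeros a' b'" "common_zeros a b \<in> codim2_subspaces"
  obtains g11 g12 g21 g22 where "a' = g11 *\<^sub>R a + g12 *\<^sub>R b" "b' = g21 *\<^sub>R a + g22 *\<^sub>R b"
    "g11 * g22 - g12 * g21 \<noteq> 0"
proof -
  have "span {a, b} = span {a', b'}"
    using assms(1) unfolding common_zeros_eq by (metis orthogonal_comp_self subspace_span)
  then have "a' \<in> span {a, b}" "b' \<in> span {a, b}" by (auto intro: span_base)
  then obtain g11 g12 g21 g22 where g: "a' = g11 *\<^sub>R a + g12 *\<^sub>R b" "b' = g21 *\<^sub>R a + g22 *\<^sub>R b"
    by (auto simp: span_insert span_singleton) (metis add_diff_cancel_left' diff_add_cancel add.commute)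
  have i: "\<forall>s t. s *\<^sub>R a' + t *\<^sub>R b' = 0 \<longrightarrow> s = 0 \<and> t = 0"
    using assms codim2_iff by metis
  have "g11 * g22 - g12 * g21 \<noteq> 0"
  proof
    assume d: "g11 * g22 - g12 * g21 = 0"
    have "g22 *\<^sub>R a' + (- g12) *\<^sub>R b' = (g11 * g22 - g12 * g21) *\<^sub>R a"
      "(- g21) *\<^sub>R a' + g11 *\<^sub>R b' = (g11 * g22 - g12 * g21) *\<^sub>R b"
      unfolding g by (simp_all add: algebra_simps)
    then have "g11 = 0" "g12 = 0" "g21 = 0" "g22 = 0"
      using i d by (metis neg_equal_0_iff_equal scaleR_zero_left)+
    then show False using i[rule_format, of 1 0] g by simp
  qed
  then show thesis using g that by blast
qed

definition pair_loop :: "(real \<Rightarrow> real^'n) \<Rightarrow> real^'n \<Rightarrow> real^'n \<Rightarrow> real \<Rightarrow> complex" where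
  "pair_loop \<gamma> a b t = Complex (a \<bullet> \<gamma> t) (b \<bullet> \<gamma> t)"

definition loop_type :: "(real \<Rightarrow> real^'n) \<Rightarrow> complex \<Rightarrow> real^'n \<Rightarrow> real^'n \<Rightarrow> bool" where
  "loop_type \<gamma> \<sigma> a b \<longleftrightarrow>
    (\<forall>t\<in>{0..1}. pair_loop \<gamma> a b t \<noteq> 0) \<and> sqrt_monodromy \<sigma> (pair_loop \<gamma> a b)"

lemma loop_type_cong:
  fixes \<gamma> :: "real \<Rightarrow> real^'n"
  assumes \<gamma>: "continuous_on {0..1} \<gamma>" "\<gamma> 0 = \<gamma> 1" and \<sigma>: "\<sigma> \<in> \<real>"
    and eq: "common_zeros a b = common_zeros a' b'" "common_zeros a b \<in> codim2_subspaces"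
    and t: "loop_type \<gamma> \<sigma> a b"
  shows "loop_type \<gamma> \<sigma> a' b'"
proof -
  obtain g11 g12 g21 g22 where g: "a' = g11 *\<^sub>R a + g12 *\<^sub>R b" "b' = g21 *\<^sub>R a + g22 *\<^sub>R b"
    "g11 * g22 - g12 * g21 \<noteq> 0"
    using common_zeros_eq_imp_combination[OF eq] .
  have "pair_loop \<gamma> a' b' t \<noteq> 0" if "t \<in> {0..1}" for t
  proof
    assume "pair_loop \<gamma> a' b' t = 0"
    then have "\<gamma> t \<in> common_zeros a' b'" by (simp add: pair_loop_def common_zeros_def complex_eq_iff)
    then have "pair_loop \<gamma> a b t = 0"
      unfolding eq(1)[symmetric] by (simp add: pair_loop_def common_zeros_def complex_eq_iff)
    then show False using t that by (simp add: loop_type_def)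
  qed
  moreover have "sqrt_monodromy \<sigma> (pair_loop \<gamma> a' b')"
  proof -
    have "sqrt_monodromy \<sigma> (\<lambda>s. Complex (g11 * (a \<bullet> \<gamma> s) + g12 * (b \<bullet> \<gamma> s)) (g21 * (a \<bullet> \<gamma> s) + g22 * (b \<bullet> \<gamma> s)))"
      using t by (intro sqrt_monodromy_real_linear \<sigma> g(3) continuous_intros \<gamma>)
        (simp_all add: loop_type_def pair_loop_def[abs_def] \<gamma>(2))
    then show ?thesis
      by (simp add: g pair_loop_def[abs_def] inner_add_left)
  qed
  ultimately show ?thesis by (simp add: loop_type_def)
qed

lemma open_loop_type:
  fixes \<gamma> :: "real \<Rightarrow> real^'n"
  assumes \<gamma>: "continuous_on {0..1} \<gamma>" "\<gamma> 0 = \<gamma> 1"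
  shows "open {(a, b). loop_type \<gamma> \<sigma> a b}"
  unfolding open_dist
proof (intro ballI)
  fix ab assume "ab \<in> {(a, b). loop_type \<gamma> \<sigma> a b}"
  then obtain a b where ab: "ab = (a, b)" "loop_type \<gamma> \<sigma> a b" by auto
  have cont: "continuous_on {0..1} (pair_loop \<gamma> a b)" for a b
    unfolding pair_loop_def by (intro continuous_on_Complex continuous_intros \<gamma>)
  have "compact (pair_loop \<gamma> a b ` {0..1})" by (intro compact_continuous_image cont) simp
  then have "closed (pair_loop \<gamma> a b ` {0..1})" by (rule compact_imp_closed)
  moreover have "0 \<notin> pair_loop \<gamma> a b ` {0..1}" using ab(2) by (force simp: loop_type_def)
  ultimately obtain m where m: "m > 0" "\<And>t. t \<in> {0..1} \<Longrightarrow> m \<le> norm (pair_loop \<gamma> a b t)"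
    by (auto dest!: separate_point_closed)
  have "bounded (\<gamma> ` {0..1})"
    by (intro compact_imp_bounded compact_continuous_image \<gamma>) simp
  then obtain K where K: "K > 0" "\<And>t. t \<in> {0..1} \<Longrightarrow> norm (\<gamma> t) \<le> K"
    by (auto simp: bounded_pos)
  show "\<exists>e>0. \<forall>y. dist y ab < e \<longrightarrow> y \<in> {(a, b). loop_type \<gamma> \<sigma> a b}"
  proof (intro exI[of _ "m / (2 * K)"] conjI allI impI)
    show "0 < m / (2 * K)" using m(1) K(1) by simp
    fix y assume y: "dist y ab < m / (2 * K)"
    obtain a' b' where y': "y = (a', b')" by (cases y)
    have d: "norm (a' - a) < m / (2 * K)" "norm (b' - b) < m / (2 * K)"
      using y dist_fst_le[of y ab] dist_snd_le[of y ab] by (simp_all add: ab y' dist_norm)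
    have close: "norm (pair_loop \<gamma> a' b' t - pair_loop \<gamma> a b t) < m" if t: "t \<in> {0..1}" for t
    proof -
      have s: "\<bar>c \<bullet> \<gamma> t\<bar> < m / 2" if "norm c < m / (2 * K)" for c
      proof -
        have "\<bar>c \<bullet> \<gamma> t\<bar> \<le> norm c * norm (\<gamma> t)" by (rule Cauchy_Schwarz_ineq2)
        also have "\<dots> \<le> norm c * K" using K(2)[OF t] by (intro mult_left_mono) auto
        also have "\<dots> < m / (2 * K) * K" using that K(1) by (intro mult_strict_right_mono)
        also have "\<dots> = m / 2" using K(1) by simp
        finally show ?thesis .
      qed
      have "pair_loop \<gamma> a' b' t - pair_loop \<gamma> a b t = Complex ((a' - a) \<bullet> \<gamma> t) ((b' - b) \<bullet> \<gamma> t)"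
        by (simp add: pair_loop_def inner_diff_left complex_eq_iff)
      then have "norm (pair_loop \<gamma> a' b' t - pair_loop \<gamma> a b t) \<le> \<bar>(a' - a) \<bullet> \<gamma> t\<bar> + \<bar>(b' - b) \<bullet> \<gamma> t\<bar>"
        using cmod_le[of "Complex ((a' - a) \<bullet> \<gamma> t) ((b' - b) \<bullet> \<gamma> t)"] by simp
      then show ?thesis using s[OF d(1)] s[OF d(2)] by linarith
    qed
    define u where "u t = pair_loop \<gamma> a' b' t / pair_loop \<gamma> a b t" for t
    have nz: "pair_loop \<gamma> a b t \<noteq> 0" if "t \<in> {0..1}" for t using m that by force
    have u: "0 < Re (u t)" if t: "t \<in> {0..1}" for t
    proof -
      have "u t - 1 = (pair_loop \<gamma> a' b' t - pair_loop \<gamma> a b t) / pair_loop \<gamma> a b t"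
        using nz[OF t] by (simp add: u_def diff_divide_distrib)
      then have "norm (u t - 1) < 1"
        using close[OF t] m(2)[OF t] nz[OF t] by (simp add: norm_divide)
      then show ?thesis using abs_Re_le_cmod[of "u t - 1"] by simp
    qed
    have "sqrt_monodromy \<sigma> (pair_loop \<gamma> a' b')"
    proof (rule sqrt_monodromy_perturb[where u = u and k = 1])
      show "sqrt_monodromy \<sigma> (pair_loop \<gamma> a b)" using ab(2) by (simp add: loop_type_def)
      show "continuous_on {0..1} u" unfolding u_def using nz by (intro continuous_on_divide cont) auto
      show "u 0 = u 1" by (simp add: u_def pair_loop_def \<gamma>(2))
      show "pair_loop \<gamma> a' b' t = 1 * pair_loop \<gamma> a b t * u t" if "t \<in> {0..1}" for t
        using nz[OF that] by (simp add: u_def)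
    qed (use u in auto)
    moreover have "pair_loop \<gamma> a' b' t \<noteq> 0" if "t \<in> {0..1}" for t
      using u[OF that] by (auto simp: u_def)
    ultimately show "y \<in> {(a, b). loop_type \<gamma> \<sigma> a b}" by (simp add: y' loop_type_def)
  qed
qed

lemma openin_loop_type:
  fixes \<gamma> :: "real \<Rightarrow> real^'n"
  assumes \<gamma>: "continuous_on {0..1} \<gamma>" "\<gamma> 0 = \<gamma> 1" and \<sigma>: "\<sigma> \<in> \<real>"
  shows "openin grassmannian {L \<in> codim2_subspaces. \<exists>a b. common_zeros a b = L \<and> loop_type \<gamma> \<sigma> a b}"
    (is "openin grassmannian ?U")
proof -
  have "{(a, b) \<in> form_pairs. common_zeros a b \<in> ?U} = form_pairs \<inter> {(a, b). loop_type \<gamma> \<sigma> a b}"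
    using loop_type_cong[OF \<gamma> \<sigma>] by (auto simp: form_pairs_def)
  then show ?thesis
    unfolding openin_grassmannian using open_loop_type[OF \<gamma>, of \<sigma>] by (auto simp: openin_open_Int)
qed

text \<open>
  On subspaces avoiding the loop \<open>\<gamma>\<close>, whether the winding number of the pencil along \<open>\<gamma>\<close> is
  even or odd is locally constant.
\<close>

lemma disconnected_by_loop_type:
  fixes \<gamma> :: "real \<Rightarrow> real^'n"
  assumes \<gamma>: "continuous_on {0..1} \<gamma>" "\<gamma> 0 = \<gamma> 1"
    and H: "H \<subseteq> codim2_subspaces" "\<And>L t. L \<in> H \<Longrightarrow> t \<in> {0..1} \<Longrightarrow> \<gamma> t \<notin> L"
    and 1: "common_zeros a1 b1 \<in> H" "sqrt_monodromy 1 (pair_loop \<gamma> a1 b1)"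
    and 2: "common_zeros a2 b2 \<in> H" "sqrt_monodromy (-1) (pair_loop \<gamma> a2 b2)"
    and C: "connectedin (subtopology grassmannian H) C"
    and mem: "common_zeros a1 b1 \<in> C" "common_zeros a2 b2 \<in> C"
  shows False
proof -
  let ?U = "\<lambda>\<sigma>. {L \<in> codim2_subspaces. \<exists>a b. common_zeros a b = L \<and> loop_type \<gamma> \<sigma> a b}"
  have CH: "C \<subseteq> H" using connectedin_subset_topspace[OF C] by auto
  have nz: "pair_loop \<gamma> a b t \<noteq> 0" if "common_zeros a b \<in> H" "t \<in> {0..1}" for a b t
    using H(2)[OF that] by (auto simp: pair_loop_def common_zeros_def complex_eq_iff)
  have cover: "C \<subseteq> ?U 1 \<union> ?U (-1)"
  proof
    fix L assume "L \<in> C"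
    then have L: "L \<in> H" "L \<in> codim2_subspaces" using CH H(1) by auto
    then obtain a b where ab: "common_zeros a b = L"
      using projections_from_nonempty[of L] by (auto simp: projections_from_def)
    have "continuous_on {0..1} (pair_loop \<gamma> a b)"
      unfolding pair_loop_def by (intro continuous_on_Complex continuous_intros \<gamma>)
    moreover have "pair_loop \<gamma> a b 0 = pair_loop \<gamma> a b 1" by (simp add: pair_loop_def \<gamma>(2))
    ultimately have "sqrt_monodromy 1 (pair_loop \<gamma> a b) \<or> sqrt_monodromy (-1) (pair_loop \<gamma> a b)"
      using nz ab L(1) by (intro sqrt_monodromy_exists) auto
    then show "L \<in> ?U 1 \<union> ?U (-1)" using nz ab L by (auto simp: loop_type_def)
  qed
  have disjoint: "?U 1 \<inter> ?U (-1) = {}"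
  proof (rule ccontr)
    assume "\<not> ?thesis"
    then obtain L a b a' b' where L: "L \<in> codim2_subspaces" "common_zeros a b = L" "loop_type \<gamma> 1 a b"
      "common_zeros a' b' = L" "loop_type \<gamma> (-1) a' b'" by blast
    then have "loop_type \<gamma> 1 a' b'" using loop_type_cong[OF \<gamma>, of 1 a b a' b'] by auto
    then have "(1::complex) = -1"
      using L(5) sqrt_monodromy_unique[of "pair_loop \<gamma> a' b'"] unfolding loop_type_def by blast
    then show False by simp
  qed
  have o: "openin grassmannian (?U 1)" "openin grassmannian (?U (-1))"
    by (rule openin_loop_type[OF \<gamma>]; simp)+
  have Cg: "connectedin grassmannian C" using C by (simp add: connectedin_subtopology)
  have t: "loop_type \<gamma> 1 a1 b1" "loop_type \<gamma> (-1) a2 b2"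
    using 1 2 nz by (simp_all add: loop_type_def)
  have ne: "?U 1 \<inter> C \<noteq> {}" "?U (-1) \<inter> C \<noteq> {}"
  proof -
    have "common_zeros a1 b1 \<in> ?U 1 \<inter> C" using t(1) 1(1) mem(1) H(1) by blast
    then show "?U 1 \<inter> C \<noteq> {}" by (metis empty_iff)
    have "common_zeros a2 b2 \<in> ?U (-1) \<inter> C" using t(2) 2(1) mem(2) H(1) by blast
    then show "?U (-1) \<inter> C \<noteq> {}" by (metis empty_iff)
  qed
  have dC: "?U 1 \<inter> ?U (-1) \<inter> C = {}" unfolding disjoint by (rule Int_empty_left)
  have "\<exists>E1 E2. openin grassmannian E1 \<and> openin grassmannian E2 \<and> C \<subseteq> E1 \<union> E2 \<and>
      E1 \<inter> E2 \<inter> C = {} \<and> E1 \<inter> C \<noteq> {} \<and> E2 \<inter> C \<noteq> {}"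
    by (rule exI[of _ "?U 1"], rule exI[of _ "?U (-1)"]) (intro conjI o cover dC ne)
  then show False using Cg[unfolded connectedin] by (elim conjE notE)
qed

section \<open>A Borsuk--Ulam argument\<close>

lemma odd_map_on_sphere_has_zero:
  fixes g :: "real^3 \<Rightarrow> complex"
  assumes cont: "continuous_on (sphere 0 1) g"
    and odd: "\<And>v. g (- v) = - g v"
  obtains v where "norm v = 1" "g v = 0"
proof (rule ccontr)
  assume no: "\<not> thesis"
  then have nz: "g v \<noteq> 0" if "norm v = 1" for v using that \<open>\<And>v. norm v = 1 \<Longrightarrow> g v = 0 \<Longrightarrow> thesis\<close> by blast
  define \<phi> :: "complex \<Rightarrow> real^3" where
    "\<phi> z = vector [Re z, Im z, sqrt (1 - (norm z)^2)]" for z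
  have nphi: "norm (\<phi> z) = 1" if "norm z \<le> 1" for z
  proof -
    have "(norm z)^2 \<le> 1" using that by (simp add: power_le_one)
    then have "(norm (\<phi> z))^2 = 1"
      unfolding norm_vec_def L2_set_def
      by (simp add: \<phi>_def sum_3 cmod_power2)
    then show ?thesis using norm_ge_zero[of "\<phi> z"] by (auto simp: power2_eq_1_iff simp del: norm_ge_zero)
  qed
  have cphi: "continuous_on (cball 0 1) \<phi>"
    unfolding \<phi>_def by (intro continuous_intros)
  have "continuous_on (cball 0 1) (\<lambda>z. g (\<phi> z))"
    by (rule continuous_on_compose2[OF cont cphi]) (auto simp: nphi)
  moreover have "g (\<phi> z) \<noteq> 0" if "z \<in> cball 0 1" for z using that nz nphi by simp
  ultimately obtain h where h: "continuous_on (cball 0 1) h"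
    "\<And>z. z \<in> cball 0 1 \<Longrightarrow> g (\<phi> z) = exp (h z)"
    using continuous_logarithm_on_cball by (metis (no_types, lifting))
  have bd: "exp (h (- z) - h z) = -1" if "norm z = 1" for z
  proof -
    have "\<phi> (- z) = - \<phi> z" using that by (simp add: \<phi>_def vec_eq_iff forall_3)
    then have "exp (h (- z)) = - exp (h z)"
      using h(2)[of z] h(2)[of "- z"] odd[of "\<phi> z"] that by simp
    then show ?thesis by (simp add: exp_diff)
  qed
  let ?d = "\<lambda>z. h (- z) - h z"
  have "?d constant_on sphere 0 1"
  proof (rule continuous_discrete_range_constant)
    show "connected (sphere (0::complex) 1)" by (intro connected_sphere) simp
    have "continuous_on (sphere 0 1) (\<lambda>z. h (- z))"
      by (rule continuous_on_compose2[OF h(1)]) (auto intro!: continuous_intros)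
    moreover have "continuous_on (sphere 0 1) h" using h(1) by (rule continuous_on_subset) auto
    ultimately show "continuous_on (sphere 0 1) ?d" by (intro continuous_on_diff)
    fix z :: complex assume z: "z \<in> sphere 0 1"
    show "\<exists>e>0. \<forall>y. y \<in> sphere 0 1 \<and> ?d y \<noteq> ?d z \<longrightarrow> e \<le> norm (?d y - ?d z)"
    proof (intro exI[of _ 1] conjI allI impI)
      fix y assume y: "y \<in> sphere 0 1 \<and> ?d y \<noteq> ?d z"
      have "exp (?d y) = exp (?d z)" using bd[of y] bd[of z] y z by simp
      then obtain n :: int where n: "?d y = ?d z + (of_int (2 * n) * pi) * \<i>"
        using exp_eq by (metis (mono_tags, opaque_lifting))
      then have "n \<noteq> 0" using y by auto
      then have "1 \<le> \<bar>real_of_int n\<bar>" by linarith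
      then have "1 \<le> 2 * \<bar>real_of_int n\<bar> * pi" using pi_ge_two
        by (smt (verit) mult_less_cancel_left_pos mult_le_cancel_right1)
      also have "\<dots> = norm (?d y - ?d z)" using n by (simp add: norm_mult abs_mult)
      finally show "1 \<le> norm (?d y - ?d z)" .
    qed simp
  qed
  then obtain c where c: "\<And>z. norm z = 1 \<Longrightarrow> ?d z = c" unfolding constant_on_def by auto
  have "c = - c" using c[of 1] c[of "-1"] by (simp add: algebra_simps)
  then have "c = 0" by simp
  then show False using bd[of 1] c[of 1] by simp
qed

section \<open>The polar form of a ternary cubic\<close>

definition polar :: "(nat \<Rightarrow> real) \<Rightarrow> 'a::real_normed_field^3 \<Rightarrow> 'a^3 \<Rightarrow> 'a^3 \<Rightarrow> 'a" where
  "polar k u v w =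
     of_real (k 0) * (u$1 * v$1 * w$1) + of_real (k 1) * (u$2 * v$2 * w$2) + of_real (k 2) * (u$3 * v$3 * w$3)
   + of_real (k 3) * (u$1 * v$1 * w$2 + u$1 * v$2 * w$1 + u$2 * v$1 * w$1)
   + of_real (k 4) * (u$1 * v$1 * w$3 + u$1 * v$3 * w$1 + u$3 * v$1 * w$1)
   + of_real (k 5) * (u$2 * v$2 * w$1 + u$2 * v$1 * w$2 + u$1 * v$2 * w$2)
   + of_real (k 6) * (u$2 * v$2 * w$3 + u$2 * v$3 * w$2 + u$3 * v$2 * w$2)
   + of_real (k 7) * (u$3 * v$3 * w$1 + u$3 * v$1 * w$3 + u$1 * v$3 * w$3)
   + of_real (k 8) * (u$3 * v$3 * w$2 + u$3 * v$2 * w$3 + u$2 * v$3 * w$3)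
   + of_real (k 9) * (u$1 * v$2 * w$3 + u$1 * v$3 * w$2 + u$2 * v$1 * w$3
       + u$2 * v$3 * w$1 + u$3 * v$1 * w$2 + u$3 * v$2 * w$1)"

lemma polar_swap12: "polar k u v w = polar k v u w"
  unfolding polar_def by (simp add: algebra_simps)

lemma polar_swap23: "polar k u v w = polar k u w v"
  unfolding polar_def by (simp add: algebra_simps)

lemma polar_add3: "polar k u v (w + w') = polar k u v w + polar k u v w'"
  unfolding polar_def by (simp add: algebra_simps)

lemma polar_scale3: "polar k u v (c *s w) = c * polar k u v w"
  unfolding polar_def by (simp add: algebra_simps)

lemma polar_add2: "polar k u (w + w') v = polar k u w v + polar k u w' v"
  by (simp only: polar_swap23[of k u _ v] polar_add3)

lemma polar_add1: "polar k (w + w') u v = polar k w u v + polar k w' u v"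
  by (simp only: polar_swap12[of k _ u v] polar_add2)

lemma polar_scale2: "polar k u (c *s w) v = c * polar k u w v"
  by (simp only: polar_swap23[of k u _ v] polar_scale3)

lemma polar_scale1: "polar k (c *s w) u v = c * polar k w u v"
  by (simp only: polar_swap12[of k _ u v] polar_scale2)

lemmas polar_linear = polar_add1 polar_add2 polar_add3 polar_scale1 polar_scale2 polar_scale3

lemma sum_exponents_3:
  fixes f :: "(3 \<Rightarrow> nat) \<Rightarrow> complex"
  defines "e \<equiv> \<lambda>i j l k :: 3. if k = 1 then i else if k = 2 then j else (l::nat)"
  shows "(\<Sum>m | sum m UNIV = 3. f m) = f (e 3 0 0) + f (e 0 3 0) + f (e 0 0 3)
    + f (e 2 1 0) + f (e 2 0 1) + f (e 1 2 0) + f (e 0 2 1) + f (e 1 0 2) + f (e 0 1 2) + f (e 1 1 1)"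
proof -
  let ?E = "{(3,0,0), (0,3,0), (0,0,3), (2,1,0), (2,0,1), (1,2,0), (0,2,1), (1,0,2), (0,1,2), (1,1,1)} :: (nat \<times> nat \<times> nat) set"
  have E: "?E = {(i, j, l). i + j + l = 3}"
  proof -
    have "(i, j, l) \<in> ?E" if "i + j + l = 3" for i j l :: nat
    proof -
      have "i = 0 \<or> i = 1 \<or> i = 2 \<or> i = 3" "j = 0 \<or> j = 1 \<or> j = 2 \<or> j = 3"
        using that by arith+
      then show ?thesis using that by (elim disjE) simp_all
    qed
    then have "{(i, j, l). i + j + l = 3} \<subseteq> ?E" by (intro subsetI) (simp only: mem_Collect_eq split_paired_all prod.case)
    moreover have "?E \<subseteq> {(i, j, l). i + j + l = 3}" by simp
    ultimately show ?thesis by (rule equalityI[rotated])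
  qed
  have "bij_betw (\<lambda>(i, j, l). e i j l) ?E {m. sum m UNIV = 3}"
    unfolding E
    by (rule bij_betw_byWitness[where f' = "\<lambda>m. (m 1, m 2, m 3)"])
      (auto simp: e_def sum_3 fun_eq_iff forall_3)
  then have "(\<Sum>m | sum m UNIV = 3. f m) = (\<Sum>(i, j, l)\<in>?E. f (e i j l))"
    by (subst sum.reindex_bij_betw[symmetric]) (auto simp: case_prod_unfold)
  also have "\<dots> = f (e 3 0 0) + f (e 0 3 0) + f (e 0 0 3)
    + f (e 2 1 0) + f (e 2 0 1) + f (e 1 2 0) + f (e 0 2 1) + f (e 1 0 2) + f (e 0 1 2) + f (e 1 1 1)"
    by (simp add: ac_simps)
  finally show ?thesis .
qed

lemma prod_3: "prod f (UNIV::3 set) = f 1 * f 2 * f 3"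
  unfolding UNIV_3 by (simp add: mult.assoc)

lemma form_eval_3_eq_polar:
  fixes c :: "(3 \<Rightarrow> nat) \<Rightarrow> real"
  shows "\<exists>k. \<forall>x. form_eval 3 c x = polar k x x x"
proof -
  let ?e = "\<lambda>i j l k :: 3. if k = 1 then i else if k = 2 then j else (l::nat)"
  let ?k = "\<lambda>n::nat. [c (?e 3 0 0), c (?e 0 3 0), c (?e 0 0 3), c (?e 2 1 0) / 3, c (?e 2 0 1) / 3,
    c (?e 1 2 0) / 3, c (?e 0 2 1) / 3, c (?e 1 0 2) / 3, c (?e 0 1 2) / 3, c (?e 1 1 1) / 6] ! n"
  have "form_eval 3 c x = polar ?k x x x" for x
    unfolding form_eval_def sum_exponents_3 prod_3 polar_def
    by (simp add: power2_eq_square power3_eq_cube algebra_simps)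
  then show ?thesis by blast
qed

section \<open>Real matrices acting on complex vectors\<close>

definition cmat :: "real^'m^'n \<Rightarrow> complex^'m^'n" where
  "cmat M = (\<chi> i j. of_real (M $ i $ j))"

lemma cmat_nth [simp]: "cmat M $ i $ j = of_real (M $ i $ j)"
  by (simp add: cmat_def)

lemma cmat_mult: "cmat (M ** N) = cmat M ** cmat N"
  by (simp add: vec_eq_iff matrix_matrix_mult_def)

lemma cmat_mat_1 [simp]: "cmat (mat 1) = mat 1"
  by (simp add: vec_eq_iff mat_def)

lemma cmat_complex_vec: "cmat M *v complex_vec x = complex_vec (M *v x)"
  by (simp add: vec_eq_iff matrix_vector_mult_def)

lemma cmat_scale: "cmat M *v (k *s x) = k *s (cmat M *v x)"
  by (simp add: vec_eq_iff matrix_vector_mult_def sum_distrib_left ac_simps)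

lemma linear_form_cmat: "linear_form a (cmat M *v x) = linear_form (a v* M) x"
proof -
  have 1: "linear_form a (cmat M *v x) = (\<Sum>i\<in>UNIV. \<Sum>j\<in>UNIV. of_real (a $ i * M $ i $ j) * x $ j)"
    by (simp add: linear_form_def matrix_vector_mult_def sum_distrib_left mult.assoc)
  have 2: "\<dots> = (\<Sum>j\<in>UNIV. \<Sum>i\<in>UNIV. of_real (a $ i * M $ i $ j) * x $ j)"
    by (rule sum.swap)
  show ?thesis unfolding 1 2
    by (simp add: linear_form_def vector_matrix_mult_def sum_distrib_left sum_distrib_right ac_simps)
qed

lemma cmat_inverse:
  assumes "N ** M = mat 1"
  shows "cmat N *v (cmat M *v x) = x"
  using assms by (metis cmat_mult cmat_mat_1 matrix_vector_mul_assoc matrix_vector_mul_lid)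

lemma cmat_eq_0_iff:
  assumes "N ** M = mat 1"
  shows "cmat M *v x = 0 \<longleftrightarrow> x = 0"
  using cmat_inverse[OF assms, of x] by auto

section \<open>A real flex\<close>

lemma polar_binomial:
  fixes x y :: "'a::real_normed_field^3"
  shows "polar k (x + s *s y) (x + s *s y) (x + s *s y) =
    polar k x x x + 3 * s * polar k x x y + 3 * s^2 * polar k x y y + s^3 * polar k y y y"
proof -
  have "polar k x y x = polar k x x y" "polar k y x x = polar k x x y"
    "polar k y x y = polar k x y y" "polar k y y x = polar k x y y"
    using polar_swap12 polar_swap23 by metis+
  then show ?thesis
    unfolding polar_linear by (simp add: power2_eq_square power3_eq_cube algebra_simps)
qed

lemma smooth_cubic_polar:
  assumes "smooth_plane_curve 3 X"
  obtains k where "X = {abs_cproj x |x. x \<noteq> 0 \<and> polar k x x x = 0}"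
    "\<And>x::complex^3. x \<noteq> 0 \<Longrightarrow> polar k x x x = 0 \<Longrightarrow> \<exists>j. polar k x x (axis j 1) \<noteq> 0"
proof -
  obtain c where c: "X = {abs_cproj x |x. x \<noteq> 0 \<and> form_eval 3 c x = 0}"
    "\<And>x. x \<noteq> 0 \<Longrightarrow> form_eval 3 c x = 0 \<Longrightarrow> \<exists>j. form_partial 3 c j x \<noteq> 0"
    using assms unfolding smooth_plane_curve_def by blast
  obtain k where k: "\<And>x. form_eval 3 c x = polar k x x x" using form_eval_3_eq_polar by blast
  have "form_partial 3 c j x = 3 * polar k x x (axis j 1)" for j x
  proof -
    let ?e = "axis j 1 :: complex^3"
    have upd: "(\<chi> i. if i = j then t else x $ i) = x + (t - x $ j) *s ?e" for t
      by (simp add: vec_eq_iff axis_def)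
    have "form_eval 3 c (\<chi> i. if i = j then t else x $ i) =
        polar k x x x + 3 * (t - x $ j) * polar k x x ?e + 3 * (t - x $ j)^2 * polar k x ?e ?e
        + (t - x $ j)^3 * polar k ?e ?e ?e" for t
      unfolding k upd by (rule polar_binomial)
    moreover have "((\<lambda>t. polar k x x x + 3 * (t - x $ j) * polar k x x ?e + 3 * (t - x $ j)^2 * polar k x ?e ?e
        + (t - x $ j)^3 * polar k ?e ?e ?e) has_field_derivative 3 * polar k x x ?e) (at (x $ j))"
      by (auto intro!: derivative_eq_intros)
    ultimately show ?thesis
      using form_partial_is_derivative[of 3 c j x] by (simp add: DERIV_unique)
  qed
  then show thesis using c k by (intro that[of k]) auto
qed

lemma polar_complex_vec:
  "polar k (complex_vec u) (complex_vec v) (complex_vec w) = of_real (polar k u v w)"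
  by (simp add: polar_def)

lemma polar_sum_axis:
  fixes u v w :: "'a::real_normed_field^3"
  shows "polar k v w u = (\<Sum>i\<in>UNIV. w $ i * (\<Sum>j\<in>UNIV. polar k v (axis i 1) (axis j 1) * u $ j))"
  unfolding sum_3 polar_def axis_def by (simp add: algebra_simps)

lemma real_flex_exists:
  fixes k :: "nat \<Rightarrow> real"
  obtains u v :: "real^3" where "u \<noteq> 0" "v \<noteq> 0" "polar k v v v = 0" "\<And>w. polar k v u w = 0"
proof -
  define B :: "real^3 \<Rightarrow> real^3^3" where "B v = (\<chi> i j. polar k v (axis i 1) (axis j 1))" for v
  have B: "B v $ i $ j = polar k v (axis i 1) (axis j 1)" for v i j by (simp add: B_def)
  have neg: "polar k (- v) u w = - polar k v u w" for u v w :: "real^3"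
    using polar_scale1[of k "-1" v u w] by (simp add: vec_eq_iff)
  have neg3: "polar k (- v) (- v) (- v) = - polar k v v v" for v :: "real^3"
    by (simp add: polar_def algebra_simps)
  have cpolar: "continuous_on S (\<lambda>v::real^3. polar k v (f v) (h v))"
    if "continuous_on S f" "continuous_on S h" for S f h
    unfolding polar_def using that by (intro continuous_intros)
  obtain v where v: "norm v = 1" "Complex (polar k v v v) (det (B v)) = 0"
  proof (rule odd_map_on_sphere_has_zero[of "\<lambda>v. Complex (polar k v v v) (det (B v))"])
    show "continuous_on (sphere 0 1) (\<lambda>v. Complex (polar k v v v) (det (B v)))"
      unfolding det_3 B by (intro continuous_on_Complex continuous_intros cpolar)
    show "Complex (polar k (- v) (- v) (- v)) (det (B (- v))) = - Complex (polar k v v v) (det (B v))" for v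
    proof -
      have "det (B (- v)) = - det (B v)" by (simp add: det_3 B neg)
      then show ?thesis by (simp add: neg3 complex_eq_iff)
    qed
  qed
  then have v: "v \<noteq> 0" "polar k v v v = 0" "det (B v) = 0" by (auto simp: complex_eq_iff)
  then obtain u where u: "u \<noteq> 0" "B v *v u = 0"
    using invertible_det_nz invertible_left_inverse matrix_left_invertible_ker by metis
  have "polar k v w u = 0" for w
  proof -
    have "(\<Sum>j\<in>UNIV. polar k v (axis i 1) (axis j 1) * u $ j) = (B v *v u) $ i" for i
      by (simp add: matrix_vector_mult_def B)
    then show ?thesis unfolding polar_sum_axis[of k v w u] u(2) by simp
  qed
  then show thesis using that[of u v] u(1) v by (metis polar_swap23)
qed

section \<open>Weierstrass form\<close>

definition weierstrass :: "real \<Rightarrow> real \<Rightarrow> real \<Rightarrow> complex^3 \<Rightarrow> complex" where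
  "weierstrass p q r c = (c$2)^2 * c$3
    - ((c$1)^3 + of_real p * (c$1)^2 * c$3 + of_real q * c$1 * (c$3)^2 + of_real r * (c$3)^3)"

lemma inverse_matrix_exists:
  fixes B :: "real^'n^'n"
  assumes "\<And>x. B *v x = 0 \<Longrightarrow> x = 0"
  obtains B' where "B' ** B = mat 1" "B ** B' = mat 1"
proof -
  obtain B' where "B' ** B = mat 1" using assms matrix_left_invertible_ker by blast
  then show thesis using that matrix_left_right_inverse by blast
qed

lemma no_singular_point:
  assumes "x \<noteq> 0" "\<And>y. \<exists>A B. \<forall>s::complex. polar k (x + s *s y) (x + s *s y) (x + s *s y) = s^2 * (A + s * B)"
  shows "polar k x x x = 0" "polar k x x y = 0"
proof -
  have *: "polar k x x x = 0 \<and> polar k x x y = 0" for y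
  proof -
    obtain A B where AB: "\<And>s::complex. polar k (x + s *s y) (x + s *s y) (x + s *s y) = s^2 * (A + s * B)"
      using assms(2) by blast
    let ?a = "polar k x x y" and ?b = "polar k x y y" and ?c = "polar k y y y"
    have ex: "polar k (x + s *s y) (x + s *s y) (x + s *s y) = polar k x x x + 3 * s * ?a + 3 * s^2 * ?b + s^3 * ?c" for s
      by (rule polar_binomial)
    have e: "polar k x x x + 3 * s * ?a + 3 * s^2 * ?b + s^3 * ?c = s^2 * (A + s * B)" for s
      using AB ex by metis
    have 0: "polar k x x x = 0" using e[of 0] by simp
    have e1: "3 * ?a + 3 * ?b + ?c = A + B" using e[of 1] 0 by simp
    have e2: "- 3 * ?a + 3 * ?b - ?c = A - B" using e[of "-1"] 0 by simp
    have e3: "6 * ?a + 12 * ?b + 8 * ?c = 4 * (A + 2 * B)" using e[of 2] 0 by simp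
    have "12 * ?a = 0" using e1 e2 e3 by algebra
    then show ?thesis using 0 by simp
  qed
  then show "polar k x x x = 0" "polar k x x y = 0" by auto
qed

lemma weierstrass_form_exists:
  assumes "smooth_plane_curve 3 X"
  obtains B B' :: "real^3^3" and p q r where "B' ** B = mat 1" "B ** B' = mat 1"
    "X = {abs_cproj (cmat B *v c) |c. c \<noteq> 0 \<and> weierstrass p q r c = 0}"
    "\<And>e e'. \<not> (\<forall>x. x^3 + p * x^2 + q * x + r = (x - e)^2 * (x - e'))"
proof -
  obtain k where X: "X = {abs_cproj x |x. x \<noteq> 0 \<and> polar k x x x = 0}"
    and smooth: "\<And>x::complex^3. x \<noteq> 0 \<Longrightarrow> polar k x x x = 0 \<Longrightarrow> \<exists>j. polar k x x (axis j 1) \<noteq> 0"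
    using smooth_cubic_polar[OF assms] by blast
  obtain u v :: "real^3" where uv: "u \<noteq> 0" "v \<noteq> 0" "polar k v v v = 0" and vu: "\<And>w. polar k v u w = 0"
    by (rule real_flex_exists[of k]) blast
  have "polar k (complex_vec v) (complex_vec v) (complex_vec v) = 0"
    by (simp add: polar_complex_vec uv(3))
  then obtain j where "polar k (complex_vec v) (complex_vec v) (axis j 1) \<noteq> 0"
    using smooth[of "complex_vec v"] uv(2) by auto
  moreover have "axis j 1 = complex_vec (axis j 1)" by (simp add: vec_eq_iff axis_def)
  ultimately have w0: "polar k v v (axis j 1) \<noteq> 0" by (metis polar_complex_vec of_real_0)
  define w0 :: "real^3" where "w0 = axis j 1"
  define w where "w = w0 + (- polar k v w0 w0 / (2 * polar k v v w0)) *s v"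
  define \<beta> where "\<beta> = polar k v v w"
  have \<beta>: "\<beta> = polar k v v w0" "\<beta> \<noteq> 0"
  proof -
    show "\<beta> = polar k v v w0" unfolding \<beta>_def w_def polar_add3 polar_scale3 uv(3) by simp
    then show "\<beta> \<noteq> 0" using w0 by (simp add: w0_def)
  qed
  have vww: "polar k v w w = 0"
    using \<beta> uv(3) polar_swap23[of k v v w0] unfolding w_def polar_linear
    by (simp add: field_simps)
  define \<alpha> \<gamma> \<delta> \<epsilon> where "\<alpha> = polar k u u u" and "\<gamma> = polar k u u w" and "\<delta> = polar k u w w"
    and "\<epsilon> = polar k w w w"
  define cub :: "complex \<Rightarrow> complex \<Rightarrow> complex \<Rightarrow> complex" where
    "cub X Y Z = of_real \<alpha> * X^3 + 3 * of_real \<beta> * Y^2 * Z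
      + 3 * of_real \<gamma> * X^2 * Z + 3 * of_real \<delta> * X * Z^2 + of_real \<epsilon> * Z^3" for X Y Z
  let ?c = "\<lambda>X Y Z. X *s complex_vec u + Y *s complex_vec v + Z *s complex_vec w"
  have cubic: "polar k (?c X Y Z) (?c X Y Z) (?c X Y Z) = cub X Y Z" for X Y Z
  proof -
    have z: "polar k v u u = 0" "polar k u v u = 0" "polar k u u v = 0"
      "polar k v v u = 0" "polar k v u v = 0" "polar k u v v = 0"
      "polar k v u w = 0" "polar k u v w = 0" "polar k v w u = 0" "polar k u w v = 0"
      "polar k w u v = 0" "polar k w v u = 0"
      "polar k v w w = 0" "polar k w v w = 0" "polar k w w v = 0" "polar k v v v = 0"
      using vu vww uv(3) polar_swap12 polar_swap23 by metis+
    have s: "polar k u w u = polar k u u w" "polar k w u u = polar k u u w"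
      "polar k w u w = polar k u w w" "polar k w w u = polar k u w w"
      "polar k v w v = polar k v v w" "polar k w v v = polar k v v w"
      using polar_swap12 polar_swap23 by metis+
    show ?thesis
      unfolding polar_linear polar_complex_vec z s \<alpha>_def[symmetric] \<beta>_def[symmetric] \<gamma>_def[symmetric]
        \<delta>_def[symmetric] \<epsilon>_def[symmetric] cub_def
      by (simp add: power2_eq_square power3_eq_cube algebra_simps)
  qed
  have indep: "X = 0 \<and> Y = 0 \<and> Z = 0" if "X *s u + Y *s v + Z *s w = 0" for X Y Z
  proof -
    have lin: "polar k v a (X *s u + Y *s v + Z *s w) = 0" for a
      using that by (simp add: polar_def)
    have "polar k v v u = 0" using vu polar_swap23 by metis
    then have "Z * \<beta> = 0" using lin[of v] uv(3) by (simp add: polar_linear \<beta>_def)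
    then have Z: "Z = 0" using \<beta>(2) by simp
    have "Y * \<beta> = 0"
      using lin[of w] vu polar_swap23[of k v w u] polar_swap23[of k v w v] Z
      by (simp add: polar_linear \<beta>_def)
    then have "Y = 0" using \<beta>(2) by simp
    then show ?thesis using Z that uv(1) by (auto simp: vec_eq_iff)
  qed
  have indepc: "X = 0 \<and> Y = 0 \<and> Z = 0" if "?c X Y Z = 0" for X Y Z
  proof -
    have *: "Re X *s u + Re Y *s v + Re Z *s w = 0" "Im X *s u + Im Y *s v + Im Z *s w = 0"
      using that by (simp_all add: vec_eq_iff complex_eq_iff)
    show ?thesis using indep[OF *(1)] indep[OF *(2)] by (simp add: complex_eq_iff)
  qed
  have sing: False
    if "?c X Y Z \<noteq> 0"
      "\<And>X' Y' Z'. \<exists>A B. \<forall>s. cub (X + s * X') (Y + s * Y') (Z + s * Z') = s^2 * (A + s * B)" for X Y Z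
  proof -
    obtain M :: "real^3^3" where M: "(\<chi> i. vector [u$i, v$i, w$i]) ** M = mat 1"
    proof (rule inverse_matrix_exists[of "\<chi> i. vector [u$i, v$i, w$i]"])
      fix x :: "real^3" assume "(\<chi> i. vector [u$i, v$i, w$i]) *v x = (0 :: real^3)"
      then have "x$1 *s u + x$2 *s v + x$3 *s w = 0"
        by (simp add: vec_eq_iff matrix_vector_mult_def sum_3 algebra_simps)
      from indep[OF this] show "x = 0" by (simp add: vec_eq_iff forall_3)
    qed
    have span: "\<exists>X' Y' Z'. y = ?c X' Y' Z'" for y
    proof -
      define z where "z = cmat M *v y"
      have "y = cmat (\<chi> i. vector [u$i, v$i, w$i]) *v z"
        unfolding z_def using cmat_inverse[OF M] by simp
      also have "\<dots> = ?c (z$1) (z$2) (z$3)"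
        by (simp add: vec_eq_iff matrix_vector_mult_def sum_3 mult.commute)
      finally show ?thesis by blast
    qed
    have "\<exists>A B. \<forall>s. polar k (?c X Y Z + s *s y) (?c X Y Z + s *s y) (?c X Y Z + s *s y) = s^2 * (A + s * B)" for y
    proof -
      obtain X' Y' Z' where y: "y = ?c X' Y' Z'" using span by blast
      have e: "?c X Y Z + s *s y = ?c (X + s * X') (Y + s * Y') (Z + s * Z')" for s
        by (simp add: y vec_eq_iff algebra_simps)
      show ?thesis unfolding e cubic by (rule that(2))
    qed
    then show False using smooth[OF that(1)] no_singular_point[OF that(1)] by blast
  qed
  have \<alpha>: "\<alpha> \<noteq> 0"
  proof
    assume a: "\<alpha> = 0"
    define Y where "Y = csqrt (- of_real (\<gamma> / \<beta>))"
    have Y: "of_real \<beta> * Y^2 = - of_real \<gamma>" using \<beta>(2) by (simp add: Y_def)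
    show False
    proof (rule sing[of 1 Y 0])
      show "?c 1 Y 0 \<noteq> 0" using indepc[of 1 Y 0] by auto
      fix X' Y' Z'
      show "\<exists>A B. \<forall>s. cub (1 + s * X') (Y + s * Y') (0 + s * Z') = s^2 * (A + s * B)"
      proof (intro exI allI)
        fix s :: complex
        have "3 * of_real \<beta> * (Y + s * Y')^2 * (0 + s * Z') = 3 * (of_real \<beta> * Y^2) * s * Z'
            + 3 * of_real \<beta> * (2 * Y * Y' + s * Y'^2) * s^2 * Z'"
          by (simp add: power2_eq_square algebra_simps)
        then show "cub (1 + s * X') (Y + s * Y') (0 + s * Z') = s^2 * ((6 * of_real \<beta> * Y * Y' * Z' + 6 * of_real \<gamma> * X' * Z' + 3 * of_real \<delta> * Z'^2)
          + s * (3 * of_real \<beta> * Y'^2 * Z' + 3 * of_real \<gamma> * X'^2 * Z' + 3 * of_real \<delta> * X' * Z'^2 + of_real \<epsilon> * Z'^3))"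
          unfolding Y cub_def by (simp add: a power2_eq_square power3_eq_cube algebra_simps)
      qed
    qed
  qed
  define \<kappa> where "\<kappa> = - \<alpha> / (3 * \<beta>)"
  have \<kappa>: "\<kappa> \<noteq> 0" "3 * \<beta> * \<kappa> = - \<alpha>" using \<alpha> \<beta>(2) by (simp_all add: \<kappa>_def)
  define p q r where "p = 3 * \<gamma> * \<kappa> / \<alpha>" and "q = 3 * \<delta> * \<kappa>^2 / \<alpha>" and "r = \<epsilon> * \<kappa>^3 / \<alpha>"
  have pqr: "3 * \<gamma> * \<kappa> = \<alpha> * p" "3 * \<delta> * \<kappa>^2 = \<alpha> * q" "\<epsilon> * \<kappa>^3 = \<alpha> * r"
    using \<alpha> by (simp_all add: p_def q_def r_def)
  have cub2: "cub X Y (of_real \<kappa> * Z) = - of_real \<alpha> * weierstrass p q r (vector [X, Y, Z])" for X Y Z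
  proof -
    have "cub X Y (of_real \<kappa> * Z) = of_real \<alpha> * X^3 + of_real (3 * \<beta> * \<kappa>) * Y^2 * Z + of_real (3 * \<gamma> * \<kappa>) * X^2 * Z
        + of_real (3 * \<delta> * \<kappa>^2) * X * Z^2 + of_real (\<epsilon> * \<kappa>^3) * Z^3"
      by (simp add: cub_def power_mult_distrib algebra_simps)
    then show ?thesis unfolding pqr \<kappa>(2)
      by (simp add: weierstrass_def algebra_simps)
  qed
  define B :: "real^3^3" where "B = (\<chi> i. vector [u$i, v$i, \<kappa> * w$i])"
  have Bc: "cmat B *v c = ?c (c$1) (c$2) (of_real \<kappa> * c$3)" for c
    by (simp add: B_def vec_eq_iff matrix_vector_mult_def sum_3 mult.commute mult.left_commute)
  obtain B' where B': "B' ** B = mat 1" "B ** B' = mat 1"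
  proof (rule inverse_matrix_exists[of B])
    fix x assume "B *v x = 0"
    then have "x$1 *s u + x$2 *s v + (x$3 * \<kappa>) *s w = 0"
      by (simp add: B_def vec_eq_iff matrix_vector_mult_def sum_3 algebra_simps)
    from indep[OF this] show "x = 0" using \<kappa>(1) by (simp add: vec_eq_iff forall_3)
  qed
  have vec3: "vector [c$1, c$2, c$3] = c" for c :: "complex^3" by (simp add: vec_eq_iff forall_3)
  have polB: "polar k (cmat B *v c) (cmat B *v c) (cmat B *v c) = - of_real \<alpha> * weierstrass p q r c" for c
    unfolding Bc cubic cub2 vec3 ..
  show thesis
  proof (rule that[OF B'])
    show "X = {abs_cproj (cmat B *v c) |c. c \<noteq> 0 \<and> weierstrass p q r c = 0}"
    proof -
      have "x \<noteq> 0 \<and> polar k x x x = 0 \<longleftrightarrow> (\<exists>c. x = cmat B *v c \<and> c \<noteq> 0 \<and> weierstrass p q r c = 0)" for x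
      proof
        assume x: "x \<noteq> 0 \<and> polar k x x x = 0"
        have "x = cmat B *v (cmat B' *v x)" using cmat_inverse[OF B'(2)] by simp
        then show "\<exists>c. x = cmat B *v c \<and> c \<noteq> 0 \<and> weierstrass p q r c = 0"
          using x polB[of "cmat B' *v x"] \<alpha> cmat_eq_0_iff[OF B'(2)] by auto
      qed (use polB cmat_eq_0_iff[OF B'(1)] in auto)
      then have "abs_cproj ` {x. x \<noteq> 0 \<and> polar k x x x = 0} =
          abs_cproj ` (\<lambda>c. cmat B *v c) ` {c. c \<noteq> 0 \<and> weierstrass p q r c = 0}"
        by (intro arg_cong[of _ _ "image abs_cproj"]) (simp only: image_def Bex_def mem_Collect_eq conj_ac)
      then show ?thesis unfolding X image_image by (simp only: setcompr_eq_image)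
    qed
    fix e e'
    show "\<not> (\<forall>x. x^3 + p * x^2 + q * x + r = (x - e)^2 * (x - e'))"
    proof
      assume dbl: "\<forall>x. x^3 + p * x^2 + q * x + r = (x - e)^2 * (x - e')"
      have 0: "r = - (e^2 * e')" using dbl[rule_format, of 0] by simp
      have 1: "1 + p + q + r = (1 - e)^2 * (1 - e')" using dbl[rule_format, of 1] by simp
      have 2: "- 1 + p - q + r = (-1 - e)^2 * (-1 - e')" using dbl[rule_format, of "-1"] by simp
      have pq: "p = - (2 * e + e')" "q = e^2 + 2 * e * e'"
        using 0 1 2 by algebra+
      let ?X = "of_real e :: complex"
      have fac: "weierstrass p q r (vector [X, Y, Z]) = Y^2 * Z - (X - ?X * Z)^2 * (X - of_real e' * Z)" for X Y Z
        unfolding pq 0 weierstrass_def by (simp add: power2_eq_square power3_eq_cube algebra_simps)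
      show False
      proof (rule sing[of ?X 0 "of_real \<kappa> * 1"])
        show "?c ?X 0 (of_real \<kappa> * 1) \<noteq> 0" using indepc[of ?X 0 "of_real \<kappa> * 1"] \<kappa>(1) by auto
        fix X' Y' Z' :: complex
        define Z'' where "Z'' = Z' / of_real \<kappa>"
        have Z: "of_real \<kappa> * 1 + s * Z' = of_real \<kappa> * (1 + s * Z'')" for s
          using \<kappa>(1) by (simp add: Z''_def field_simps)
        have "- of_real \<alpha> * weierstrass p q r (vector [?X + s * X', 0 + s * Y', 1 + s * Z'']) =
            s^2 * (- of_real \<alpha> * (Y'^2 - (X' - ?X * Z'')^2 * (?X - of_real e'))
               + s * (- of_real \<alpha> * (Y'^2 * Z'' - (X' - ?X * Z'')^2 * (X' - of_real e' * Z''))))" for s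
          unfolding fac by (simp add: power2_eq_square algebra_simps)
        then show "\<exists>A B. \<forall>s. cub (?X + s * X') (0 + s * Y') (of_real \<kappa> * 1 + s * Z') = s^2 * (A + s * B)"
          unfolding Z cub2 by blast
      qed
    qed
  qed
qed

lemma real_cubic_has_root:
  fixes p q r :: real
  obtains x where "x^3 + p * x^2 + q * x + r = 0"
proof -
  define M where "M = 1 + \<bar>p\<bar> + \<bar>q\<bar> + \<bar>r\<bar>"
  have M: "1 \<le> M" by (simp add: M_def)
  have M1: "M \<le> M^2" using M by (simp add: power2_eq_square)
  then have M2: "1 \<le> M^2" using M by linarith
  have "\<bar>p\<bar> * M^2 + \<bar>q\<bar> * M + \<bar>r\<bar> \<le> \<bar>p\<bar> * M^2 + \<bar>q\<bar> * M^2 + \<bar>r\<bar> * M^2"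
    using mult_left_mono[OF M1, of "\<bar>q\<bar>"] mult_left_mono[OF M2, of "\<bar>r\<bar>"] by simp
  also have "\<dots> = (M - 1) * M^2" by (simp add: M_def algebra_simps)
  also have "\<dots> < M^3" using M by (simp add: power2_eq_square power3_eq_cube algebra_simps)
  finally have *: "\<bar>p\<bar> * M^2 + \<bar>q\<bar> * M + \<bar>r\<bar> < M^3" .
  have b: "\<bar>p * M^2\<bar> = \<bar>p\<bar> * M^2" "\<bar>q * M\<bar> = \<bar>q\<bar> * M" using M by (simp_all add: abs_mult)
  let ?f = "\<lambda>x. x^3 + p * x^2 + q * x + r"
  have "?f (- M) \<le> 0" "0 \<le> ?f M" using * b by auto
  moreover have "continuous_on {- M..M} ?f" by (intro continuous_intros)
  ultimately obtain x where "?f x = 0" using IVT'[of ?f "- M" 0 M] M by auto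
  then show thesis by (rule that)
qed

lemma cubic_cases:
  fixes p q r :: real
  assumes no_double: "\<And>e e'. \<not> (\<forall>x. x^3 + p * x^2 + q * x + r = (x - e)^2 * (x - e'))"
  obtains e A C where "A = p + 3 * e" "C = q + 2 * p * e + 3 * e^2" "e^3 + p * e^2 + q * e + r = 0"
    "A^2 < 4 * C \<or> (\<exists>a b. 0 < a \<and> a < b \<and> A = - (a + b) \<and> C = a * b)"
proof -
  note result = that
  have sorted: thesis
    if "e1 < e2" "e2 < e3" "p = - (e1 + e2 + e3)" "q = e1 * e2 + e1 * e3 + e2 * e3" "r = - (e1 * e2 * e3)"
    for e1 e2 e3
  proof (rule result[of "p + 3 * e1" e1 "q + 2 * p * e1 + 3 * e1^2"])
    show "(p + 3 * e1)^2 < 4 * (q + 2 * p * e1 + 3 * e1^2) \<or>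
      (\<exists>a b. 0 < a \<and> a < b \<and> p + 3 * e1 = - (a + b) \<and> q + 2 * p * e1 + 3 * e1^2 = a * b)"
      using that(1,2) unfolding that(3-5) by (intro disjI2 exI[of _ "e2 - e1"] exI[of _ "e3 - e1"])
        (simp add: power2_eq_square algebra_simps)
    show "e1^3 + p * e1^2 + q * e1 + r = 0"
      unfolding that(3-5) by (simp add: power2_eq_square power3_eq_cube algebra_simps)
  qed simp_all
  obtain e where e: "e^3 + p * e^2 + q * e + r = 0" by (rule real_cubic_has_root)
  define A C where "A = p + 3 * e" and "C = q + 2 * p * e + 3 * e^2"
  show thesis
  proof (cases "A^2 < 4 * C")
    case True
    then show ?thesis using result[OF A_def C_def e] by blast
  next
    case False
    define s where "s = sqrt (A^2 - 4 * C)"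
    have s: "s^2 = A^2 - 4 * C" using False by (simp add: s_def)
    define f g where "f = e + (- A - s) / 2" and "g = e + (- A + s) / 2"
    have p: "p = - (e + f + g)" by (simp add: f_def g_def A_def field_simps)
    have "(f - e) * (g - e) = (A^2 - s^2) / 4"
      by (simp add: f_def g_def power2_eq_square field_simps)
    then have fg: "(f - e) * (g - e) = C" using s by simp
    have q: "q = e * f + e * g + f * g"
      using fg unfolding C_def p by (simp add: power2_eq_square algebra_simps)
    have r: "r = - (e * f * g)"
      using e unfolding p q by (simp add: power2_eq_square power3_eq_cube algebra_simps)
    have "e \<noteq> f" using no_double[of e g] unfolding p q r
      by (auto simp: power2_eq_square power3_eq_cube algebra_simps)
    moreover have "e \<noteq> g" using no_double[of e f] unfolding p q r
      by (auto simp: power2_eq_square power3_eq_cube algebra_simps)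
    moreover have "f \<noteq> g" using no_double[of f e] unfolding p q r
      by (auto simp: power2_eq_square power3_eq_cube algebra_simps)
    ultimately have "e < f \<and> f < g \<or> e < g \<and> g < f \<or> f < e \<and> e < g \<or> f < g \<and> g < e \<or>
        g < e \<and> e < f \<or> g < f \<and> f < e" by linarith
    then show ?thesis
      using sorted[of e f g] sorted[of e g f] sorted[of f e g] sorted[of f g e] sorted[of g e f] sorted[of g f e]
      unfolding p q r by (simp only: ac_simps) blast
  qed
qed

definition shift_matrix :: "real \<Rightarrow> real^3^3" where
  "shift_matrix e = vector [vector [1, 0, e], vector [0, 1, 0], vector [0, 0, 1]]"

lemma shift_matrix_inverse: "shift_matrix e ** shift_matrix (- e) = mat 1"
  by (simp add: shift_matrix_def vec_eq_iff matrix_matrix_mult_def mat_def forall_3 sum_3)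

lemma shift_matrix_inverse': "shift_matrix (- e) ** shift_matrix e = mat 1"
  using shift_matrix_inverse[of "- e"] by simp

lemma shift_matrix_vec:
  "cmat (shift_matrix e) *v c = vector [c$1 + of_real e * c$3, c$2, c$3]"
  by (simp add: shift_matrix_def vec_eq_iff matrix_vector_mult_def forall_3 sum_3)

lemma weierstrass_shift:
  assumes "e^3 + p * e^2 + q * e + r = 0"
  shows "weierstrass p q r (cmat (shift_matrix e) *v c) = weierstrass (p + 3 * e) (q + 2 * p * e + 3 * e^2) 0 c"
proof -
  have "of_real (e^3 + p * e^2 + q * e + r) = (0::complex)" using assms by simp
  then have r: "of_real r = - (of_real e^3 + of_real p * (of_real e)^2 + of_real q * of_real e :: complex)"
    by (simp add: add_eq_0_iff2)
  show ?thesis unfolding weierstrass_def shift_matrix_vec r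
    by (simp add: power2_eq_square power3_eq_cube algebra_simps)
qed

lemma smooth_cubic_normal_form:
  assumes "smooth_plane_curve 3 X"
  obtains B B' :: "real^3^3" and A C where "B' ** B = mat 1" "B ** B' = mat 1"
    "X = {abs_cproj (cmat B *v c) |c. c \<noteq> 0 \<and> weierstrass A C 0 c = 0}"
    "A^2 < 4 * C \<or> (\<exists>a b. 0 < a \<and> a < b \<and> A = - (a + b) \<and> C = a * b)"
proof -
  obtain B B' :: "real^3^3" and p q r where B: "B' ** B = mat 1" "B ** B' = mat 1"
    and X: "X = {abs_cproj (cmat B *v c) |c. c \<noteq> 0 \<and> weierstrass p q r c = 0}"
    and nd: "\<And>e e'. \<not> (\<forall>x. x^3 + p * x^2 + q * x + r = (x - e)^2 * (x - e'))"
    by (rule weierstrass_form_exists[OF assms]) (rule that)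
  obtain e A C where e: "A = p + 3 * e" "C = q + 2 * p * e + 3 * e^2" "e^3 + p * e^2 + q * e + r = 0"
    "A^2 < 4 * C \<or> (\<exists>a b. 0 < a \<and> a < b \<and> A = - (a + b) \<and> C = a * b)"
    by (rule cubic_cases[OF nd]) (rule that)
  let ?S = "shift_matrix e" and ?S' = "shift_matrix (- e)"
  show thesis
  proof (rule that[of "?S' ** B'" "B ** ?S" A C])
    show "?S' ** B' ** (B ** ?S) = mat 1" "B ** ?S ** (?S' ** B') = mat 1"
      by (metis B shift_matrix_inverse shift_matrix_inverse' matrix_mul_assoc matrix_mul_lid)+
    show "X = {abs_cproj (cmat (B ** ?S) *v c) |c. c \<noteq> 0 \<and> weierstrass A C 0 c = 0}"
    proof
      show "{abs_cproj (cmat (B ** ?S) *v c) |c. c \<noteq> 0 \<and> weierstrass A C 0 c = 0} \<subseteq> X"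
      proof
        fix x assume "x \<in> {abs_cproj (cmat (B ** ?S) *v c) |c. c \<noteq> 0 \<and> weierstrass A C 0 c = 0}"
        then obtain c where c: "x = abs_cproj (cmat B *v (cmat ?S *v c))" "c \<noteq> 0" "weierstrass A C 0 c = 0"
          by (auto simp: cmat_mult matrix_vector_mul_assoc)
        moreover have "weierstrass p q r (cmat ?S *v c) = 0" using c(3) weierstrass_shift[OF e(3)] e(1,2) by simp
        moreover have "cmat ?S *v c \<noteq> 0" using c(2) cmat_eq_0_iff[OF shift_matrix_inverse'] by simp
        ultimately show "x \<in> X" unfolding X by blast
      qed
      show "X \<subseteq> {abs_cproj (cmat (B ** ?S) *v c) |c. c \<noteq> 0 \<and> weierstrass A C 0 c = 0}"
      proof
        fix x assume "x \<in> X"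
        then obtain c where c: "x = abs_cproj (cmat B *v c)" "c \<noteq> 0" "weierstrass p q r c = 0"
          unfolding X by blast
        let ?d = "cmat ?S' *v c"
        have d: "cmat ?S *v ?d = c" by (rule cmat_inverse[OF shift_matrix_inverse])
        then have "x = abs_cproj (cmat (B ** ?S) *v ?d)" by (simp add: c(1) cmat_mult matrix_vector_mul_assoc[symmetric])
        moreover have "?d \<noteq> 0" using d c(2) by auto
        moreover have "weierstrass A C 0 ?d = 0" using weierstrass_shift[OF e(3), of ?d] e(1,2) c(3) d by simp
        ultimately show "x \<in> {abs_cproj (cmat (B ** ?S) *v c) |c. c \<noteq> 0 \<and> weierstrass A C 0 c = 0}" by blast
      qed
    qed
  qed (rule e(4))
qed

definition oval_pts :: "real \<Rightarrow> real \<Rightarrow> (real^3) set" where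
  "oval_pts a b = {vector [x, y, 1] |x y. 0 \<le> x \<and> x \<le> a \<and> y^2 = x * (x - a) * (x - b)}"

definition pseudoline_pts :: "real \<Rightarrow> real \<Rightarrow> (real^3) set" where
  "pseudoline_pts a b = insert (vector [0, 1, 0])
     {vector [x, y, 1] |x y. b \<le> x \<and> y^2 = x * (x - a) * (x - b)}"

lemma vec3_eq_iff:
  "(vector [x, y, z] :: 'a::zero^3) = vector [x', y', z'] \<longleftrightarrow> x = x' \<and> y = y' \<and> z = z'"
  by (simp add: vec_eq_iff forall_3)

locale two_component_cubic =
  fixes a b x0 :: real
  assumes x0: "0 < x0" "x0 < a" and ab: "a < b"
begin

abbreviation oval :: "(real^3) set" where "oval \<equiv> oval_pts a b"
abbreviation pseudoline :: "(real^3) set" where "pseudoline \<equiv> pseudoline_pts a b"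
abbreviation real_pts :: "(real^3) set" where "real_pts \<equiv> oval \<union> pseudoline"

abbreviation cubic :: "complex^3 \<Rightarrow> complex" where
  "cubic \<equiv> weierstrass (- (a + b)) (a * b) 0"

lemma cubic_eq: "cubic c = (c$2)^2 * c$3 - c$1 * (c$1 - of_real a * c$3) * (c$1 - of_real b * c$3)"
  unfolding weierstrass_def by (simp add: power2_eq_square power3_eq_cube algebra_simps)

lemma value_at_x0: "0 < x0 * (x0 - a) * (x0 - b)"
  using x0 ab by (simp add: mult_pos_neg mult_neg_neg)

lemma slope_line_roots:
  obtains x1 x2 x3 where "0 \<le> x1" "x1 < x0" "x0 < x2" "x2 \<le> a" "b \<le> x3"
    "- (a + b) - k^2 = - (x1 + x2 + x3)" "a * b + 2 * k^2 * x0 = x1 * x2 + x1 * x3 + x2 * x3"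
    "- (k^2 * x0^2) = - (x1 * x2 * x3)"
proof -
  let ?G = "\<lambda>x. x * (x - a) * (x - b) - k^2 * (x - x0)^2"
  have c: "continuous_on S ?G" for S by (intro continuous_intros)
  have G: "?G 0 \<le> 0" "0 < ?G x0" "?G a \<le> 0" "?G b \<le> 0" using value_at_x0 by simp_all
  obtain x1 where x1: "0 \<le> x1" "x1 \<le> x0" "?G x1 = 0"
    using IVT'[of ?G 0 0 x0] G c x0 by auto
  obtain x2 where x2: "x0 \<le> x2" "x2 \<le> a" "?G x2 = 0"
    using IVT2'[of ?G a 0 x0] G c x0 by auto
  have lt: "x1 < x0" "x0 < x2" using x1 x2 G(2) by (auto simp: less_le)
  define x3 where "x3 = (a + b) + k^2 - x1 - x2"
  have "(x1 - x2) * (x1^2 + x1 * x2 + x2^2 - (a + b + k^2) * (x1 + x2) + (a * b + 2 * k^2 * x0)) = ?G x1 - ?G x2"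
    by (simp add: power2_eq_square algebra_simps)
  then have "x1^2 + x1 * x2 + x2^2 - (a + b + k^2) * (x1 + x2) + (a * b + 2 * k^2 * x0) = 0"
    using x1(3) x2(3) lt by simp
  then have q: "a * b + 2 * k^2 * x0 = x1 * x2 + x1 * x3 + x2 * x3"
    unfolding x3_def by (simp add: power2_eq_square algebra_simps)
  have p: "- (a + b) - k^2 = - (x1 + x2 + x3)" by (simp add: x3_def)
  have exp: "?G x = x^3 + (- (a + b) - k^2) * x^2 + (a * b + 2 * k^2 * x0) * x - k^2 * x0^2" for x
    by (simp add: power2_eq_square power3_eq_cube algebra_simps)
  have r: "k^2 * x0^2 = x1 * x2 * x3"
    using x1(3) unfolding exp p q by (simp add: power2_eq_square power3_eq_cube algebra_simps)
  have "?G b = (b - x1) * (b - x2) * (b - x3)"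
    unfolding exp p q r by (simp add: power2_eq_square power3_eq_cube algebra_simps)
  moreover have "0 < (b - x1) * (b - x2)" using x1 x2 x0 ab by simp
  ultimately have "b \<le> x3" using G(4) by (metis diff_gt_0_iff_gt linorder_not_less mult_pos_pos)
  then show thesis using that[of x1 x2 x3] x1(1) x2(2) lt p q r by simp
qed

lemma slope_line_factor:
  fixes z :: "'a::real_normed_field"
  assumes "- (a + b) - k^2 = - (x1 + x2 + x3)" "a * b + 2 * k^2 * x0 = x1 * x2 + x1 * x3 + x2 * x3"
    "- (k^2 * x0^2) = - (x1 * x2 * x3)"
  shows "z * (z - of_real a) * (z - of_real b) - (of_real k * (z - of_real x0))^2
    = (z - of_real x1) * (z - of_real x2) * (z - of_real x3)"
proof -
  have "z * (z - of_real a) * (z - of_real b) - (of_real k * (z - of_real x0))^2 =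
    z^3 + of_real (- (a + b) - k^2) * z^2 + of_real (a * b + 2 * k^2 * x0) * z + of_real (- (k^2 * x0^2))"
    by (simp add: power2_eq_square power3_eq_cube algebra_simps)
  also have "\<dots> = (z - of_real x1) * (z - of_real x2) * (z - of_real x3)"
    unfolding assms by (simp add: power2_eq_square power3_eq_cube algebra_simps)
  finally show ?thesis .
qed

lemma slope_line_meets_cubic:
  assumes "\<beta> \<noteq> 0"
  obtains k x1 x2 x3 where "0 \<le> x1" "x1 < x0" "x0 < x2" "x2 \<le> a" "b \<le> x3"
    "\<And>t y. y^2 = t * (t - a) * (t - b) \<and> \<alpha> * (t - x0) + \<beta> * y = 0 \<longleftrightarrow>
      (t = x1 \<or> t = x2 \<or> t = x3) \<and> y = k * (t - x0)"
proof -
  define k where "k = - \<alpha> / \<beta>"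
  have line: "\<alpha> * (x - x0) + \<beta> * y = 0 \<longleftrightarrow> y = k * (x - x0)" for x y
    using assms by (simp add: k_def field_simps)
  obtain x1 x2 x3 where x: "0 \<le> x1" "x1 < x0" "x0 < x2" "x2 \<le> a" "b \<le> x3"
    and co: "- (a + b) - k^2 = - (x1 + x2 + x3)" "a * b + 2 * k^2 * x0 = x1 * x2 + x1 * x3 + x2 * x3"
    "- (k^2 * x0^2) = - (x1 * x2 * x3)" by (rule slope_line_roots)
  have root: "(k * (t - x0))^2 = t * (t - a) * (t - b) \<longleftrightarrow> t = x1 \<or> t = x2 \<or> t = x3" for t
    using slope_line_factor[OF co, of t] by auto
  show thesis
    by (rule that[OF x, of k]) (use line root in auto)
qed

text \<open>Homogeneous coordinates centred at the point \<open>(x0, 0)\<close> inside the oval.\<close>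

definition ell :: "'a::real_normed_field^3 \<Rightarrow> 'a" where "ell c = c$1 - of_real x0 * c$3"

lemma ell_vec [simp]: "ell (vector [x, y, z]) = x - of_real x0 * z"
  by (simp add: ell_def)

lemma line_meets_oval:
  assumes "\<alpha> \<noteq> 0 \<or> \<beta> \<noteq> 0"
  obtains w1 w2 where "{w \<in> oval. \<alpha> * ell w + \<beta> * w$2 = 0} = {w1, w2}"
    "ell w1 * ell w2 + w1$2 * w2$2 < 0"
proof (cases "\<beta> = 0")
  case True
  define h where "h = sqrt (x0 * (x0 - a) * (x0 - b))"
  have h: "h^2 = x0 * (x0 - a) * (x0 - b)" "0 < h" using value_at_x0 by (simp_all add: h_def)
  have "{w \<in> oval. \<alpha> * ell w + \<beta> * w$2 = 0} = {vector [x0, h, 1], vector [x0, -h, 1]}"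
    using assms True x0 by (auto simp: oval_pts_def vec3_eq_iff h(1)[symmetric] power2_eq_iff)
  moreover have "ell (vector [x0, h, 1] :: real^3) * ell (vector [x0, - h, 1] :: real^3)
      + (vector [x0, h, 1] :: real^3) $ 2 * (vector [x0, - h, 1] :: real^3) $ 2 < 0"
    using h(2) by simp
  ultimately show ?thesis by (rule that)
next
  case False
  obtain k x1 x2 x3 where x: "0 \<le> x1" "x1 < x0" "x0 < x2" "x2 \<le> a" "b \<le> x3"
    and on_line: "\<And>t y. y^2 = t * (t - a) * (t - b) \<and> \<alpha> * (t - x0) + \<beta> * y = 0 \<longleftrightarrow>
      (t = x1 \<or> t = x2 \<or> t = x3) \<and> y = k * (t - x0)"
    by (rule slope_line_meets_cubic[OF False]) (rule that)
  have "{w \<in> oval. \<alpha> * ell w + \<beta> * w$2 = 0} = {vector [x1, k * (x1 - x0), 1], vector [x2, k * (x2 - x0), 1]}"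
    (is "?S = ?T")
  proof -
    have key: "(0 \<le> t \<and> t \<le> a \<and> y^2 = t * (t - a) * (t - b)) \<and> \<alpha> * (t - x0) + \<beta> * y = 0 \<longleftrightarrow>
      (t = x1 \<or> t = x2) \<and> y = k * (t - x0)" for t y
      using on_line[of y t] x x0 ab by auto
    have "w \<in> ?S \<longleftrightarrow> w \<in> ?T" for w
    proof
      assume "w \<in> ?S"
      then obtain t y where w: "w = vector [t, y, 1]" "0 \<le> t \<and> t \<le> a \<and> y^2 = t * (t - a) * (t - b)"
        "\<alpha> * ell w + \<beta> * w$2 = 0" unfolding oval_pts_def by blast
      then have "(t = x1 \<or> t = x2) \<and> y = k * (t - x0)" using key[of t y] by simp
      then show "w \<in> ?T" unfolding w(1) by auto
    next
      assume "w \<in> ?T"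
      then obtain t where w: "w = vector [t, k * (t - x0), 1]" "t = x1 \<or> t = x2" by auto
      then have "(0 \<le> t \<and> t \<le> a \<and> (k * (t - x0))^2 = t * (t - a) * (t - b)) \<and> \<alpha> * (t - x0) + \<beta> * (k * (t - x0)) = 0"
        using key by blast
      then show "w \<in> ?S" unfolding w(1) by (simp add: oval_pts_def vec3_eq_iff)
    qed
    then show ?thesis by (rule set_eqI)
  qed
  moreover have "ell (vector [x1, k * (x1 - x0), 1]) * ell (vector [x2, k * (x2 - x0), 1])
      + (vector [x1, k * (x1 - x0), 1] :: real^3) $ 2 * (vector [x2, k * (x2 - x0), 1] :: real^3) $ 2 < 0"
  proof -
    have "(x1 - x0) * (x2 - x0) < 0" using x by (simp add: mult_neg_pos)
    moreover have "0 < 1 + k^2" by (simp add: add_pos_nonneg)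
    ultimately have "(1 + k^2) * ((x1 - x0) * (x2 - x0)) < 0" by (rule mult_pos_neg[rotated])
    then show ?thesis by (simp add: power2_eq_square algebra_simps)
  qed
  ultimately show ?thesis by (rule that)
qed

lemma line_meets_pseudoline:
  assumes "\<alpha> \<noteq> 0 \<or> \<beta> \<noteq> 0"
  obtains w1 where "{w \<in> pseudoline. \<alpha> * ell w + \<beta> * w$2 = 0} = {w1}"
proof (cases "\<beta> = 0")
  case True
  have "{w \<in> pseudoline. \<alpha> * ell w + \<beta> * w$2 = 0} = {vector [0, 1, 0]}"
    using assms True x0 ab by (auto simp: pseudoline_pts_def)
  then show ?thesis by (rule that)
next
  case False
  obtain k x1 x2 x3 where x: "0 \<le> x1" "x1 < x0" "x0 < x2" "x2 \<le> a" "b \<le> x3"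
    and on_line: "\<And>t y. y^2 = t * (t - a) * (t - b) \<and> \<alpha> * (t - x0) + \<beta> * y = 0 \<longleftrightarrow>
      (t = x1 \<or> t = x2 \<or> t = x3) \<and> y = k * (t - x0)"
    by (rule slope_line_meets_cubic[OF False]) (rule that)
  have "{w \<in> pseudoline. \<alpha> * ell w + \<beta> * w$2 = 0} = {vector [x3, k * (x3 - x0), 1]}"
    (is "?S = ?T")
  proof -
    have key: "(b \<le> t \<and> y^2 = t * (t - a) * (t - b)) \<and> \<alpha> * (t - x0) + \<beta> * y = 0 \<longleftrightarrow>
      t = x3 \<and> y = k * (t - x0)" for t y
      using on_line[of y t] x x0 ab by auto
    have "w \<in> ?S \<longleftrightarrow> w \<in> ?T" for w
    proof
      assume w: "w \<in> ?S"
      then have "w \<noteq> vector [0, 1, 0]" using False by auto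
      with w obtain t y where w: "w = vector [t, y, 1]" "b \<le> t \<and> y^2 = t * (t - a) * (t - b)"
        "\<alpha> * ell w + \<beta> * w$2 = 0" unfolding pseudoline_pts_def by blast
      then have "t = x3 \<and> y = k * (t - x0)" using key[of t y] by simp
      then show "w \<in> ?T" unfolding w(1) by auto
    next
      assume "w \<in> ?T"
      then have w: "w = vector [x3, k * (x3 - x0), 1]" by simp
      have "(b \<le> x3 \<and> (k * (x3 - x0))^2 = x3 * (x3 - a) * (x3 - b)) \<and> \<alpha> * (x3 - x0) + \<beta> * (k * (x3 - x0)) = 0"
        using key by blast
      then show "w \<in> ?S" unfolding w by (simp add: pseudoline_pts_def vec3_eq_iff)
    qed
    then show ?thesis by (rule set_eqI)
  qed
  then show ?thesis by (rule that)
qed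

lemma line_meets_cubic_in_real_points:
  fixes c :: "complex^3"
  assumes "\<alpha> \<noteq> 0 \<or> \<beta> \<noteq> 0" "c \<noteq> 0" "cubic c = 0" "of_real \<alpha> * ell c + of_real \<beta> * c$2 = 0"
  obtains k w where "k \<noteq> 0" "c = k *s complex_vec w"
proof (cases "c$3 = 0")
  case True
  then have "c$1 = 0" using assms(3) unfolding cubic_eq by simp
  then have "c = (c$2) *s complex_vec (vector [0, 1, 0])" using True by (simp add: vec_eq_iff forall_3)
  moreover have "c$2 \<noteq> 0" using True \<open>c$1 = 0\<close> assms(2) by (simp add: vec_eq_iff forall_3)
  ultimately show ?thesis by (intro that)
next
  case c3: False
  define z y where "z = c$1 / c$3" and "y = c$2 / c$3"
  have zc: "c$1 = c$3 * z" "c$2 = c$3 * y" using c3 by (simp_all add: z_def y_def)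
  have curve: "y^2 = z * (z - of_real a) * (z - of_real b)"
  proof -
    have "cubic c = (c$3)^3 * (y^2 - z * (z - of_real a) * (z - of_real b))"
      unfolding cubic_eq zc by (simp add: power2_eq_square power3_eq_cube algebra_simps)
    then show ?thesis using assms(3) c3 by simp
  qed
  have "(c$3) * (of_real \<alpha> * (z - of_real x0) + of_real \<beta> * y) = 0"
    using assms(4) unfolding ell_def zc by (simp add: algebra_simps)
  then have line: "of_real \<alpha> * (z - of_real x0) + of_real \<beta> * y = 0" using c3 by simp
  have "z \<in> \<real> \<and> y \<in> \<real>"
  proof (cases "\<beta> = 0")
    case True
    then have z: "z = of_real x0" using line assms(1) by simp
    define h where "h = sqrt (x0 * (x0 - a) * (x0 - b))"
    have "h^2 = x0 * (x0 - a) * (x0 - b)" using value_at_x0 by (simp add: h_def)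
    then have "y^2 = (of_real h)^2" unfolding curve z by (metis of_real_diff of_real_mult of_real_power)
    then show ?thesis using z by (auto simp: power2_eq_iff)
  next
    case False
    define k where "k = - \<alpha> / \<beta>"
    have y: "y = of_real k * (z - of_real x0)"
      using False line by (simp add: k_def field_simps)
    obtain x1 x2 x3 where co: "- (a + b) - k^2 = - (x1 + x2 + x3)"
      "a * b + 2 * k^2 * x0 = x1 * x2 + x1 * x3 + x2 * x3"
      "- (k^2 * x0^2) = - (x1 * x2 * x3)" by (rule slope_line_roots)
    have "(z - of_real x1) * (z - of_real x2) * (z - of_real x3) = 0"
      using slope_line_factor[OF co, of z] curve unfolding y by simp
    then have "z \<in> \<real>" by auto
    then show ?thesis by (simp add: y)
  qed
  then obtain z' y' where "z = of_real z'" "y = of_real y'" by (auto elim!: Reals_cases)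
  then have "c = (c$3) *s complex_vec (vector [z', y', 1])"
    using zc by (simp add: vec_eq_iff forall_3)
  then show ?thesis by (rule that[OF c3])
qed

abbreviation qA :: "real^6" where "qA \<equiv> vector [1, 0, -2 * x0, -1, 0, x0^2]"
abbreviation qB :: "real^6" where "qB \<equiv> vector [0, 2, 0, 0, -2 * x0, 0]"

lemma linear_form_veronese:
  "linear_form (vector [d1, d2, d3, d4, d5, d6]) (veronese_vec c) =
    of_real d1 * (c$1)^2 + of_real d2 * (c$1 * c$2) + of_real d3 * (c$1 * c$3)
    + of_real d4 * (c$2)^2 + of_real d5 * (c$2 * c$3) + of_real d6 * (c$3)^2"
  by (simp add: linear_form_def sum_6 vector_6 veronese_vec_nth power2_eq_square)

lemma qA: "linear_form qA (veronese_vec c) = (ell c)^2 - (c$2)^2"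
  and qB: "linear_form qB (veronese_vec c) = 2 * ell c * c$2"
  unfolding linear_form_veronese ell_def by (simp_all add: power2_eq_square algebra_simps)

lemma no_base_point:
  assumes "c \<noteq> 0" "cubic c = 0"
  shows "ell c \<noteq> 0 \<or> c$2 \<noteq> 0"
proof (rule ccontr)
  assume "\<not> ?thesis"
  then have e: "c$1 = of_real x0 * c$3" "c$2 = 0" by (simp_all add: ell_def)
  have "cubic c = - of_real (x0 * (x0 - a) * (x0 - b)) * (c$3)^3"
    unfolding cubic_eq e by (simp add: power3_eq_cube algebra_simps)
  then have "c$3 = 0" using assms(2) value_at_x0 by (auto simp del: of_real_mult of_real_diff)
  then show False using e assms(1) by (simp add: vec_eq_iff forall_3)
qed

lemma forms_nonzero:
  assumes "c \<noteq> 0" "cubic c = 0"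
  shows "linear_form qA (veronese_vec c) \<noteq> 0 \<or> linear_form qB (veronese_vec c) \<noteq> 0"
  using no_base_point[OF assms] unfolding qA qB by auto

lemma ell_complex_vec [simp]: "ell (complex_vec w) = of_real (ell w)"
  by (simp add: ell_def)

lemma curve_pts:
  assumes "w \<in> real_pts"
  shows "complex_vec w \<noteq> 0" "cubic (complex_vec w) = 0"
proof -
  have *: "(of_real y)^2 = (of_real x * (of_real x - of_real a) * (of_real x - of_real b) :: complex)"
    if "y^2 = x * (x - a) * (x - b)" for x y
    using that by (metis of_real_diff of_real_mult of_real_power)
  show "complex_vec w \<noteq> 0" using assms
    by (auto simp: oval_pts_def pseudoline_pts_def vec_eq_iff forall_3)
  show "cubic (complex_vec w) = 0" unfolding cubic_eq using assms
    by (auto simp: oval_pts_def pseudoline_pts_def *)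
qed

lemma oval_pts_3: "w \<in> oval \<Longrightarrow> w$3 = 1"
  by (auto simp: oval_pts_def)

lemma pseudoline_pts_cases: "w \<in> pseudoline \<Longrightarrow> w$3 = 1 \<or> w = vector [0, 1, 0]"
  by (auto simp: pseudoline_pts_def)

end

text \<open>
  Coordinates on projective 5-space are changed by an invertible matrix \<open>M\<close> with inverse \<open>N\<close>;
  \<open>V\<close> parametrises the transformed Veronese surface.
\<close>

locale veronese_pencil = two_component_cubic +
  fixes M N :: "real^6^6"
  assumes MN: "N ** M = mat 1" "M ** N = mat 1"
begin

definition V :: "complex^3 \<Rightarrow> complex^6" where "V c = cmat M *v veronese_vec c"

lemma linear_form_V: "linear_form (d v* N) (V c) = linear_form d (veronese_vec c)"
proof -
  have "linear_form (d v* N) (V c) = linear_form (d v* (N ** M)) (veronese_vec c)"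
    unfolding V_def linear_form_cmat vector_matrix_mul_assoc ..
  then show ?thesis by (simp add: MN)
qed

lemma V_scale: "V (k *s c) = k^2 *s V c"
proof -
  have "veronese_vec (k *s c) = k^2 *s veronese_vec c"
    by (simp add: vec_eq_iff forall_6 veronese_vec_nth power2_eq_square algebra_simps)
  then show ?thesis by (simp add: V_def cmat_scale)
qed

lemma veronese_vec_eq_0_iff: "veronese_vec c = 0 \<longleftrightarrow> c = 0"
  by (auto simp: vec_eq_iff forall_6 forall_3 veronese_vec_nth)

lemma V_eq_0_iff: "V c = 0 \<longleftrightarrow> c = 0"
  unfolding V_def cmat_eq_0_iff[OF MN(1)] by (rule veronese_vec_eq_0_iff)

lemma V_complex_vec_real: "V (complex_vec w) $ i \<in> \<real>"
proof -
  have "veronese_vec (complex_vec w) $ j \<in> \<real>" for j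
    using exhaust_6[of j] by (auto simp: veronese_vec_nth)
  then show ?thesis unfolding V_def matrix_vector_mult_def by (auto intro!: sum_in_Reals)
qed

definition Y where "Y = {abs_cproj (V c) |c. c \<noteq> 0 \<and> cubic c = 0}"

definition pt :: "real^3 \<Rightarrow> 6 cproj" where "pt w = abs_cproj (V (complex_vec w))"

definition L :: "(real^6) set" where "L = common_zeros (qA v* N) (qB v* N)"

lemma L_codim2: "L \<in> codim2_subspaces"
  unfolding L_def codim2_iff
proof (intro allI impI)
  fix s t assume st: "s *\<^sub>R (qA v* N) + t *\<^sub>R (qB v* N) = 0"
  have e: "of_real s * ((ell c)^2 - (c$2)^2) + of_real t * (2 * ell c * c$2) = (0::complex)" for c
    using linear_form_combination[of s "qA v* N" t "qB v* N" "V c", unfolded st linear_form_V qA qB]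
    by (simp add: linear_form_def)
  show "s = 0 \<and> t = 0"
    using e[of "vector [1, 0, 0]"] e[of "vector [1, 1, 0]"] by simp
qed

lemma L_linear_subspace: "L \<in> linear_subspaces 3"
  using L_codim2 by (auto simp: linear_subspaces_def codim2_subspaces_def)

lemma Y_disjoint_L: "complex_points L \<inter> Y = {}"
proof (rule ccontr)
  assume "\<not> ?thesis"
  then obtain x c where x: "x \<noteq> 0" "(\<chi> i. Re (x $ i)) \<in> L" "(\<chi> i. Im (x $ i)) \<in> L"
    and c: "c \<noteq> 0" "cubic c = 0" "abs_cproj x = abs_cproj (V c)"
    unfolding complex_points_def Y_def by auto
  obtain k where k: "V c = k *s x"
    using c(3) abs_cproj_eq_iff[OF x(1), of "V c"] c(1) V_eq_0_iff by auto
  have z: "linear_form d x = Complex (d \<bullet> (\<chi> i. Re (x $ i))) (d \<bullet> (\<chi> i. Im (x $ i)))" for d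
    by (simp add: linear_form_def inner_vec_def complex_eq_iff)
  have "linear_form (qA v* N) x = 0" "linear_form (qB v* N) x = 0"
    using x(2,3) unfolding z L_def common_zeros_def by (simp_all add: complex_eq_iff)
  then have "linear_form (qA v* N) (V c) = 0" "linear_form (qB v* N) (V c) = 0"
    unfolding k linear_form_scale by simp_all
  then show False using forms_nonzero[OF c(1,2)] unfolding linear_form_V by simp
qed

definition coordinates :: "(6 cproj \<Rightarrow> 2 cproj) \<Rightarrow> real^6 \<Rightarrow> real^6 \<Rightarrow> real \<Rightarrow> real \<Rightarrow> real \<Rightarrow> real \<Rightarrow> bool" where
  "coordinates f a' b' g11 g12 g21 g22 \<longleftrightarrow> f = pencil_map a' b' \<and> g11 * g22 - g12 * g21 \<noteq> 0 \<and>
    (\<forall>c. linear_form a' (V c) = of_real g11 * ((ell c)^2 - (c$2)^2) + of_real g12 * (2 * ell c * c$2)) \<and>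
    (\<forall>c. linear_form b' (V c) = of_real g21 * ((ell c)^2 - (c$2)^2) + of_real g22 * (2 * ell c * c$2)) \<and>
    (\<forall>c. c \<noteq> 0 \<longrightarrow> cubic c = 0 \<longrightarrow> linear_form a' (V c) \<noteq> 0 \<or> linear_form b' (V c) \<noteq> 0)"

lemma coordinatesD:
  assumes "coordinates f a' b' g11 g12 g21 g22"
  shows "f = pencil_map a' b'" "g11 * g22 - g12 * g21 \<noteq> 0"
    "linear_form a' (V c) = of_real g11 * ((ell c)^2 - (c$2)^2) + of_real g12 * (2 * ell c * c$2)"
    "linear_form b' (V c) = of_real g21 * ((ell c)^2 - (c$2)^2) + of_real g22 * (2 * ell c * c$2)"
    "c \<noteq> 0 \<Longrightarrow> cubic c = 0 \<Longrightarrow> linear_form a' (V c) \<noteq> 0 \<or> linear_form b' (V c) \<noteq> 0"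
  using assms unfolding coordinates_def by blast+

context
  fixes f assumes f: "f \<in> projections_from L"
begin

lemma projection_coordinates:
  obtains a' b' g11 g12 g21 g22 where "coordinates f a' b' g11 g12 g21 g22"
proof -
  obtain a' b' where ab': "f = pencil_map a' b'" "common_zeros a' b' = L"
    using f by (auto simp: projections_from_def)
  obtain g11 g12 g21 g22 where g: "a' = g11 *\<^sub>R (qA v* N) + g12 *\<^sub>R (qB v* N)"
    "b' = g21 *\<^sub>R (qA v* N) + g22 *\<^sub>R (qB v* N)" "g11 * g22 - g12 * g21 \<noteq> 0"
    by (rule common_zeros_eq_imp_combination[of "qA v* N" "qB v* N" a' b'])
      (use ab'(2) L_codim2 L_def in auto)
  have lf: "linear_form a' (V c) = of_real g11 * ((ell c)^2 - (c$2)^2) + of_real g12 * (2 * ell c * c$2)"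
    "linear_form b' (V c) = of_real g21 * ((ell c)^2 - (c$2)^2) + of_real g22 * (2 * ell c * c$2)" for c
    unfolding g linear_form_combination linear_form_V qA qB by simp_all
  have nz: "linear_form a' (V c) \<noteq> 0 \<or> linear_form b' (V c) \<noteq> 0" if "c \<noteq> 0" "cubic c = 0" for c
  proof (rule ccontr)
    assume "\<not> ?thesis"
    then have z: "of_real g11 * ((ell c)^2 - (c$2)^2) + of_real g12 * (2 * ell c * c$2) = 0"
      "of_real g21 * ((ell c)^2 - (c$2)^2) + of_real g22 * (2 * ell c * c$2) = 0"
      unfolding lf by simp_all
    have "of_real (g11 * g22 - g12 * g21) * ((ell c)^2 - (c$2)^2) = 0"
      "of_real (g11 * g22 - g12 * g21) * (2 * ell c * c$2) = 0"
      unfolding of_real_diff of_real_mult using z by algebra+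
    then have "(ell c)^2 - (c$2)^2 = 0" "2 * ell c * c$2 = 0"
      using g(3) by (simp_all only: mult_eq_0_iff of_real_eq_0_iff simp_thms)
    then show False using forms_nonzero[OF that] unfolding qA qB by simp
  qed
  show thesis by (rule that, unfold coordinates_def) (use ab'(1) g(3) lf nz in blast)
qed

lemma projection_real_fibre:
  assumes "r \<in> real_points"
  obtains d1 d2 :: real where "d1 \<noteq> 0 \<or> d2 \<noteq> 0"
    "\<And>c. c \<noteq> 0 \<Longrightarrow> cubic c = 0 \<Longrightarrow> f (abs_cproj (V c)) = r \<longleftrightarrow>
      (of_real d1 * ell c + of_real d2 * c$2) * (of_real d2 * ell c + of_real (- d1) * c$2) = 0"
proof -
  obtain a' b' g11 g12 g21 g22 where "coordinates f a' b' g11 g12 g21 g22"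
    by (rule projection_coordinates)
  note g = coordinatesD(1,2)[OF this] and lf = coordinatesD(3,4)[OF this] and nz = coordinatesD(5)[OF this]
  let ?D = "g11 * g22 - g12 * g21"
  obtain v :: "real^2" where v: "v \<noteq> 0" "r = abs_cproj (complex_vec v)"
    using assms unfolding real_points_eq by auto
  have r: "r = abs_cproj (vector [of_real (v$1), of_real (v$2)])"
    unfolding v(2) by (rule arg_cong[of _ _ abs_cproj]) (simp add: vec_eq_iff forall_2)
  have v0: "v$1 \<noteq> 0 \<or> v$2 \<noteq> 0" using v(1) by (simp add: vec_eq_iff forall_2)
  define s1 s2 where "s1 = (g22 * v$1 - g12 * v$2) / ?D" and "s2 = (- g21 * v$1 + g11 * v$2) / ?D"
  have v12: "v$1 = g11 * s1 + g12 * s2" "v$2 = g21 * s1 + g22 * s2"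
    unfolding s1_def s2_def using g(2) by (simp_all add: divide_simps) (simp_all add: algebra_simps)
  define \<delta> where "\<delta> = csqrt (Complex s1 s2)"
  have "\<delta>^2 = Complex s1 s2" by (simp add: \<delta>_def)
  then have s: "s1 = (Re \<delta>)^2 - (Im \<delta>)^2" "s2 = 2 * Re \<delta> * Im \<delta>"
    by (simp_all add: complex_eq_iff power2_eq_square ac_simps)
  show thesis
  proof (rule that[of "Re \<delta>" "Im \<delta>"])
    show "Re \<delta> \<noteq> 0 \<or> Im \<delta> \<noteq> 0" using v0 v12 s by auto
    fix c assume c: "c \<noteq> 0" "cubic c = 0"
    have "f (abs_cproj (V c)) = abs_cproj (vector [linear_form a' (V c), linear_form b' (V c)])"
      unfolding g(1) by (rule pencil_map_abs) (rule nz[OF c])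
    then have "f (abs_cproj (V c)) = r \<longleftrightarrow>
        linear_form a' (V c) * of_real (v$2) = linear_form b' (V c) * of_real (v$1)"
      unfolding r by (simp only: abs_cproj_pair_eq_iff nz[OF c] v0 of_real_eq_0_iff)
    also have "\<dots> \<longleftrightarrow> linear_form a' (V c) * of_real (v$2) - linear_form b' (V c) * of_real (v$1) = 0"
      by simp
    also have "linear_form a' (V c) * of_real (v$2) - linear_form b' (V c) * of_real (v$1) =
        of_real (2 * ?D) * ((of_real (Re \<delta>) * ell c + of_real (Im \<delta>) * c$2) *
          (of_real (Im \<delta>) * ell c + of_real (- Re \<delta>) * c$2))"
      unfolding lf v12 s of_real_add of_real_mult of_real_diff of_real_minus of_real_power of_real_numeral
      by (simp add: power2_eq_square algebra_simps)
    also have "\<dots> = 0 \<longleftrightarrow> (of_real (Re \<delta>) * ell c + of_real (Im \<delta>) * c$2) *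
          (of_real (Im \<delta>) * ell c + of_real (- Re \<delta>) * c$2) = 0"
      using g(2) by (simp only: mult_eq_0_iff[of "of_real (2 * ?D)"] of_real_eq_0_iff mult_eq_0_iff[of 2]) simp
    finally show "f (abs_cproj (V c)) = r \<longleftrightarrow>
        (of_real (Re \<delta>) * ell c + of_real (Im \<delta>) * c$2) *
          (of_real (Im \<delta>) * ell c + of_real (- Re \<delta>) * c$2) = 0" .
  qed
qed

lemma projection_eq_iff:
  assumes "c \<noteq> 0" "cubic c = 0" "d \<noteq> 0" "cubic d = 0"
  shows "f (abs_cproj (V c)) = f (abs_cproj (V d)) \<longleftrightarrow>
    (ell c * ell d + c$2 * d$2) * (ell c * d$2 - c$2 * ell d) = 0"
proof -
  obtain a' b' g11 g12 g21 g22 where "coordinates f a' b' g11 g12 g21 g22"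
    by (rule projection_coordinates)
  note g = coordinatesD(1,2)[OF this] and lf = coordinatesD(3,4)[OF this] and nz = coordinatesD(5)[OF this]
  let ?D = "g11 * g22 - g12 * g21"
  have "f (abs_cproj (V c)) = f (abs_cproj (V d)) \<longleftrightarrow>
      linear_form a' (V c) * linear_form b' (V d) = linear_form b' (V c) * linear_form a' (V d)"
    unfolding g(1) pencil_map_abs[OF nz[OF assms(1,2)]] pencil_map_abs[OF nz[OF assms(3,4)]]
    by (rule abs_cproj_pair_eq_iff) (rule nz[OF assms(1,2)], rule nz[OF assms(3,4)])
  also have "\<dots> \<longleftrightarrow> linear_form a' (V c) * linear_form b' (V d) - linear_form b' (V c) * linear_form a' (V d) = 0"
    by simp
  also have "linear_form a' (V c) * linear_form b' (V d) - linear_form b' (V c) * linear_form a' (V d) =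
      of_real (2 * ?D) * ((ell c * ell d + c$2 * d$2) * (ell c * d$2 - c$2 * ell d))"
    unfolding lf of_real_mult of_real_diff by (simp add: power2_eq_square algebra_simps)
  also have "\<dots> = 0 \<longleftrightarrow> (ell c * ell d + c$2 * d$2) * (ell c * d$2 - c$2 * ell d) = 0"
    using g(2) by (simp only: mult_eq_0_iff[of "of_real (2 * ?D)"] of_real_eq_0_iff mult_eq_0_iff[of 2]) simp
  finally show ?thesis .
qed

lemma projection_separating: "separating Y f"
  unfolding separating_def
proof (intro equalityI subsetI)
  fix p assume "p \<in> {p \<in> Y. f p \<in> real_points}"
  then obtain c where c: "c \<noteq> 0" "cubic c = 0" "p = abs_cproj (V c)" "f p \<in> real_points" "p \<in> Y"
    by (auto simp: Y_def)
  obtain d1 d2 :: real where d: "d1 \<noteq> 0 \<or> d2 \<noteq> 0"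
    "(of_real d1 * ell c + of_real d2 * c$2) * (of_real d2 * ell c + of_real (- d1) * c$2) = 0"
    using projection_real_fibre[OF c(4)] c by metis
  then obtain \<alpha> \<beta> :: real where "\<alpha> \<noteq> 0 \<or> \<beta> \<noteq> 0" "of_real \<alpha> * ell c + of_real \<beta> * c$2 = 0"
    by (metis mult_eq_0_iff neg_equal_0_iff_equal)
  then obtain k w where kw: "k \<noteq> 0" "c = k *s complex_vec w"
    using line_meets_cubic_in_real_points[of \<alpha> \<beta> c] c(1,2) by metis
  have "complex_vec w \<noteq> 0" using c(1) kw(2) by auto
  then have nz: "V (complex_vec w) \<noteq> 0" using V_eq_0_iff by blast
  have "p = abs_cproj (V (complex_vec w))"
    unfolding c(3) kw(2) V_scale using abs_cproj_scale[OF nz] kw(1) by simp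
  then have "p \<in> real_points" unfolding real_points_def using nz V_complex_vec_real by blast
  then show "p \<in> Y \<inter> real_points" using c(5) by simp
next
  fix p assume p: "p \<in> Y \<inter> real_points"
  obtain a' b' g11 g12 g21 g22 where "coordinates f a' b' g11 g12 g21 g22"
    by (rule projection_coordinates)
  note g = coordinatesD(1,2)[OF this] and lf = coordinatesD(3,4)[OF this] and nz = coordinatesD(5)[OF this]
  obtain c where c: "c \<noteq> 0" "cubic c = 0" "p = abs_cproj (V c)" using p by (auto simp: Y_def)
  obtain v :: "real^6" where v: "v \<noteq> 0" "p = abs_cproj (complex_vec v)" using p by (auto simp: real_points_eq)
  obtain k where k: "V c = k *s complex_vec v"
    using c(3) v abs_cproj_eq_iff[of "complex_vec v" "V c"] c(1) V_eq_0_iff by auto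
  have n: "linear_form a' (complex_vec v) \<noteq> 0 \<or> linear_form b' (complex_vec v) \<noteq> 0"
    using nz[OF c(1,2)] unfolding k linear_form_scale by auto
  then have "f p = abs_cproj (vector [of_real (a' \<bullet> v), of_real (b' \<bullet> v)])"
    unfolding g(1) v(2) by (subst pencil_map_abs) simp_all
  moreover have "(vector [of_real (a' \<bullet> v), of_real (b' \<bullet> v)] :: complex^2) $ i \<in> \<real>" for i
    using exhaust_2[of i] by auto
  moreover have "(vector [of_real (a' \<bullet> v), of_real (b' \<bullet> v)] :: complex^2) \<noteq> 0"
    using n by (simp add: vec2_eq_0_iff)
  ultimately have "f p \<in> real_points" unfolding real_points_def by blast
  then show "p \<in> {p \<in> Y. f p \<in> real_points}" using p by simp
qed

end

lemma L_hyperbolic: "hyperbolic_wrt Y L"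
  unfolding hyperbolic_wrt_def using L_codim2 Y_disjoint_L projection_separating by blast

end

context veronese_pencil
begin

lemma oval_pseudoline_disjoint: "oval \<inter> pseudoline = {}"
  using ab by (auto simp: oval_pts_def pseudoline_pts_def vec3_eq_iff)

lemma inj_on_pt: "inj_on pt (real_pts)"
proof (rule inj_onI)
  fix w w' assume w: "w \<in> real_pts" and w': "w' \<in> real_pts"
    and eq: "pt w = pt w'"
  have "V (complex_vec w) \<noteq> 0" "V (complex_vec w') \<noteq> 0"
    using curve_pts(1)[OF w] curve_pts(1)[OF w'] V_eq_0_iff by auto
  then obtain k where k: "k \<noteq> 0" "V (complex_vec w') = k *s V (complex_vec w)"
    using eq abs_cproj_eq_iff unfolding pt_def by metis
  have lf: "linear_form d (veronese_vec (complex_vec w')) = k * linear_form d (veronese_vec (complex_vec w))" for d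
    using linear_form_V[of d "complex_vec w'"] linear_form_V[of d "complex_vec w"]
    unfolding k(2) linear_form_scale by metis
  have "of_real (w'$3) ^ 2 = k * of_real (w$3) ^ 2"
    using lf[of "vector [0, 0, 0, 0, 0, 1]"] unfolding linear_form_veronese by simp
  moreover have "of_real (w'$1) * of_real (w'$3) = k * (of_real (w$1) * of_real (w$3))"
    using lf[of "vector [0, 0, 1, 0, 0, 0]"] unfolding linear_form_veronese by simp
  moreover have "of_real (w'$2) * of_real (w'$3) = k * (of_real (w$2) * of_real (w$3))"
    using lf[of "vector [0, 0, 0, 0, 1, 0]"] unfolding linear_form_veronese by simp
  moreover have "w$3 = 1 \<or> w = vector [0, 1, 0]" "w'$3 = 1 \<or> w' = vector [0, 1, 0]"
    using w w' oval_pts_3 pseudoline_pts_cases by blast+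
  ultimately show "w = w'" using k(1) by (auto simp: vec_eq_iff forall_3)
qed

lemma pt_in_Y_real:
  assumes "w \<in> real_pts"
  shows "pt w \<in> Y \<inter> real_points"
  unfolding Y_def real_points_def pt_def
  using curve_pts[OF assms] V_complex_vec_real V_eq_0_iff by blast

definition near :: "real^3 \<Rightarrow> 6 cproj set" where
  "near w = {p. 0 < Re (linear_form ((((ell w)^2 - (w$2)^2) *\<^sub>R qA + (2 * ell w * w$2) *\<^sub>R qB) v* N) (rep_cproj p)
      * cnj (linear_form (vector [1, 0, -2 * x0, 1, 0, x0^2] v* N) (rep_cproj p)))}"

definition same_side :: "real^3 \<Rightarrow> 6 cproj set" where
  "same_side w = {p. 0 < Re (linear_form (vector [0, 0, ell w, 0, w$2, - x0 * ell w] v* N) (rep_cproj p)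
      * cnj (linear_form (vector [0, 0, 0, 0, 0, 1] v* N) (rep_cproj p)))}"

lemma open_near: "open (near w)" and open_same_side: "open (same_side w)"
  unfolding near_def same_side_def by (rule open_positive_product)+

lemma real_no_base_point:
  assumes "w \<in> real_pts"
  shows "ell w \<noteq> 0 \<or> w$2 \<noteq> 0"
  using no_base_point[OF curve_pts[OF assms]] by simp

text \<open>\<open>near w\<close> is the condition that the directions from \<open>(x0, 0)\<close> differ by less than 45 degrees.\<close>

lemma pt_in_near_iff:
  assumes "w' \<in> real_pts"
  shows "pt w' \<in> near w \<longleftrightarrow> (ell w * w'$2 - w$2 * ell w')^2 < (ell w * ell w' + w$2 * w'$2)^2"
proof -
  have nz: "V (complex_vec w') \<noteq> 0" using curve_pts(1)[OF assms] V_eq_0_iff by blast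
  have lf1: "linear_form ((((ell w)^2 - (w$2)^2) *\<^sub>R qA + (2 * ell w * w$2) *\<^sub>R qB) v* N) (V (complex_vec w'))
      = of_real (((ell w)^2 - (w$2)^2) * ((ell w')^2 - (w'$2)^2) + (2 * ell w * w$2) * (2 * ell w' * w'$2))"
    unfolding linear_form_V linear_form_combination qA qB by simp
  have lf2: "linear_form (vector [1, 0, -2 * x0, 1, 0, x0^2] v* N) (V (complex_vec w'))
      = of_real ((ell w')^2 + (w'$2)^2)"
    unfolding linear_form_V linear_form_veronese ell_def by (simp add: power2_eq_square algebra_simps)
  have pos: "0 < (ell w')^2 + (w'$2)^2"
    using real_no_base_point[OF assms] by (simp add: sum_power2_gt_zero_iff)
  have "pt w' \<in> near w \<longleftrightarrow> 0 < (((ell w)^2 - (w$2)^2) * ((ell w')^2 - (w'$2)^2) + (2 * ell w * w$2) * (2 * ell w' * w'$2))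
      * ((ell w')^2 + (w'$2)^2)"
    unfolding near_def pt_def mem_Collect_eq positive_product_abs[OF nz] lf1 lf2
      complex_cnj_complex_of_real of_real_mult[symmetric] Re_complex_of_real ..
  also have "\<dots> \<longleftrightarrow> 0 < ((ell w)^2 - (w$2)^2) * ((ell w')^2 - (w'$2)^2) + (2 * ell w * w$2) * (2 * ell w' * w'$2)"
    using pos by (simp only: zero_less_mult_iff) auto
  also have "((ell w)^2 - (w$2)^2) * ((ell w')^2 - (w'$2)^2) + (2 * ell w * w$2) * (2 * ell w' * w'$2)
      = (ell w * ell w' + w$2 * w'$2)^2 - (ell w * w'$2 - w$2 * ell w')^2"
    by (simp add: power2_eq_square algebra_simps)
  finally show ?thesis by simp
qed

lemma pt_in_same_side_iff:
  assumes "w' \<in> oval"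
  shows "pt w' \<in> same_side w \<longleftrightarrow> 0 < ell w * ell w' + w$2 * w'$2"
proof -
  have nz: "V (complex_vec w') \<noteq> 0" using curve_pts(1)[of w'] assms V_eq_0_iff by blast
  have lf1: "linear_form (vector [0, 0, ell w, 0, w$2, - x0 * ell w] v* N) (V (complex_vec w'))
      = of_real (ell w * ell w' + w$2 * w'$2)"
    unfolding linear_form_V linear_form_veronese ell_def using oval_pts_3[OF assms]
    by (simp add: algebra_simps)
  have lf2: "linear_form (vector [0, 0, 0, 0, 0, 1] v* N) (V (complex_vec w')) = of_real 1"
    unfolding linear_form_V linear_form_veronese using oval_pts_3[OF assms] by simp
  show ?thesis
    unfolding same_side_def pt_def mem_Collect_eq positive_product_abs[OF nz] lf1 lf2 by simp
qed

lemma angle_lt_90: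
  fixes l m l1 m1 l2 m2 :: real
  assumes "(l * m1 - m * l1)^2 < (l * l1 + m * m1)^2" "(l * m2 - m * l2)^2 < (l * l2 + m * m2)^2"
  shows "l1 * l2 + m1 * m2 \<noteq> 0"
    and "0 < l * l1 + m * m1 \<Longrightarrow> 0 < l * l2 + m * m2 \<Longrightarrow> 0 < l1 * l2 + m1 * m2"
proof -
  let ?u1 = "l * l1 + m * m1" and ?u2 = "l * l2 + m * m2"
    and ?v1 = "l * m1 - m * l1" and ?v2 = "l * m2 - m * l2"
  have e: "(l^2 + m^2) * (l1 * l2 + m1 * m2) = ?u1 * ?u2 + ?v1 * ?v2"
    by (simp add: power2_eq_square algebra_simps)
  have "\<bar>?v1\<bar> < \<bar>?u1\<bar>" "\<bar>?v2\<bar> < \<bar>?u2\<bar>"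
    using assms by (metis abs_ge_zero power2_abs power_less_imp_less_base)+
  then have lt: "\<bar>?v1 * ?v2\<bar> < \<bar>?u1 * ?u2\<bar>"
    unfolding abs_mult by (intro mult_strict_mono') auto
  then show "l1 * l2 + m1 * m2 \<noteq> 0" using e by auto
  assume "0 < ?u1" "0 < ?u2"
  then have "0 < ?u1 * ?u2" by simp
  then have "0 < (l^2 + m^2) * (l1 * l2 + m1 * m2)" using lt unfolding e by linarith
  then show "0 < l1 * l2 + m1 * m2" by (simp add: zero_less_mult_iff not_less[symmetric]) 
      (smt (verit) sum_power2_ge_zero)
qed

context
  fixes f assumes f: "f \<in> projections_from L"
begin

lemma pt_projection_eq_iff:
  assumes w: "w \<in> real_pts" "w' \<in> real_pts"
  shows "f (pt w) = f (pt w') \<longleftrightarrow> (ell w * ell w' + w$2 * w'$2) * (ell w * w'$2 - w$2 * ell w') = 0"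
proof -
  have "f (pt w) = f (pt w') \<longleftrightarrow>
     of_real ((ell w * ell w' + w$2 * w'$2) * (ell w * w'$2 - w$2 * ell w')) = (0::complex)"
    unfolding pt_def projection_eq_iff[OF f curve_pts[OF w(1)] curve_pts[OF w(2)]]
    by (simp only: ell_complex_vec complex_vec_nth of_real_mult of_real_add of_real_diff)
  then show ?thesis by (simp only: of_real_eq_0_iff)
qed

lemma pt_projection_fibre:
  assumes "r \<in> real_points"
  obtains d1 d2 :: real where "d1 \<noteq> 0 \<or> d2 \<noteq> 0"
    "\<And>w. w \<in> real_pts \<Longrightarrow>
      f (pt w) = r \<longleftrightarrow> d1 * ell w + d2 * w$2 = 0 \<or> d2 * ell w + (- d1) * w$2 = 0"
proof -
  obtain d1 d2 :: real where d: "d1 \<noteq> 0 \<or> d2 \<noteq> 0"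
    "\<And>c. c \<noteq> 0 \<Longrightarrow> cubic c = 0 \<Longrightarrow> f (abs_cproj (V c)) = r \<longleftrightarrow>
      (of_real d1 * ell c + of_real d2 * c$2) * (of_real d2 * ell c + of_real (- d1) * c$2) = 0"
    by (rule projection_real_fibre[OF f assms]) (rule that)
  show thesis
  proof (rule that[OF d(1)])
    fix w assume w: "w \<in> real_pts"
    have "f (pt w) = r \<longleftrightarrow> of_real ((d1 * ell w + d2 * w$2) * (d2 * ell w + (- d1) * w$2)) = (0::complex)"
      unfolding pt_def d(2)[OF curve_pts[OF w]]
      by (simp only: ell_complex_vec complex_vec_nth of_real_mult of_real_add)
    then show "f (pt w) = r \<longleftrightarrow> d1 * ell w + d2 * w$2 = 0 \<or> d2 * ell w + (- d1) * w$2 = 0"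
      by (simp only: of_real_eq_0_iff mult_eq_0_iff)
  qed
qed

lemma perpendicular_lines_disjoint:
  assumes "w \<in> real_pts" "d1 \<noteq> 0 \<or> d2 \<noteq> 0"
    "d1 * ell w + d2 * w$2 = 0" "d2 * ell w + (- d1) * w$2 = 0"
  shows False
proof -
  have "(d1^2 + d2^2) * ell w = 0" "(d1^2 + d2^2) * w$2 = 0"
    using assms(3,4) by algebra+
  moreover have "d1^2 + d2^2 \<noteq> 0" using assms(2) by (simp add: sum_power2_eq_zero_iff)
  ultimately show False using real_no_base_point[OF assms(1)] by auto
qed

lemma fibre_card:
  assumes S: "S \<subseteq> real_pts" and r: "r \<in> real_points"
    and line: "\<And>\<alpha> \<beta>. \<alpha> \<noteq> 0 \<or> \<beta> \<noteq> 0 \<Longrightarrow>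
      finite {w \<in> S. \<alpha> * ell w + \<beta> * w$2 = 0} \<and> card {w \<in> S. \<alpha> * ell w + \<beta> * w$2 = 0} = n"
  shows "finite {p \<in> pt ` S. f p = r} \<and> card {p \<in> pt ` S. f p = r} = 2 * n"
proof -
  obtain d1 d2 :: real where d: "d1 \<noteq> 0 \<or> d2 \<noteq> 0"
    "\<And>w. w \<in> real_pts \<Longrightarrow>
      f (pt w) = r \<longleftrightarrow> d1 * ell w + d2 * w$2 = 0 \<or> d2 * ell w + (- d1) * w$2 = 0"
    by (rule pt_projection_fibre[OF r]) (rule that)
  let ?A = "{w \<in> S. d1 * ell w + d2 * w$2 = 0}"
  let ?B = "{w \<in> S. d2 * ell w + (- d1) * w$2 = 0}"
  have AB: "finite ?A" "card ?A = n" "finite ?B" "card ?B = n"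
    using line[of d1 d2] line[of d2 "- d1"] d(1) by auto
  have "?A \<inter> ?B = {}" using perpendicular_lines_disjoint[OF _ d(1)] S by blast
  then have "card (?A \<union> ?B) = 2 * n" using AB by (simp add: card_Un_disjoint)
  moreover have "inj_on pt (?A \<union> ?B)" using inj_on_pt by (rule inj_on_subset) (use S in auto)
  moreover have e: "{p \<in> pt ` S. f p = r} = pt ` (?A \<union> ?B)"
    using S d(2) by auto
  ultimately show ?thesis using AB unfolding e by (simp add: card_image)
qed

lemma oval_fibre:
  assumes "r \<in> real_points"
  shows "finite {p \<in> pt ` oval. f p = r} \<and> card {p \<in> pt ` oval. f p = r} = 2 * 2"
proof (rule fibre_card[OF Un_upper1 assms])
  fix \<alpha> \<beta> :: real assume "\<alpha> \<noteq> 0 \<or> \<beta> \<noteq> 0"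
  then obtain w1 w2 where w: "{w \<in> oval. \<alpha> * ell w + \<beta> * w$2 = 0} = {w1, w2}"
    "ell w1 * ell w2 + w1$2 * w2$2 < 0" by (rule line_meets_oval)
  have "w1 \<noteq> w2" using w(2) by (metis sum_squares_ge_zero not_less)
  then show "finite {w \<in> oval. \<alpha> * ell w + \<beta> * w$2 = 0} \<and> card {w \<in> oval. \<alpha> * ell w + \<beta> * w$2 = 0} = 2"
    unfolding w(1) by simp
qed

lemma pseudoline_fibre:
  assumes "r \<in> real_points"
  shows "finite {p \<in> pt ` pseudoline. f p = r} \<and> card {p \<in> pt ` pseudoline. f p = r} = 2 * 1"
proof (rule fibre_card[OF Un_upper2 assms])
  fix \<alpha> \<beta> :: real assume "\<alpha> \<noteq> 0 \<or> \<beta> \<noteq> 0"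
  then obtain w where w: "{w \<in> pseudoline. \<alpha> * ell w + \<beta> * w$2 = 0} = {w}" by (rule line_meets_pseudoline)
  show "finite {w \<in> pseudoline. \<alpha> * ell w + \<beta> * w$2 = 0} \<and> card {w \<in> pseudoline. \<alpha> * ell w + \<beta> * w$2 = 0} = 1"
    unfolding w by simp
qed

lemma continuous_on_projection: "continuous_on Y f"
proof -
  obtain a' b' g11 g12 g21 g22 where "coordinates f a' b' g11 g12 g21 g22"
    by (rule projection_coordinates[OF f])
  note g = coordinatesD(1)[OF this] and nz = coordinatesD(5)[OF this]
  show ?thesis unfolding g(1)
  proof (rule continuous_on_subset[OF continuous_on_pencil_map], rule subsetI)
    fix p assume "p \<in> Y"
    then obtain c where c: "c \<noteq> 0" "cubic c = 0" "p = abs_cproj (V c)" by (auto simp: Y_def)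
    have "V c \<noteq> 0" using c(1) V_eq_0_iff by blast
    then obtain k where k: "k \<noteq> 0" "rep_cproj p = k *s V c" unfolding c(3) by (rule rep_abs_cproj)
    show "p \<in> {p. linear_form a' (rep_cproj p) \<noteq> 0 \<or> linear_form b' (rep_cproj p) \<noteq> 0}"
      using nz[OF c(1,2)] k(1) unfolding mem_Collect_eq k(2) linear_form_scale by simp
  qed
qed

lemma covering_from_fibres:
  assumes S: "S \<subseteq> real_pts" "compact (pt ` S)" and n: "n \<noteq> 0"
    and fibre: "\<And>r. r \<in> real_points \<Longrightarrow> finite {p \<in> pt ` S. f p = r} \<and> card {p \<in> pt ` S. f p = r} = n"
    and inj: "\<And>w. w \<in> S \<Longrightarrow> \<exists>U. open U \<and> pt w \<in> U \<and> inj_on f (pt ` S \<inter> U)"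
  shows "covering_of_degree (pt ` S) f n"
  unfolding covering_of_degree_def
proof (intro conjI ballI)
  have Y: "pt ` S \<subseteq> Y \<inter> real_points" using pt_in_Y_real S(1) by blast
  show "covering_space (pt ` S) f real_points"
  proof (rule covering_space_of_locally_injective[OF S(2)])
    show "continuous_on (pt ` S) f" using continuous_on_projection by (rule continuous_on_subset) (use Y in auto)
    show "f ` pt ` S = real_points"
    proof
      show "f ` pt ` S \<subseteq> real_points"
        using projection_separating[OF f] Y unfolding separating_def by blast
      show "real_points \<subseteq> f ` pt ` S"
      proof
        fix r :: "2 cproj" assume "r \<in> real_points"
        then have "{p \<in> pt ` S. f p = r} \<noteq> {}" using fibre[of r] n by (metis card.empty)
        then show "r \<in> f ` pt ` S" by blast
      qed
    qed
    show "\<exists>U. open U \<and> p \<in> U \<and> inj_on f (pt ` S \<inter> U)" if "p \<in> pt ` S" for p using inj that by blast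
  qed (rule fibre)
qed (use fibre in auto)

lemma oval_covering:
  assumes "compact (pt ` oval)"
  shows "covering_of_degree (pt ` oval) f 4"
proof (rule covering_from_fibres[OF Un_upper1 assms _ oval_fibre[simplified]])
  fix w assume w: "w \<in> oval"
  have w': "w \<in> real_pts" using w by simp
  have pos: "0 < ell w * ell w + w$2 * w$2"
    using real_no_base_point[OF w'] by (simp add: sum_squares_gt_zero_iff)
  show "\<exists>U. open U \<and> pt w \<in> U \<and> inj_on f (pt ` oval \<inter> U)"
  proof (intro exI[of _ "near w \<inter> same_side w"] conjI open_Int open_near open_same_side)
    show "pt w \<in> near w \<inter> same_side w"
      using pos real_no_base_point[OF w'] by (auto simp: pt_in_near_iff[OF w'] pt_in_same_side_iff[OF w])
    show "inj_on f (pt ` oval \<inter> (near w \<inter> same_side w))"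
    proof (rule inj_onI, clarify)
      fix w1 w2 assume 1: "w1 \<in> oval" "pt w1 \<in> near w" "pt w1 \<in> same_side w"
        and 2: "w2 \<in> oval" "pt w2 \<in> near w" "pt w2 \<in> same_side w"
        and eq: "f (pt w1) = f (pt w2)"
      have p1: "w1 \<in> real_pts" and p2: "w2 \<in> real_pts"
        using 1 2 by auto
      have acute: "0 < ell w1 * ell w2 + w1$2 * w2$2"
        using angle_lt_90(2)[of "ell w" "w1$2" "w$2" "ell w1" "w2$2" "ell w2"] 1 2
        by (simp add: pt_in_near_iff[OF p1] pt_in_near_iff[OF p2] pt_in_same_side_iff[OF 1(1)] pt_in_same_side_iff[OF 2(1)])
      then have "w1$2 * ell w2 + (- ell w1) * w2$2 = 0"
        using eq unfolding pt_projection_eq_iff[OF p1 p2] by auto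
      moreover have nz: "w1$2 \<noteq> 0 \<or> - ell w1 \<noteq> 0" using real_no_base_point[OF p1] by auto
      moreover obtain v1 v2 where v: "{w \<in> oval. w1$2 * ell w + (- ell w1) * w$2 = 0} = {v1, v2}"
        "ell v1 * ell v2 + v1$2 * v2$2 < 0"
        by (rule line_meets_oval[OF nz]) (rule that)
      ultimately have "w1 \<in> {v1, v2}" "w2 \<in> {v1, v2}"
        using 1(1) 2(1) unfolding v(1)[symmetric] by simp_all
      then have "w1 = w2" using acute v(2) by (auto simp: algebra_simps)
      then show "pt w1 = pt w2" by simp
    qed
  qed
qed simp

lemma pseudoline_covering:
  assumes "compact (pt ` pseudoline)"
  shows "covering_of_degree (pt ` pseudoline) f 2"
proof (rule covering_from_fibres[OF Un_upper2 assms _ pseudoline_fibre[simplified]])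
  fix w assume w: "w \<in> pseudoline"
  have w': "w \<in> real_pts" using w by simp
  have pos: "0 < ell w * ell w + w$2 * w$2"
    using real_no_base_point[OF w'] by (simp add: sum_squares_gt_zero_iff)
  show "\<exists>U. open U \<and> pt w \<in> U \<and> inj_on f (pt ` pseudoline \<inter> U)"
  proof (intro exI[of _ "near w"] conjI open_near)
    show "pt w \<in> near w" using real_no_base_point[OF w'] by (auto simp: pt_in_near_iff[OF w'])
    show "inj_on f (pt ` pseudoline \<inter> near w)"
    proof (rule inj_onI, clarify)
      fix w1 w2 assume 1: "w1 \<in> pseudoline" "pt w1 \<in> near w"
        and 2: "w2 \<in> pseudoline" "pt w2 \<in> near w"
        and eq: "f (pt w1) = f (pt w2)"
      have p1: "w1 \<in> real_pts" and p2: "w2 \<in> real_pts"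
        using 1 2 by auto
      have "ell w1 * ell w2 + w1$2 * w2$2 \<noteq> 0"
        using angle_lt_90(1)[of "ell w" "w1$2" "w$2" "ell w1" "w2$2" "ell w2"] 1 2
        by (simp add: pt_in_near_iff[OF p1] pt_in_near_iff[OF p2])
      then have "w1$2 * ell w2 + (- ell w1) * w2$2 = 0"
        using eq unfolding pt_projection_eq_iff[OF p1 p2] by auto
      moreover have nz: "w1$2 \<noteq> 0 \<or> - ell w1 \<noteq> 0" using real_no_base_point[OF p1] by auto
      moreover obtain v where v: "{w \<in> pseudoline. w1$2 * ell w + (- ell w1) * w$2 = 0} = {v}"
        by (rule line_meets_pseudoline[OF nz]) (rule that)
      ultimately have "w1 \<in> {v}" "w2 \<in> {v}"
        using 1(1) 2(1) unfolding v(1)[symmetric] by simp_all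
      then show "pt w1 = pt w2" by simp
    qed
  qed
qed simp

end

end

section \<open>The real components of the plane cubic\<close>

definition plane_pt :: "real^3^3 \<Rightarrow> real^3 \<Rightarrow> 3 cproj" where
  "plane_pt B w = abs_cproj (cmat B *v complex_vec w)"

lemma complex_vec_scale: "complex_vec (r *s w) = of_real r *s complex_vec w"
  by (simp add: vec_eq_iff)

lemma plane_pt_scale:
  assumes "B' ** B = mat 1" "w \<noteq> 0" "r \<noteq> 0"
  shows "plane_pt B (r *s w) = plane_pt B w"
proof -
  have "cmat B *v complex_vec w \<noteq> 0" using assms(2) by (simp add: cmat_eq_0_iff[OF assms(1)])
  then show ?thesis unfolding plane_pt_def complex_vec_scale cmat_scale
    by (rule abs_cproj_scale) (simp add: assms(3))
qed

lemma continuous_on_complex_vec [continuous_intros]: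
  "continuous_on S g \<Longrightarrow> continuous_on S (\<lambda>s. complex_vec (g s))"
  unfolding complex_vec_def by (intro continuous_intros)

lemma continuous_on_cmat [continuous_intros]:
  "continuous_on S g \<Longrightarrow> continuous_on S (\<lambda>s. cmat M *v g s)"
  unfolding matrix_vector_mult_def by (intro continuous_intros)

lemma continuous_on_plane_pt:
  assumes "B' ** B = mat 1" "continuous_on S g" "\<And>s. s \<in> S \<Longrightarrow> g s \<noteq> 0"
  shows "continuous_on S (\<lambda>s. plane_pt B (g s))"
  unfolding plane_pt_def using assms(3)
  by (intro continuous_on_compose_abs_cproj continuous_intros assms(2)) (simp add: cmat_eq_0_iff[OF assms(1)])

lemma real_locus:
  assumes B: "B' ** B = mat 1" "B ** B' = mat 1"
    and X: "X = {abs_cproj (cmat B *v c) |c. c \<noteq> 0 \<and> weierstrass A C 0 c = 0}"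
  shows "X \<inter> real_points = plane_pt B ` insert (vector [0, 1, 0])
    {vector [x, y, 1] |x y. y^2 = x * (x^2 + A * x + C)}" (is "_ = plane_pt B ` ?R")
proof
  show "X \<inter> real_points \<subseteq> plane_pt B ` ?R"
  proof
    fix p assume p: "p \<in> X \<inter> real_points"
    obtain c where c: "c \<noteq> 0" "weierstrass A C 0 c = 0" "p = abs_cproj (cmat B *v c)" using p X by auto
    obtain v :: "real^3" where v: "v \<noteq> 0" "p = abs_cproj (complex_vec v)" using p by (auto simp: real_points_eq)
    define w where "w = B' *v v"
    have Bw: "cmat B *v complex_vec w = complex_vec v"
      unfolding w_def cmat_complex_vec[symmetric] by (rule cmat_inverse[OF B(2)])
    have w0: "w \<noteq> 0" using cmat_eq_0_iff[OF B(1), of "complex_vec w"] Bw v(1) by auto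
    have pw: "p = plane_pt B w" by (simp add: plane_pt_def Bw v(2))
    obtain k where k: "k \<noteq> 0" "complex_vec v = k *s (cmat B *v c)"
      using abs_cproj_eq_iff[of "cmat B *v c" "complex_vec v"] c v cmat_eq_0_iff[OF B(1)] by auto
    have "complex_vec w = cmat B' *v (k *s (cmat B *v c))" unfolding k(2)[symmetric] w_def cmat_complex_vec ..
    also have "\<dots> = k *s c" unfolding cmat_scale cmat_inverse[OF B(1)] ..
    finally have "weierstrass A C 0 (complex_vec w) = k^3 * weierstrass A C 0 c"
      by (simp add: weierstrass_def power2_eq_square power3_eq_cube algebra_simps)
    then have "of_real ((w$2)^2 * w$3 - ((w$1)^3 + A * (w$1)^2 * w$3 + C * w$1 * (w$3)^2)) = (0::complex)"
      using c(2) by (simp add: weierstrass_def)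
    then have e: "(w$2)^2 * w$3 = (w$1)^3 + A * (w$1)^2 * w$3 + C * w$1 * (w$3)^2"
      by (simp only: of_real_eq_0_iff eq_iff_diff_eq_0[symmetric])
    show "p \<in> plane_pt B ` ?R"
    proof (cases "w$3 = 0")
      case True
      then have "w$1 = 0" using e by simp
      then have w: "w = (w$2) *s vector [0, 1, 0]" using True by (simp add: vec_eq_iff forall_3)
      then have "w$2 \<noteq> 0" using w0 by auto
      then have "p = plane_pt B (vector [0, 1, 0])"
        unfolding pw using plane_pt_scale[OF B(1), of "vector [0, 1, 0]" "w$2"] w
        by (metis vec3_eq_iff zero_neq_one vec_eq_iff vector_3(2) zero_index)
      then show ?thesis by blast
    next
      case False
      define x y where "x = w$1 / w$3" and "y = w$2 / w$3"
      have w12: "w$1 = w$3 * x" "w$2 = w$3 * y" using False by (simp_all add: x_def y_def)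
      have w: "w = (w$3) *s vector [x, y, 1]" using w12 by (simp add: vec_eq_iff forall_3)
      have "(w$3)^3 * y^2 = (w$3)^3 * (x * (x^2 + A * x + C))"
        using e unfolding w12 by (simp add: power2_eq_square power3_eq_cube algebra_simps)
      then have "y^2 = x * (x^2 + A * x + C)" using False by simp
      moreover have "p = plane_pt B (vector [x, y, 1])"
        unfolding pw using plane_pt_scale[OF B(1), of "vector [x, y, 1]" "w$3"] w False
        by (metis vec_eq_iff vector_3(3) zero_index zero_neq_one)
      ultimately show ?thesis by blast
    qed
  qed
  show "plane_pt B ` ?R \<subseteq> X \<inter> real_points"
  proof
    fix p assume "p \<in> plane_pt B ` ?R"
    then obtain w where w: "w \<in> ?R" "p = plane_pt B w" by blast
    have w0: "w \<noteq> 0" using w(1) by (auto simp: vec_eq_iff forall_3)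
    have "(w$2)^2 * w$3 - ((w$1)^3 + A * (w$1)^2 * w$3 + C * w$1 * (w$3)^2) = 0"
      using w(1) by (auto simp: power2_eq_square power3_eq_cube algebra_simps)
    then have "of_real ((w$2)^2 * w$3 - ((w$1)^3 + A * (w$1)^2 * w$3 + C * w$1 * (w$3)^2)) = (0::complex)"
      by (simp only: of_real_0)
    then have "weierstrass A C 0 (complex_vec w) = 0" by (simp add: weierstrass_def)
    then have "p \<in> X" unfolding X w(2) plane_pt_def using w0 complex_vec_eq_0_iff by blast
    moreover have "B *v w \<noteq> 0" using w0 cmat_eq_0_iff[OF B(1), of "complex_vec w"]
      by (simp add: cmat_complex_vec)
    then have "p \<in> real_points" unfolding real_points_eq w(2) plane_pt_def cmat_complex_vec by blast
    ultimately show "p \<in> X \<inter> real_points" by simp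
  qed
qed

text \<open>
  With \<open>x = u^2 / r^2\<close>, where \<open>u^2 + r^2 = 1\<close>, the whole branch from infinity to infinity is one arc.
\<close>

lemma unbounded_branch:
  assumes B: "B' ** B = mat 1" and pos: "\<And>x. 0 \<le> x \<Longrightarrow> 0 < x^2 + A * x + C"
  defines "R \<equiv> insert (vector [0, 1, 0]) {vector [x, y, 1] |x y. 0 \<le> x \<and> y^2 = x * (x^2 + A * x + C)}"
  shows "compact (plane_pt B ` R)" "connected (plane_pt B ` R)"
proof -
  define r where "r u = sqrt (1 - u^2)" for u :: real
  define Q where "Q u = u^4 + A * u^2 * (r u)^2 + C * (r u)^4" for u
  define g where "g u = (vector [u^2 * r u, u * sqrt (Q u), (r u)^3] :: real^3)" for u
  define x y where "x u = u^2 / (r u)^2" and "y u = u * sqrt (Q u) / (r u)^3" for u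
  have r2: "(r u)^2 = 1 - u^2" if "u \<in> {-1..1}" for u
    using that by (simp add: r_def abs_square_le_1 abs_le_iff)
  have inf: "g u = u *s vector [0, 1, 0]" "u \<noteq> 0" if "u \<in> {-1..1}" "r u = 0" for u
  proof -
    have u2: "u^2 = 1" using r2[OF that(1)] that(2) by simp
    then have "u^4 = 1" using power_mult[of u 2 2] by simp
    then show "g u = u *s vector [0, 1, 0]" by (simp add: g_def Q_def that(2) vec_eq_iff forall_3)
    show "u \<noteq> 0" using u2 by auto
  qed
  have fin: "g u = (r u)^3 *s vector [x u, y u, 1]" if "r u \<noteq> 0" for u
    using that by (simp add: g_def x_def y_def vec_eq_iff forall_3 power2_eq_square power3_eq_cube)
  have xy: "0 \<le> x u \<and> (y u)^2 = x u * ((x u)^2 + A * x u + C)" if "r u \<noteq> 0" for u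
  proof -
    have x: "0 \<le> x u" by (simp add: x_def)
    have Q: "Q u = (r u)^4 * ((x u)^2 + A * x u + C)"
      using that by (simp add: Q_def x_def field_simps power2_eq_square power4_eq_xxxx)
    then have "0 \<le> Q u" using pos[OF x] by simp
    then have "(y u)^2 = u^2 * Q u / (r u)^6"
      by (simp add: y_def power_divide power_mult_distrib flip: power_mult)
    also have "(r u)^6 = (r u)^2 * (r u)^4" by (simp flip: power_add)
    also have "u^2 * Q u / ((r u)^2 * (r u)^4) = u^2 / (r u)^2 * ((x u)^2 + A * x u + C)"
    proof -
      have "u^2 * (d * h) / (e * d) = u^2 / e * h" if "d \<noteq> 0" for d e h :: real using that by simp
      then show ?thesis unfolding Q using that by (metis power_not_zero)
    qed
    also have "u^2 / (r u)^2 = x u" by (simp add: x_def)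
    finally show ?thesis using x by simp
  qed
  have g0: "g u \<noteq> 0" if "u \<in> {-1..1}" for u
    using inf[OF that] fin[of u] by (cases "r u = 0") (auto simp: vec_eq_iff forall_3)
  have g_fin: "plane_pt B (g u) = plane_pt B (vector [x u, y u, 1])" if "r u \<noteq> 0" for u
    unfolding fin[OF that] using that by (intro plane_pt_scale[OF B]) (simp_all add: vec_eq_iff forall_3)
  have g_inf: "plane_pt B (g u) = plane_pt B (vector [0, 1, 0])" if "u \<in> {-1..1}" "r u = 0" for u
    unfolding inf(1)[OF that] using inf(2)[OF that]
    by (intro plane_pt_scale[OF B]) (simp_all add: vec_eq_iff forall_3)
  have eq: "plane_pt B ` R = (\<lambda>u. plane_pt B (g u)) ` {-1..1}"
  proof
    show "(\<lambda>u. plane_pt B (g u)) ` {-1..1} \<subseteq> plane_pt B ` R"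
    proof (rule image_subsetI)
      fix u :: real assume u: "u \<in> {-1..1}"
      show "plane_pt B (g u) \<in> plane_pt B ` R"
        using g_fin[of u] xy[of u] g_inf[OF u] unfolding R_def by (cases "r u = 0") blast+
    qed
    show "plane_pt B ` R \<subseteq> (\<lambda>u. plane_pt B (g u)) ` {-1..1}"
    proof (rule image_subsetI)
      fix w assume "w \<in> R"
      then consider "w = vector [0, 1, 0]" | s t where "w = vector [s, t, 1]" "0 \<le> s" "t^2 = s * (s^2 + A * s + C)"
        unfolding R_def by blast
      then show "plane_pt B w \<in> (\<lambda>u. plane_pt B (g u)) ` {-1..1}"
      proof cases
        case 1
        then show ?thesis using g_inf[of 1] by (intro image_eqI[of _ _ 1]) (simp_all add: r_def)
      next
        case 2
        define v where "v = sqrt (s / (1 + s))"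
        have v2: "v^2 = s / (1 + s)" using 2(2) by (simp add: v_def)
        also have "\<dots> < 1" using 2(2) by simp
        finally have "\<bar>v\<bar> < 1" by (simp add: abs_square_less_1)
        then have v: "v \<in> {-1..1}" "- v \<in> {-1..1}" by auto
        have rv: "(r v)^2 = 1 / (1 + s)" using r2[OF v(1)] v2 2(2) by (simp add: field_simps)
        have rm: "r (- v) = r v" by (simp add: r_def)
        have r0: "r v \<noteq> 0" using rv 2(2) by auto
        have xs: "x v = s" "x (- v) = s" using 2(2) by (simp_all add: x_def rm rv v2)
        have "y (- v) = - y v" by (simp add: y_def Q_def rm)
        moreover have "(y v)^2 = t^2" using xy[OF r0] 2(3) unfolding xs by simp
        ultimately have "t = y v \<or> t = y (- v)" by (auto simp: power2_eq_iff)
        then show ?thesis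
          using g_fin[OF r0] g_fin[of "- v"] r0 v xs unfolding 2(1) rm by (metis imageI)
      qed
    qed
  qed
  have c: "continuous_on {-1..1} (\<lambda>u. plane_pt B (g u))"
    by (intro continuous_on_plane_pt[OF B] g0) (unfold g_def Q_def r_def, intro continuous_intros)
  show "compact (plane_pt B ` R)" "connected (plane_pt B ` R)"
    unfolding eq by (intro compact_continuous_image connected_continuous_image c; simp)+
qed

definition oval_loop :: "real \<Rightarrow> real \<Rightarrow> real \<Rightarrow> real^3" where
  "oval_loop a b t = vector [a * (sin (pi * t))^2,
     a * sin (pi * t) * cos (pi * t) * sqrt (b - a * (sin (pi * t))^2), 1]"

lemma continuous_on_oval_loop: "continuous_on S (oval_loop a b)"
  unfolding oval_loop_def by (intro continuous_intros)

lemma oval_loop_closed: "oval_loop a b 0 = oval_loop a b 1"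
  by (simp add: oval_loop_def)

lemma oval_loop_image:
  assumes "0 < a" "a < b"
  shows "oval_loop a b ` {0..1} = oval_pts a b"
proof
  have s2: "(sin u)^2 \<le> 1" for u :: real by (simp add: abs_square_le_1)
  show "oval_loop a b ` {0..1} \<subseteq> oval_pts a b"
  proof (rule image_subsetI)
    fix t :: real
    let ?s = "sin (pi * t)" and ?c = "cos (pi * t)"
    let ?x = "a * ?s^2"
    have x: "0 \<le> ?x" "?x \<le> a" using assms s2[of "pi * t"] by (simp_all add: mult_left_le)
    have c: "?c^2 = 1 - ?s^2" by (simp add: cos_squared_eq)
    have "(a * ?s * ?c * sqrt (b - ?x))^2 = a^2 * ?s^2 * ?c^2 * (b - ?x)"
    proof -
      have "0 \<le> b - ?x" using x assms by linarith
      then show ?thesis by (simp only: power_mult_distrib real_sqrt_pow2)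
    qed
    also have "\<dots> = ?x * (?x - a) * (?x - b)" unfolding c by (simp add: power2_eq_square algebra_simps)
    finally show "oval_loop a b t \<in> oval_pts a b" using x unfolding oval_loop_def oval_pts_def by blast
  qed
  show "oval_pts a b \<subseteq> oval_loop a b ` {0..1}"
  proof
    fix w assume "w \<in> oval_pts a b"
    then obtain x y where w: "w = vector [x, y, 1]" "0 \<le> x" "x \<le> a" "y^2 = x * (x - a) * (x - b)"
      by (auto simp: oval_pts_def)
    define \<epsilon> :: real where "\<epsilon> = (if 0 \<le> y then 1 else -1)"
    have \<epsilon>: "\<epsilon>^2 = 1" "\<bar>\<epsilon>\<bar> = 1" by (auto simp: \<epsilon>_def)
    define c where "c = \<epsilon> * sqrt (1 - x / a)"
    have xa: "0 \<le> x / a" "x / a \<le> 1" using w assms by simp_all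
    have c2: "c^2 = 1 - x / a" using xa \<epsilon> by (simp add: c_def power_mult_distrib)
    have c: "-1 \<le> c" "c \<le> 1" using c2 xa abs_square_le_1[of c] by (auto simp: abs_le_iff)
    define t where "t = arccos c / pi"
    have t: "t \<in> {0..1}" using c arccos_bounded[of c] by (simp add: t_def)
    have pt: "pi * t = arccos c" by (simp add: t_def)
    have s: "sin (pi * t) = sqrt (x / a)" "cos (pi * t) = c"
      unfolding pt using c by (simp_all add: sin_arccos c2)
    have s2': "a * (sin (pi * t))^2 = x" using s(1) xa assms by simp
    have "\<bar>y\<bar> = sqrt (x * (x - a) * (x - b))" unfolding w(4)[symmetric] by simp
    also have "x * (x - a) * (x - b) = a^2 * (x / a) * (1 - x / a) * (b - x)"
      using assms by (simp add: field_simps power2_eq_square)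
    also have "sqrt \<dots> = a * sqrt (x / a) * sqrt (1 - x / a) * sqrt (b - x)"
      using assms by (simp only: real_sqrt_mult) simp
    finally have "y = \<epsilon> * (a * sqrt (x / a) * sqrt (1 - x / a) * sqrt (b - x))"
      by (auto simp: \<epsilon>_def abs_if split: if_splits)
    then have "y = a * sin (pi * t) * cos (pi * t) * sqrt (b - x)"
      unfolding s c_def by simp
    then have "w = oval_loop a b t" unfolding w(1) oval_loop_def s2' by simp
    then show "w \<in> oval_loop a b ` {0..1}" using t by blast
  qed
qed

lemma oval_component:
  assumes "B' ** B = mat 1" "0 < a" "a < b"
  shows "compact (plane_pt B ` oval_pts a b)" "connected (plane_pt B ` oval_pts a b)"
proof -
  have c: "continuous_on {0..1} (\<lambda>t. plane_pt B (oval_loop a b t))"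
    by (intro continuous_on_plane_pt[OF assms(1)] continuous_on_oval_loop)
      (simp add: oval_loop_def vec_eq_iff forall_3)
  have e: "plane_pt B ` oval_pts a b = (\<lambda>t. plane_pt B (oval_loop a b t)) ` {0..1}"
    unfolding oval_loop_image[OF assms(2,3), symmetric] image_image ..
  show "compact (plane_pt B ` oval_pts a b)" "connected (plane_pt B ` oval_pts a b)"
    unfolding e by (intro compact_continuous_image connected_continuous_image c; simp)+
qed

lemma pseudoline_component:
  assumes "B' ** B = mat 1" "0 < a" "a < b"
  shows "compact (plane_pt B ` pseudoline_pts a b)" "connected (plane_pt B ` pseudoline_pts a b)"
proof -
  let ?S = "shift_matrix b" and ?A = "2 * b - a" and ?C = "b * (b - a)"
  let ?R = "insert (vector [0, 1, 0]) {vector [x, y, 1] |x y. 0 \<le> x \<and> y^2 = x * (x^2 + ?A * x + ?C)} :: (real^3) set"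
  have inv: "(shift_matrix (- b) ** B') ** (B ** ?S) = mat 1"
    by (metis assms(1) shift_matrix_inverse' matrix_mul_assoc matrix_mul_lid)
  have pos: "0 < x^2 + ?A * x + ?C" if "0 \<le> x" for x
    using that assms by (intro add_nonneg_pos) simp_all
  have sh: "plane_pt (B ** ?S) (vector [x, y, z]) = plane_pt B (vector [x + b * z, y, z])" for x y z
  proof -
    have "cmat ?S *v complex_vec (vector [x, y, z]) = complex_vec (vector [x + b * z, y, z])"
      unfolding shift_matrix_vec by (simp add: vec_eq_iff forall_3)
    then show ?thesis by (simp add: plane_pt_def cmat_mult matrix_vector_mul_assoc[symmetric])
  qed
  have "plane_pt B ` pseudoline_pts a b = plane_pt (B ** ?S) ` ?R"
  proof
    show "plane_pt B ` pseudoline_pts a b \<subseteq> plane_pt (B ** ?S) ` ?R"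
    proof (rule image_subsetI)
      fix w assume "w \<in> pseudoline_pts a b"
      then consider "w = vector [0, 1, 0]" | x y where "w = vector [x, y, 1]" "b \<le> x" "y^2 = x * (x - a) * (x - b)"
        by (auto simp: pseudoline_pts_def)
      then show "plane_pt B w \<in> plane_pt (B ** ?S) ` ?R"
      proof cases
        case 1
        then have "plane_pt B w = plane_pt (B ** ?S) (vector [0, 1, 0])" by (simp add: sh)
        then show ?thesis by blast
      next
        case 2
        then have "plane_pt B w = plane_pt (B ** ?S) (vector [x - b, y, 1])" by (simp add: sh)
        moreover have "y^2 = (x - b) * ((x - b)^2 + ?A * (x - b) + ?C)"
          unfolding 2(3) by (simp add: power2_eq_square algebra_simps)
        moreover have "0 \<le> x - b" using 2(2) by simp
        ultimately show ?thesis by blast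
      qed
    qed
    show "plane_pt (B ** ?S) ` ?R \<subseteq> plane_pt B ` pseudoline_pts a b"
    proof (rule image_subsetI)
      fix w assume "w \<in> ?R"
      then consider "w = vector [0, 1, 0]" | x y where "w = vector [x, y, 1]" "0 \<le> x" "y^2 = x * (x^2 + ?A * x + ?C)"
        by auto
      then show "plane_pt (B ** ?S) w \<in> plane_pt B ` pseudoline_pts a b"
      proof cases
        case 1 then show ?thesis by (simp add: sh pseudoline_pts_def)
      next
        case 2
        have "y^2 = (x + b) * (x + b - a) * (x + b - b)"
          unfolding 2(3) by (simp add: power2_eq_square algebra_simps)
        moreover have "b \<le> x + b" using 2(2) by simp
        ultimately have "vector [x + b, y, 1] \<in> pseudoline_pts a b"
          unfolding pseudoline_pts_def by blast
        then show ?thesis unfolding 2(1) sh by simp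
      qed
    qed
  qed
  then show "compact (plane_pt B ` pseudoline_pts a b)" "connected (plane_pt B ` pseudoline_pts a b)"
    using unbounded_branch[OF inv pos] by simp_all
qed

lemma components_of_two:
  fixes S T :: "'a::t2_space set"
  assumes "compact S" "connected S" "S \<noteq> {}" "compact T" "connected T" "T \<noteq> {}" "S \<inter> T = {}"
  shows "components (S \<union> T) = {S, T}"
proof -
  have cl: "closed S" "closed T" using assms by (auto intro: compact_imp_closed)
  have dich: "d \<subseteq> S \<or> d \<subseteq> T" if "connected d" "d \<subseteq> S \<union> T" for d
    using connected_closedD[OF that(1) _ that(2) cl] assms(7) that(2) by blast
  have S: "S \<in> components (S \<union> T)" and T: "T \<in> components (S \<union> T)"
    unfolding in_components_maximal using assms dich by blast+
  have "C = S \<or> C = T" if "C \<in> components (S \<union> T)" for C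
  proof -
    have "C \<subseteq> S \<or> C \<subseteq> T" using dich in_components_connected[OF that] in_components_subset[OF that] by blast
    then have "C \<inter> S \<noteq> {} \<or> C \<inter> T \<noteq> {}" using in_components_nonempty[OF that] by blast
    then show ?thesis using components_nonoverlap[OF that S] components_nonoverlap[OF that T] by blast
  qed
  then show ?thesis using S T by blast
qed

section \<open>The Veronese surface under linear changes of coordinates\<close>

definition sym_square :: "real^3^3 \<Rightarrow> real^6^6" where
  "sym_square B = (let r = (\<lambda>i j. vector [B$i$1 * B$j$1, B$i$1 * B$j$2 + B$i$2 * B$j$1,
      B$i$1 * B$j$3 + B$i$3 * B$j$1, B$i$2 * B$j$2, B$i$2 * B$j$3 + B$i$3 * B$j$2, B$i$3 * B$j$3])
    in vector [r 1 1, r 1 2, r 1 3, r 2 2, r 2 3, r 3 3])"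

lemma sym_square_veronese: "cmat (sym_square B) *v veronese_vec c = veronese_vec (cmat B *v c)"
  by (simp add: sym_square_def Let_def vec_eq_iff forall_6 matrix_vector_mult_def sum_6 sum_3
      vector_6 veronese_vec_nth algebra_simps)

lemma veronese_fixed_imp_identity:
  assumes "\<And>c. cmat K *v veronese_vec c = veronese_vec c"
  shows "K = (mat 1 :: real^6^6)"
proof -
  have fix_diff: "cmat K *v (x - y - z) = x - y - z"
    if "cmat K *v x = x" "cmat K *v y = y" "cmat K *v z = z" for x y z
    by (simp only: matrix_vector_mult_diff_distrib that)
  have col1: "cmat K *v axis 1 1 = axis 1 1" and col4: "cmat K *v axis 4 1 = axis 4 1"
    and col6: "cmat K *v axis 6 1 = axis 6 1"
  proof -
    have a: "axis 1 1 = veronese_vec (vector [1,0,0])" "axis 4 1 = veronese_vec (vector [0,1,0])"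
      "axis 6 1 = veronese_vec (vector [0,0,1])"
      by (simp_all add: vec_eq_iff forall_6 veronese_vec_nth axis_def)
    show "cmat K *v axis 1 1 = axis 1 1" "cmat K *v axis 4 1 = axis 4 1" "cmat K *v axis 6 1 = axis 6 1"
      unfolding a by (rule assms)+
  qed
  have col2: "cmat K *v axis 2 1 = axis 2 1" and col3: "cmat K *v axis 3 1 = axis 3 1"
    and col5: "cmat K *v axis 5 1 = axis 5 1"
  proof -
    have a: "axis 2 1 = veronese_vec (vector [1,1,0]) - axis 1 1 - axis 4 1"
      "axis 3 1 = veronese_vec (vector [1,0,1]) - axis 1 1 - axis 6 1"
      "axis 5 1 = veronese_vec (vector [0,1,1]) - axis 4 1 - axis 6 1"
      by (simp_all add: vec_eq_iff forall_6 veronese_vec_nth axis_def)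
    show "cmat K *v axis 2 1 = axis 2 1" unfolding a(1) by (rule fix_diff[OF assms col1 col4])
    show "cmat K *v axis 3 1 = axis 3 1" unfolding a(2) by (rule fix_diff[OF assms col1 col6])
    show "cmat K *v axis 5 1 = axis 5 1" unfolding a(3) by (rule fix_diff[OF assms col4 col6])
  qed
  have col: "cmat K *v axis j 1 = axis j 1" for j
    using exhaust_6[of j] col1 col2 col3 col4 col5 col6 by (elim disjE) (simp_all only:)
  have "(cmat K *v axis j 1) $ i = of_real (K $ i $ j)" for i j
    by (simp add: matrix_vector_mult_def axis_def if_distrib cong: if_cong)
  then have "of_real (K $ i $ j) = (axis j 1 :: complex^6) $ i" for i j
    using col by metis
  then have "(of_real (K $ i $ j) :: complex) = of_real ((mat 1 :: real^6^6) $ i $ j)" for i j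
    by (simp add: axis_def mat_def)
  then show ?thesis unfolding vec_eq_iff of_real_eq_iff by blast
qed

lemma sym_square_inverse:
  assumes "B' ** B = mat 1"
  shows "sym_square B' ** sym_square B = mat 1"
proof (rule veronese_fixed_imp_identity)
  fix c
  show "cmat (sym_square B' ** sym_square B) *v veronese_vec c = veronese_vec c"
    unfolding cmat_mult matrix_vector_mul_assoc[symmetric] sym_square_veronese cmat_inverse[OF assms] ..
qed

lemma veronese_abs:
  assumes "x \<noteq> 0"
  shows "veronese (abs_cproj x) = abs_cproj (veronese_vec x)"
proof -
  obtain k where k: "k \<noteq> 0" "rep_cproj (abs_cproj x) = k *s x" using rep_abs_cproj[OF assms] .
  have "veronese_vec (k *s x) = k^2 *s veronese_vec x"
    by (simp add: vec_eq_iff forall_6 veronese_vec_nth power2_eq_square algebra_simps)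
  moreover have "veronese_vec x \<noteq> 0" using assms
    by (auto simp: vec_eq_iff forall_6 forall_3 veronese_vec_nth)
  ultimately show ?thesis unfolding veronese_def k(2)
    using abs_cproj_scale[of "veronese_vec x" "k^2"] k(1) by simp
qed

lemma continuous_on_veronese: "continuous_on UNIV veronese"
proof (rule continuous_on_open_vimage[OF open_UNIV, THEN iffD2], intro allI impI)
  fix U :: "6 cproj set" assume U: "open U"
  have v0: "veronese_vec x \<noteq> 0" if "x \<noteq> 0" for x using that
    by (auto simp: vec_eq_iff forall_6 forall_3 veronese_vec_nth)
  have "continuous_on (- {0}) (\<lambda>x. abs_cproj (veronese_vec x))"
    by (intro continuous_on_compose_abs_cproj continuous_intros v0) auto
  then have "open ((\<lambda>x. abs_cproj (veronese_vec x)) -` U \<inter> - {0})"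
    using U by (subst (asm) continuous_on_open_vimage) (simp_all add: open_Compl)
  moreover have "{x. x \<noteq> 0 \<and> abs_cproj x \<in> veronese -` U \<inter> UNIV} =
      (\<lambda>x. abs_cproj (veronese_vec x)) -` U \<inter> - {0}"
    using veronese_abs by auto
  ultimately show "open (veronese -` U \<inter> UNIV)" by (simp only: open_cproj_iff)
qed

section \<open>Translation by the two-torsion point on the oval\<close>

text \<open>
  Translation by the two-torsion point \<open>(0, 0)\<close> is \<open>(x, y) \<mapsto> (a b / x, - a b y / x^2)\<close>.
  Multiplying the quadratic monomials of the image by \<open>x\<^sup>3\<close> and reducing modulo the cubic gives
  a linear map on the Veronese coordinates; its square is multiplication by \<open>a\<^sup>3 b\<^sup>3\<close>.
\<close>

definition translation :: "real \<Rightarrow> real \<Rightarrow> real^6^6" where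
  "translation a b = vector
    [vector [0, 0, a^2 * b^2, 0, 0, 0],
     vector [0, 0, 0, 0, - (a^2 * b^2), 0],
     vector [a * b, 0, 0, 0, 0, 0],
     vector [a^2 * b^2, 0, - (a^2 * b^2 * (a + b)), 0, 0, a^3 * b^3],
     vector [0, - (a * b), 0, 0, 0, 0],
     vector [a + b, 0, - (a * b), 1, 0, 0]]"

lemma translation_square: "translation a b ** translation a b = (a^3 * b^3) *\<^sub>R mat 1"
  by (simp add: vec_eq_iff forall_6 translation_def matrix_matrix_mult_def sum_6 vector_6 mat_def
      power2_eq_square power3_eq_cube algebra_simps)

lemma translation_veronese:
  "cmat (translation a b) *v veronese_vec c = vector
    [of_real (a^2 * b^2) * (c$1 * c$3), - of_real (a^2 * b^2) * (c$2 * c$3), of_real (a * b) * (c$1)^2,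
     of_real (a^2 * b^2) * ((c$1)^2 - of_real (a + b) * (c$1 * c$3) + of_real (a * b) * (c$3)^2),
     - of_real (a * b) * (c$1 * c$2),
     (c$2)^2 + of_real (a + b) * (c$1)^2 - of_real (a * b) * (c$1 * c$3)]"
  by (simp add: vec_eq_iff forall_6 translation_def matrix_vector_mult_def sum_6 vector_6 veronese_vec_nth
      power2_eq_square power3_eq_cube algebra_simps)

lemma translation_twice:
  "cmat (translation a b) *v (cmat (translation a b) *v x) = of_real (a^3 * b^3) *s x"
proof -
  have "cmat (translation a b) *v (cmat (translation a b) *v x) = cmat ((a^3 * b^3) *\<^sub>R mat 1) *v x"
    by (simp only: matrix_vector_mul_assoc cmat_mult[symmetric] translation_square)
  also have "\<dots> = of_real (a^3 * b^3) *s x"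
    by (simp add: vec_eq_iff matrix_vector_mult_def mat_def if_distrib[of "\<lambda>z. z * _"] sum.delta
        if_distrib[of "\<lambda>z. _ * z"] if_distrib[of complex_of_real] cong: if_cong)
  finally show ?thesis .
qed

context two_component_cubic
begin

abbreviation translated :: "complex^3 \<Rightarrow> complex^6" where
  "translated c \<equiv> cmat (translation a b) *v veronese_vec c"

lemma a_pos: "0 < a" and b_pos: "0 < b" using x0 ab by auto

lemma translation_cubic:
  assumes c: "c \<noteq> 0" "cubic c = 0"
  obtains k d where "k \<noteq> 0" "d \<noteq> 0" "cubic d = 0"
    "translated c = k *s veronese_vec d"
proof (cases "c$1 = 0")
  case True
  then have z: "(c$2)^2 * c$3 = 0" using c(2) unfolding cubic_eq by simp
  show ?thesis
  proof (cases "c$3 = 0")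
    case c3: True
    then have "c$2 \<noteq> 0" using c(1) True by (auto simp: vec_eq_iff forall_3)
    moreover have "translated c = (c$2)^2 *s veronese_vec (vector [0, 0, 1])"
      unfolding translation_veronese using True c3
      by (simp add: vec_eq_iff forall_6 vector_6 veronese_vec_nth)
    moreover have "cubic (vector [0, 0, 1]) = 0" unfolding cubic_eq by simp
    ultimately show ?thesis using that[of "(c$2)^2" "vector [0, 0, 1]"]
      by (simp add: vec_eq_iff forall_3)
  next
    case c3: False
    then have "c$2 = 0" using z by simp
    then have "translated c = (of_real (a^3 * b^3) * (c$3)^2) *s veronese_vec (vector [0, 1, 0])"
      unfolding translation_veronese using True
      by (simp add: vec_eq_iff forall_6 vector_6 veronese_vec_nth power2_eq_square power3_eq_cube)
    moreover have "cubic (vector [0, 1, 0]) = 0" unfolding cubic_eq by simp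
    moreover have "of_real (a^3 * b^3) * (c$3)^2 \<noteq> 0" using c3 a_pos b_pos by simp
    ultimately show ?thesis using that[of "of_real (a^3 * b^3) * (c$3)^2" "vector [0, 1, 0]"]
      by (simp add: vec_eq_iff forall_3)
  qed
next
  case c1: False
  then have c3: "c$3 \<noteq> 0" using c(2) unfolding cubic_eq by auto
  define d where "d = (vector [of_real (a * b) * c$1 * c$3, - of_real (a * b) * c$2 * c$3, (c$1)^2] :: complex^3)"
  have e: "(c$2)^2 * c$3 = c$1 * (c$1 - of_real a * c$3) * (c$1 - of_real b * c$3)"
    using c(2) unfolding cubic_eq by simp
  have e': "(c$1 * c$3) * (of_real (a^2 * b^2) * ((c$1)^2 - of_real (a + b) * (c$1 * c$3) + of_real (a * b) * (c$3)^2))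
      = of_real (a^2 * b^2) * c$3 * ((c$2)^2 * c$3)"
    unfolding e by (simp add: power2_eq_square algebra_simps)
  have e'': "(c$1 * c$3) * ((c$2)^2 + of_real (a + b) * (c$1)^2 - of_real (a * b) * (c$1 * c$3))
      = (c$1)^4"
  proof -
    have "(c$1 * c$3) * ((c$2)^2 + of_real (a + b) * (c$1)^2 - of_real (a * b) * (c$1 * c$3))
      = c$1 * ((c$2)^2 * c$3) + c$1 * (of_real (a + b) * (c$1)^2 * c$3 - of_real (a * b) * c$1 * (c$3)^2)"
      by (simp add: power2_eq_square algebra_simps)
    also have "\<dots> = (c$1)^4" unfolding e by (simp add: power2_eq_square power4_eq_xxxx algebra_simps)
    finally show ?thesis .
  qed
  have "(c$1 * c$3) *s (translated c) = veronese_vec d"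
    unfolding translation_veronese vec_eq_iff forall_6 vector_smult_component vector_6 e' e'' veronese_vec_nth
    by (simp add: d_def power2_eq_square power4_eq_xxxx algebra_simps)
  then have "translated c = inverse (c$1 * c$3) *s veronese_vec d"
    using c1 c3 by (metis mult_eq_0_iff left_inverse vector_smult_assoc vector_smult_lid)
  moreover have "d \<noteq> 0" using c1 by (simp add: d_def vec_eq_iff forall_3)
  moreover have "cubic d = 0"
  proof -
    have "cubic d = of_real (a * b)^2 * (c$1)^2 * c$3 * ((c$2)^2 * c$3 - c$1 * (c$1 - of_real a * c$3) * (c$1 - of_real b * c$3))"
      unfolding cubic_eq d_def by (simp add: power2_eq_square algebra_simps)
    then show ?thesis unfolding e by simp
  qed
  moreover have "inverse (c$1 * c$3) \<noteq> 0" using c1 c3 by simp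
  ultimately show ?thesis using that by blast
qed

lemma translation_affine:
  assumes "x \<noteq> 0" "y^2 = x * (x - a) * (x - b)"
  shows "translated (complex_vec (vector [x, y, 1])) =
      of_real (x^3) *s veronese_vec (complex_vec (vector [a * b / x, - (a * b * y / x^2), 1]))"
    and "(- (a * b * y / x^2))^2 = a * b / x * (a * b / x - a) * (a * b / x - b)"
proof -
  have "(- (a * b * y / x^2))^2 = (a * b)^2 * y^2 / x^4"
    by (simp add: power_divide power_mult_distrib flip: power_mult)
  also have "\<dots> = a * b / x * (a * b / x - a) * (a * b / x - b)"
    unfolding assms(2) using assms(1) by (simp add: field_simps power2_eq_square power4_eq_xxxx)
  finally show *: "(- (a * b * y / x^2))^2 = a * b / x * (a * b / x - a) * (a * b / x - b)" .
  have y2: "a^2 * b^2 * (x^2 - (a + b) * x + a * b) = x^3 * (- (a * b * y / x^2))^2"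
    unfolding * using assms(1) by (simp add: field_simps power2_eq_square power3_eq_cube)
  have z2: "y^2 + (a + b) * x^2 - a * b * x = x^3"
    unfolding assms(2) by (simp add: power2_eq_square power3_eq_cube algebra_simps)
  let ?r = "vector [a^2 * b^2 * x, - (a^2 * b^2 * y), a * b * x^2, a^2 * b^2 * (x^2 - (a + b) * x + a * b),
     - (a * b * (x * y)), y^2 + (a + b) * x^2 - a * b * x] :: real^6"
  have "translated (complex_vec (vector [x, y, 1])) = complex_vec ?r"
    unfolding translation_veronese by (simp add: vec_eq_iff forall_6 vector_6)
  also have "\<dots> = of_real (x^3) *s veronese_vec (complex_vec (vector [a * b / x, - (a * b * y / x^2), 1]))"
  proof -
    have "?r = x^3 *s vector [(a * b / x)^2, a * b / x * (- (a * b * y / x^2)), a * b / x,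
        (- (a * b * y / x^2))^2, - (a * b * y / x^2), 1]"
      unfolding y2 z2 using assms(1)
      by (simp add: vec_eq_iff forall_6 vector_6 power2_eq_square power3_eq_cube field_simps)
    then show ?thesis
      by (simp add: complex_vec_scale) (simp add: vec_eq_iff forall_6 vector_6 veronese_vec_nth power2_eq_square)
  qed
  finally show "translated (complex_vec (vector [x, y, 1])) =
      of_real (x^3) *s veronese_vec (complex_vec (vector [a * b / x, - (a * b * y / x^2), 1]))" .
qed

lemma translation_oval:
  assumes "w \<in> oval"
  obtains k d where "k \<noteq> 0" "d \<in> pseudoline"
    "translated (complex_vec w) = k *s veronese_vec (complex_vec d)"
proof -
  obtain x y where w: "w = vector [x, y, 1]" "0 \<le> x" "x \<le> a" "y^2 = x * (x - a) * (x - b)"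
    using assms by (auto simp: oval_pts_def)
  show thesis
  proof (cases "x = 0")
    case True
    then have eq: "translated (complex_vec w)
        = of_real (a^3 * b^3) *s veronese_vec (complex_vec (vector [0, 1, 0]))"
      unfolding translation_veronese using w(1,4)
      by (simp add: vec_eq_iff forall_6 vector_6 veronese_vec_nth power2_eq_square power3_eq_cube)
    have "(of_real (a^3 * b^3) :: complex) \<noteq> 0" using a_pos b_pos by simp
    moreover have "vector [0, 1, 0] \<in> pseudoline" by (simp add: pseudoline_pts_def)
    ultimately show ?thesis using eq by (rule that)
  next
    case False
    have "b \<le> a * b / x" using False w b_pos by (simp add: pos_le_divide_eq mult_right_mono mult.commute)
    then have "vector [a * b / x, - (a * b * y / x^2), 1] \<in> pseudoline"
      unfolding pseudoline_pts_def using translation_affine(2)[OF False w(4)] by blast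
    moreover have "(of_real (x^3) :: complex) \<noteq> 0" using False by simp
    ultimately show ?thesis using translation_affine(1)[OF False w(4)] that unfolding w(1) by blast
  qed
qed

lemma translation_pseudoline:
  assumes "w \<in> pseudoline"
  obtains k d where "k \<noteq> 0" "d \<in> oval"
    "translated (complex_vec w) = k *s veronese_vec (complex_vec d)"
proof (cases "w = vector [0, 1, 0]")
  case True
  then have "translated (complex_vec w) = 1 *s veronese_vec (complex_vec (vector [0, 0, 1]))"
    unfolding translation_veronese by (simp add: vec_eq_iff forall_6 vector_6 veronese_vec_nth)
  moreover have "vector [0, 0, 1] \<in> oval" unfolding oval_pts_def
    using a_pos by (intro CollectI exI[of _ 0] conjI refl) auto
  ultimately show ?thesis using that[OF one_neq_zero] by blast
next
  case False
  then obtain x y where w: "w = vector [x, y, 1]" "b \<le> x" "y^2 = x * (x - a) * (x - b)"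
    using assms by (auto simp: pseudoline_pts_def)
  have x: "x \<noteq> 0" "0 < x" using w(2) b_pos by auto
  have "0 \<le> a * b / x" "a * b / x \<le> a" using x w(2) a_pos b_pos
    by (simp_all add: pos_divide_le_eq mult_left_mono)
  then have "vector [a * b / x, - (a * b * y / x^2), 1] \<in> oval"
    unfolding oval_pts_def using translation_affine(2)[OF x(1) w(3)] by blast
  moreover have "(of_real (x^3) :: complex) \<noteq> 0" using x by simp
  ultimately show ?thesis using translation_affine(1)[OF x(1) w(3)] that unfolding w(1) by blast
qed

end

section \<open>The two pencils of conics\<close>

definition translation_inverse :: "real \<Rightarrow> real \<Rightarrow> real^6^6" where
  "translation_inverse a b = (1 / (a^3 * b^3)) *\<^sub>R translation a b"

lemma translation_inverse:
  assumes "a \<noteq> 0" "b \<noteq> 0"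
  shows "translation_inverse a b ** translation a b = mat 1" "translation a b ** translation_inverse a b = mat 1"
  using assms by (simp_all add: translation_inverse_def scalar_matrix_assoc[symmetric] matrix_scalar_ac translation_square)

locale plane_cubic = two_component_cubic +
  fixes B B' :: "real^3^3" and X :: "3 cproj set"
  assumes BB: "B' ** B = mat 1" "B ** B' = mat 1"
    and X: "X = {abs_cproj (cmat B *v c) |c. c \<noteq> 0 \<and> cubic c = 0}"
begin

sublocale P: veronese_pencil a b x0 "sym_square B" "sym_square B'"
  by unfold_locales (rule sym_square_inverse BB)+

sublocale Q: veronese_pencil a b x0 "sym_square B ** translation a b" "translation_inverse a b ** sym_square B'"
proof unfold_locales
  have ab0: "a \<noteq> 0" "b \<noteq> 0" using a_pos b_pos by auto
  show "translation_inverse a b ** sym_square B' ** (sym_square B ** translation a b) = mat 1"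
    by (metis translation_inverse(1)[OF ab0] P.MN(1) matrix_mul_assoc matrix_mul_lid)
  show "sym_square B ** translation a b ** (translation_inverse a b ** sym_square B') = mat 1"
    by (metis translation_inverse(2)[OF ab0] P.MN(2) matrix_mul_assoc matrix_mul_lid)
qed

lemma P_V: "P.V c = veronese_vec (cmat B *v c)"
  unfolding P.V_def sym_square_veronese ..

lemma veronese_cmat: "c \<noteq> 0 \<Longrightarrow> veronese (abs_cproj (cmat B *v c)) = abs_cproj (P.V c)"
  unfolding P_V by (rule veronese_abs) (simp add: cmat_eq_0_iff[OF BB(1)])

lemma veronese_X: "veronese ` X = P.Y"
proof
  show "veronese ` X \<subseteq> P.Y" unfolding X P.Y_def using veronese_cmat by blast
  show "P.Y \<subseteq> veronese ` X"
  proof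
    fix p assume "p \<in> P.Y"
    then obtain c where c: "c \<noteq> 0" "cubic c = 0" "p = abs_cproj (P.V c)" unfolding P.Y_def by blast
    then have "p = veronese (abs_cproj (cmat B *v c))" by (simp add: veronese_cmat)
    then show "p \<in> veronese ` X" unfolding X using c by blast
  qed
qed

lemma veronese_plane_pt:
  assumes "S \<subseteq> real_pts"
  shows "veronese ` plane_pt B ` S = P.pt ` S"
  unfolding image_image
proof (rule image_cong[OF refl])
  fix w assume "w \<in> S"
  then have "complex_vec w \<noteq> 0" using assms curve_pts(1) by blast
  then show "veronese (plane_pt B w) = P.pt w" unfolding plane_pt_def P.pt_def by (rule veronese_cmat)
qed

lemma Q_V:
  assumes "translated c = k *s veronese_vec d"
  shows "Q.V c = k *s P.V d" "P.V c = (k / of_real (a^3 * b^3)) *s Q.V d"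
proof -
  have Q: "Q.V c = cmat (sym_square B) *v (translated c)" for c
    unfolding Q.V_def cmat_mult matrix_vector_mul_assoc ..
  show "Q.V c = k *s P.V d" unfolding Q assms cmat_scale P.V_def ..
  have "of_real (a^3 * b^3) *s veronese_vec c = k *s (translated d)"
    unfolding translation_twice[symmetric] assms cmat_scale ..
  then have "of_real (a^3 * b^3) *s P.V c = k *s Q.V d"
    unfolding Q P.V_def cmat_scale[symmetric] by simp
  moreover have "(of_real (a^3 * b^3) :: complex) \<noteq> 0" using a_pos b_pos by simp
  ultimately show "P.V c = (k / of_real (a^3 * b^3)) *s Q.V d"
    by (simp add: vec_eq_iff field_simps)
qed

lemma Q_abs:
  assumes "translated c = k *s veronese_vec d" "k \<noteq> 0" "d \<noteq> 0"
  shows "abs_cproj (Q.V c) = abs_cproj (P.V d)" "abs_cproj (P.V c) = abs_cproj (Q.V d)"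
proof -
  have "P.V d \<noteq> 0" "Q.V d \<noteq> 0" using assms(3) P.V_eq_0_iff Q.V_eq_0_iff by auto
  moreover have "k / of_real (a^3 * b^3) \<noteq> 0" using assms(2) a_pos b_pos by simp
  ultimately show "abs_cproj (Q.V c) = abs_cproj (P.V d)" "abs_cproj (P.V c) = abs_cproj (Q.V d)"
    unfolding Q_V[OF assms(1)] using assms(2) by (simp_all only: abs_cproj_scale not_False_eq_True)
qed

lemma Q_Y: "Q.Y = P.Y"
proof -
  have "\<exists>d. d \<noteq> 0 \<and> cubic d = 0 \<and> abs_cproj (Q.V c) = abs_cproj (P.V d) \<and> abs_cproj (P.V c) = abs_cproj (Q.V d)"
    if c: "c \<noteq> 0" "cubic c = 0" for c
  proof -
    obtain k d where "k \<noteq> 0" "d \<noteq> 0" "cubic d = 0"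
      "translated c = k *s veronese_vec d"
      by (rule translation_cubic[OF c]) (rule that)
    then show ?thesis using Q_abs by blast
  qed
  then show ?thesis unfolding P.Y_def Q.Y_def by blast
qed

lemma Q_pt: "Q.pt ` oval = P.pt ` pseudoline" "Q.pt ` pseudoline = P.pt ` oval"
proof -
  have o: "\<exists>d\<in>pseudoline. Q.pt w = P.pt d \<and> P.pt w = Q.pt d" if w: "w \<in> oval" for w
  proof -
    obtain k d where d: "k \<noteq> 0" "d \<in> pseudoline"
      "translated (complex_vec w) = k *s veronese_vec (complex_vec d)"
      by (rule translation_oval[OF w]) (rule that)
    have "complex_vec d \<noteq> 0" using curve_pts(1) d(2) by blast
    then show ?thesis unfolding P.pt_def Q.pt_def using Q_abs[OF d(3,1)] d(2) by blast
  qed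
  have p: "\<exists>d\<in>oval. Q.pt w = P.pt d \<and> P.pt w = Q.pt d" if w: "w \<in> pseudoline" for w
  proof -
    obtain k d where d: "k \<noteq> 0" "d \<in> oval"
      "translated (complex_vec w) = k *s veronese_vec (complex_vec d)"
      by (rule translation_pseudoline[OF w]) (rule that)
    have "complex_vec d \<noteq> 0" using curve_pts(1) d(2) by blast
    then show ?thesis unfolding P.pt_def Q.pt_def using Q_abs[OF d(3,1)] d(2) by blast
  qed
  show "Q.pt ` oval = P.pt ` pseudoline"
    using o p by (intro equalityI image_subsetI) (metis imageI)+
  show "Q.pt ` pseudoline = P.pt ` oval"
    using o p by (intro equalityI image_subsetI) (metis imageI)+
qed

lemma compact_images: "compact (P.pt ` oval)" "compact (P.pt ` pseudoline)"
proof -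
  have c: "compact (veronese ` K)" if "compact K" for K
    using that by (rule compact_continuous_image[OF continuous_on_subset[OF continuous_on_veronese subset_UNIV]])
  show "compact (P.pt ` oval)" "compact (P.pt ` pseudoline)"
    using c oval_component(1)[OF BB(1) a_pos ab] pseudoline_component(1)[OF BB(1) a_pos ab]
    by (metis veronese_plane_pt Un_upper1 Un_upper2)+
qed

lemma components_X: "components (X \<inter> real_points) = {plane_pt B ` oval, plane_pt B ` pseudoline}"
proof -
  have R: "insert (vector [0, 1, 0]) {vector [x, y, 1] |x y. y^2 = x * (x^2 + (- (a + b)) * x + a * b)}
      = real_pts" (is "?R = _")
  proof -
    have eq: "x * (x^2 + (- (a + b)) * x + a * b) = x * (x - a) * (x - b)" for x
      by (simp add: power2_eq_square algebra_simps)
    have range: "(0 \<le> x \<and> x \<le> a) \<or> b \<le> x" if "y^2 = x * (x - a) * (x - b)" for x y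
    proof (rule ccontr)
      assume n: "\<not> ?thesis"
      have "x * (x - a) * (x - b) < 0"
      proof (cases "x < 0")
        case True
        then have "0 < (x - a) * (x - b)" using a_pos ab by (intro mult_neg_neg) auto
        then show ?thesis using True by (simp add: mult.assoc mult_neg_pos)
      next
        case False
        then have "0 < x * (x - a)" "x - b < 0" using n a_pos by auto
        then show ?thesis by (rule mult_pos_neg)
      qed
      then show False using that by (metis not_less zero_le_power2)
    qed
    show ?thesis unfolding eq oval_pts_def pseudoline_pts_def using range by blast
  qed
  have real: "X \<inter> real_points = plane_pt B ` oval \<union> plane_pt B ` pseudoline"
    unfolding real_locus[OF BB X] R by (rule image_Un)
  have "vector [0, 0, 1] \<in> oval" unfolding oval_pts_def
    using a_pos by (intro CollectI exI[of _ 0] conjI refl) auto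
  moreover have "plane_pt B ` oval \<inter> plane_pt B ` pseudoline = {}"
  proof (rule ccontr)
    assume "\<not> ?thesis"
    then have "veronese ` plane_pt B ` oval \<inter> veronese ` plane_pt B ` pseudoline \<noteq> {}" by blast
    then have "P.pt ` oval \<inter> P.pt ` pseudoline \<noteq> {}"
      unfolding veronese_plane_pt[OF Un_upper1] veronese_plane_pt[OF Un_upper2] .
    then show False
      using inj_on_image_Int[OF P.inj_on_pt Un_upper1 Un_upper2] P.oval_pseudoline_disjoint by simp
  qed
  ultimately show ?thesis unfolding real
    using oval_component[OF BB(1) a_pos ab] pseudoline_component[OF BB(1) a_pos ab]
    by (intro components_of_two) (auto simp: pseudoline_pts_def)
qed

definition \<gamma> :: "real \<Rightarrow> real^6" where
  "\<gamma> t = (\<chi> i. Re (P.V (complex_vec (oval_loop a b t)) $ i))"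

lemma complex_vec_\<gamma>: "complex_vec (\<gamma> t) = P.V (complex_vec (oval_loop a b t))"
  using P.V_complex_vec_real by (simp add: \<gamma>_def vec_eq_iff complex_eq_iff complex_is_Real_iff)

lemma continuous_on_\<gamma>: "continuous_on {0..1} \<gamma>"
  unfolding \<gamma>_def P.V_def by (intro continuous_intros continuous_on_oval_loop)

lemma \<gamma>_closed: "\<gamma> 0 = \<gamma> 1"
  by (simp add: \<gamma>_def oval_loop_closed)

lemma oval_loop_in: "t \<in> {0..1} \<Longrightarrow> oval_loop a b t \<in> oval"
  using oval_loop_image[OF a_pos ab] by blast

lemma \<gamma>_avoids:
  assumes "hyperbolic_wrt P.Y L" "t \<in> {0..1}"
  shows "\<gamma> t \<notin> L"
proof
  assume "\<gamma> t \<in> L"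
  moreover have "0 \<in> L" using assms(1) subspace_0 unfolding hyperbolic_wrt_def codim2_subspaces_def by blast
  moreover have c: "complex_vec (oval_loop a b t) \<noteq> 0" "cubic (complex_vec (oval_loop a b t)) = 0"
    using oval_loop_in[OF assms(2)] curve_pts by blast+
  moreover have "complex_vec (\<gamma> t) \<noteq> 0" unfolding complex_vec_\<gamma> using c(1) P.V_eq_0_iff by blast
  moreover have "(\<chi> i. Re (complex_vec (\<gamma> t) $ i)) = \<gamma> t" "(\<chi> i. Im (complex_vec (\<gamma> t) $ i)) = 0"
    by (simp_all add: vec_eq_iff)
  ultimately have "abs_cproj (complex_vec (\<gamma> t)) \<in> complex_points L"
    unfolding complex_points_def by force
  moreover have "abs_cproj (complex_vec (\<gamma> t)) \<in> P.Y" unfolding complex_vec_\<gamma> P.Y_def using c by blast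
  ultimately show False using assms(1) unfolding hyperbolic_wrt_def by blast
qed

lemma pair_loop_P:
  "pair_loop \<gamma> (qA v* sym_square B') (qB v* sym_square B') t =
    (Complex (ell (oval_loop a b t)) (oval_loop a b t $ 2))^2"
proof -
  have "of_real ((d v* sym_square B') \<bullet> \<gamma> t) = linear_form d (veronese_vec (complex_vec (oval_loop a b t)))" for d
    unfolding linear_form_complex_vec[symmetric] complex_vec_\<gamma> P.linear_form_V ..
  then have "of_real ((qA v* sym_square B') \<bullet> \<gamma> t) =
      (of_real ((ell (oval_loop a b t))^2 - (oval_loop a b t $ 2)^2) :: complex)"
    "of_real ((qB v* sym_square B') \<bullet> \<gamma> t) = (of_real (2 * ell (oval_loop a b t) * (oval_loop a b t $ 2)) :: complex)"
    unfolding qA qB by (simp_all only: qA qB ell_complex_vec complex_vec_nth of_real_diff of_real_mult of_real_power of_real_numeral)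
  then show ?thesis unfolding pair_loop_def of_real_eq_iff
    by (simp add: complex_eq_iff power2_eq_square)
qed

lemma monodromy_P: "sqrt_monodromy 1 (pair_loop \<gamma> (qA v* sym_square B') (qB v* sym_square B'))"
  unfolding sqrt_monodromy_def pair_loop_P
proof (intro exI[of _ "\<lambda>t. Complex (ell (oval_loop a b t)) (oval_loop a b t $ 2)"] conjI ballI refl)
  show "continuous_on {0..1} (\<lambda>t. Complex (ell (oval_loop a b t)) (oval_loop a b t $ 2))"
    unfolding ell_def by (intro continuous_on_Complex continuous_intros continuous_on_oval_loop)
qed (simp add: oval_loop_closed)

abbreviation N2 :: "real^6^6" where "N2 \<equiv> translation_inverse a b ** sym_square B'"

definition half_turn :: "real \<Rightarrow> complex" where
  "half_turn t = of_real (sqrt a / sqrt (a^3 * b^3)) *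
     Complex (sin (pi * t) * (a * b - x0 * (a * (sin (pi * t))^2)))
       (- (a * b * cos (pi * t) * sqrt (b - a * (sin (pi * t))^2)))"

lemma linear_form_Q:
  "of_real ((d v* N2) \<bullet> \<gamma> t) = of_real (1 / (a^3 * b^3)) *
     linear_form d (translated (complex_vec (oval_loop a b t)))"
proof -
  have "of_real ((d v* N2) \<bullet> \<gamma> t) =
      linear_form ((d v* translation_inverse a b) v* sym_square B') (P.V (complex_vec (oval_loop a b t)))"
    unfolding linear_form_complex_vec[symmetric] complex_vec_\<gamma> vector_matrix_mul_assoc ..
  also have "\<dots> = linear_form d (cmat (translation_inverse a b) *v veronese_vec (complex_vec (oval_loop a b t)))"
    unfolding P.linear_form_V linear_form_cmat ..
  also have "cmat (translation_inverse a b) *v veronese_vec (complex_vec (oval_loop a b t)) =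
      of_real (1 / (a^3 * b^3)) *s (translated (complex_vec (oval_loop a b t)))"
    by (simp add: vec_eq_iff matrix_vector_mult_def translation_inverse_def sum_distrib_left mult.assoc)
  finally show ?thesis unfolding linear_form_scale .
qed

lemma pair_loop_Q:
  assumes t: "t \<in> {0..1}"
  shows "pair_loop \<gamma> (qA v* N2) (qB v* N2) t
    = (half_turn t)^2"
proof -
  let ?s = "sin (pi * t)" and ?c = "cos (pi * t)"
  define x y z where "x = a * ?s^2" and "y = a * ?s * ?c * sqrt (b - a * ?s^2)" and "z = sqrt (b - a * ?s^2)"
  have loop: "oval_loop a b t = vector [x, y, 1]" by (simp add: oval_loop_def x_def y_def)
  have xa: "x \<le> a" "y^2 = x * (x - a) * (x - b)"
    using oval_loop_in[OF t] unfolding loop by (auto simp: oval_pts_def vec3_eq_iff)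
  have zx: "z = sqrt (b - x)" by (simp add: z_def x_def)
  have z2: "z^2 = b - x" using xa(1) ab by (simp add: z_def x_def)
  have c2: "a * ?c^2 = a - x" by (simp add: x_def cos_squared_eq algebra_simps)
  have y: "y = a * ?s * ?c * z" by (simp add: y_def z_def)
  let ?T = "translated (complex_vec (oval_loop a b t))"
  have T: "linear_form (vector [d1, d2, d3, d4, d5, d6]) ?T =
      of_real (d1 * (a^2 * b^2 * x) + d2 * (- (a^2 * b^2 * y)) + d3 * (a * b * x^2)
        + d4 * (a^2 * b^2 * (x^2 - (a + b) * x + a * b)) + d5 * (- (a * b * (x * y)))
        + d6 * (y^2 + (a + b) * x^2 - a * b * x))" for d1 d2 d3 d4 d5 d6
    unfolding translation_veronese loop by (simp add: linear_form_def sum_6 vector_6)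
  have A: "linear_form qA ?T = of_real (x * (a * b - x0 * x)^2 - a^2 * b^2 * ((a - x) * (b - x)))"
    unfolding T xa(2) by (rule arg_cong[of _ _ of_real]) (simp add: power2_eq_square algebra_simps)
  have B: "linear_form qB ?T = of_real (- 2 * (a * b) * y * (a * b - x0 * x))"
    unfolding T by (rule arg_cong[of _ _ of_real]) (simp add: power2_eq_square algebra_simps)
  have "(sqrt a / sqrt (a^3 * b^3))^2 = a / (a^3 * b^3)"
    using a_pos b_pos by (simp add: power_divide)
  then have k: "(of_real (sqrt a / sqrt (a^3 * b^3)))^2 = (of_real (a / (a^3 * b^3)) :: complex)"
    by (metis of_real_power)
  have "(Complex (?s * (a * b - x0 * x)) (- (a * b * ?c * z)))^2 =
      Complex (?s^2 * (a * b - x0 * x)^2 - (a * b)^2 * ?c^2 * z^2) (- 2 * (a * b) * (?s * ?c * z) * (a * b - x0 * x))"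
    by (simp add: complex_eq_iff power2_eq_square)
  then have "(half_turn t)^2 = of_real (1 / (a^3 * b^3)) * (of_real a *
      Complex (?s^2 * (a * b - x0 * x)^2 - (a * b)^2 * ?c^2 * z^2) (- 2 * (a * b) * (?s * ?c * z) * (a * b - x0 * x)))"
    unfolding half_turn_def power_mult_distrib k x_def[symmetric] zx[symmetric] by simp
  also have "of_real a * Complex (?s^2 * (a * b - x0 * x)^2 - (a * b)^2 * ?c^2 * z^2) (- 2 * (a * b) * (?s * ?c * z) * (a * b - x0 * x))
      = Complex (x * (a * b - x0 * x)^2 - a^2 * b^2 * ((a - x) * (b - x))) (- 2 * (a * b) * y * (a * b - x0 * x))"
  proof -
    have "a * (?s^2 * (a * b - x0 * x)^2 - (a * b)^2 * ?c^2 * z^2) =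
        (a * ?s^2) * (a * b - x0 * x)^2 - a^2 * b^2 * ((a * ?c^2) * z^2)"
      by (simp add: power_mult_distrib algebra_simps)
    also have "\<dots> = x * (a * b - x0 * x)^2 - a^2 * b^2 * ((a - x) * (b - x))"
      unfolding c2 z2 x_def[symmetric] ..
    finally show ?thesis unfolding y by (simp add: complex_eq_iff)
  qed
  also have "of_real (1 / (a^3 * b^3)) * \<dots> =
      pair_loop \<gamma> (qA v* N2) (qB v* N2) t"
  proof -
    have "of_real ((qA v* N2) \<bullet> \<gamma> t) =
        (of_real (1 / (a^3 * b^3) * (x * (a * b - x0 * x)^2 - a^2 * b^2 * ((a - x) * (b - x)))) :: complex)"
      "of_real ((qB v* N2) \<bullet> \<gamma> t) =
        (of_real (1 / (a^3 * b^3) * (- 2 * (a * b) * y * (a * b - x0 * x))) :: complex)"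
      unfolding linear_form_Q A B by (simp_all only: of_real_mult)
    then show ?thesis unfolding of_real_eq_iff pair_loop_def by (simp add: complex_eq_iff)
  qed
  finally show ?thesis by (rule sym)
qed

lemma monodromy_Q:
  "sqrt_monodromy (-1) (pair_loop \<gamma> (qA v* N2) (qB v* N2))"
  unfolding sqrt_monodromy_def
proof (intro exI[of _ half_turn] conjI ballI pair_loop_Q)
  show "continuous_on {0..1} half_turn"
    unfolding half_turn_def by (intro continuous_on_Complex continuous_intros)
qed (simp_all add: half_turn_def complex_eq_iff)

lemma P_L: "hyperbolic_wrt (veronese ` X) P.L"
  unfolding veronese_X by (rule P.L_hyperbolic)

lemma Q_L: "hyperbolic_wrt (veronese ` X) Q.L"
  unfolding veronese_X using Q.L_hyperbolic unfolding Q_Y .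

lemma not_connectedin:
  assumes "connectedin (subtopology grassmannian (hyperbolicity_locus (veronese ` X))) C" "P.L \<in> C" "Q.L \<in> C"
  shows False
proof (rule disconnected_by_loop_type[OF continuous_on_\<gamma> \<gamma>_closed _ _ _ monodromy_P _ monodromy_Q assms(1)])
  show "hyperbolicity_locus (veronese ` X) \<subseteq> codim2_subspaces"
    by (auto simp: hyperbolicity_locus_def hyperbolic_wrt_def)
  show "\<gamma> t \<notin> L" if "L \<in> hyperbolicity_locus (veronese ` X)" "t \<in> {0..1}" for L t
    using that \<gamma>_avoids unfolding veronese_X hyperbolicity_locus_def by blast
qed (use P_L Q_L assms(2,3) in \<open>simp_all add: hyperbolicity_locus_def P.L_def Q.L_def\<close>)

lemma not_connected_locus:
  "\<not> connected_space (subtopology grassmannian (hyperbolicity_locus (veronese ` X)))"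
proof
  let ?G = "subtopology grassmannian (hyperbolicity_locus (veronese ` X))"
  assume "connected_space ?G"
  then have "connectedin ?G (topspace ?G)" by (simp only: connectedin_topspace)
  moreover have "P.L \<in> topspace ?G" "Q.L \<in> topspace ?G"
    using P_L Q_L P.L_codim2 Q.L_codim2
    by (simp_all add: topspace_subtopology topspace_grassmannian hyperbolicity_locus_def)
  ultimately show False by (rule not_connectedin)
qed

lemma degree_partition_P:
  assumes "f \<in> projections_from P.L"
  shows "covering_of_degree (veronese ` plane_pt B ` oval) f 4"
    "covering_of_degree (veronese ` plane_pt B ` pseudoline) f 2"
  unfolding veronese_plane_pt[OF Un_upper1] veronese_plane_pt[OF Un_upper2]
  using P.oval_covering[OF assms] P.pseudoline_covering[OF assms] compact_images by blast+

lemma degree_partition_Q: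
  assumes "f \<in> projections_from Q.L"
  shows "covering_of_degree (veronese ` plane_pt B ` oval) f 2"
    "covering_of_degree (veronese ` plane_pt B ` pseudoline) f 4"
  unfolding veronese_plane_pt[OF Un_upper1] veronese_plane_pt[OF Un_upper2]
  using Q.oval_covering[OF assms] Q.pseudoline_covering[OF assms] compact_images unfolding Q_pt by blast+

end

theorem mainTheorem4:
  fixes X X1 X2 :: "3 cproj set" and X' :: "6 cproj set"
  assumes "smooth_plane_curve 3 X"
    and "components (X \<inter> real_points) = {X1, X2}"
    and "X1 \<noteq> X2"
    and "X' = veronese ` X"
  shows "(\<exists>L1 \<in> linear_subspaces 3. \<exists>L2 \<in> linear_subspaces 3.
            hyperbolic_wrt X' L1 \<and> hyperbolic_wrt X' L2 \<and>
            (\<forall>f \<in> projections_from L1. degree_partition [veronese ` X1, veronese ` X2] f [4, 2]) \<and>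
            (\<forall>f \<in> projections_from L2. degree_partition [veronese ` X1, veronese ` X2] f [2, 4]) \<and>
            \<not> (\<exists>C \<in> connected_components_of
                    (subtopology grassmannian (hyperbolicity_locus X')). L1 \<in> C \<and> L2 \<in> C)) \<and>
         \<not> connected_space (subtopology grassmannian (hyperbolicity_locus X'))"
proof -
  obtain B B' :: "real^3^3" and A C where BB: "B' ** B = mat 1" "B ** B' = mat 1"
    and X: "X = {abs_cproj (cmat B *v c) |c. c \<noteq> 0 \<and> weierstrass A C 0 c = 0}"
    and AC: "A^2 < 4 * C \<or> (\<exists>a b. 0 < a \<and> a < b \<and> A = - (a + b) \<and> C = a * b)"
    by (rule smooth_cubic_normal_form[OF assms(1)]) (rule that)
  have "\<not> A^2 < 4 * C"
  proof
    assume disc: "A^2 < 4 * C"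
    have pos: "0 < x^2 + A * x + C" for x
    proof -
      have "x^2 + A * x + C = (x + A / 2)^2 + (4 * C - A^2) / 4"
        by (simp add: power2_eq_square field_simps)
      also have "0 < \<dots>" using disc by (intro add_nonneg_pos) simp_all
      finally show ?thesis .
    qed
    have "0 \<le> x" if "y^2 = x * (x^2 + A * x + C)" for x y
      using that pos[of x] by (metis zero_le_mult_iff zero_le_power2 not_less)
    then have "{vector [x, y, 1] |x y. y^2 = x * (x^2 + A * x + C)} =
        ({vector [x, y, 1] |x y. 0 \<le> x \<and> y^2 = x * (x^2 + A * x + C)} :: (real^3) set)" by blast
    then have "connected (X \<inter> real_points)"
      unfolding real_locus[OF BB X] using unbounded_branch(2)[OF BB(1) pos] by simp
    moreover have "X \<inter> real_points \<noteq> {}" unfolding real_locus[OF BB X] by blast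
    ultimately have "components (X \<inter> real_points) = {X \<inter> real_points}"
      by (simp add: components_eq_sing_iff)
    then show False using assms(2,3) by (metis doubleton_eq_iff insert_absorb2)
  qed
  then obtain a b where ab: "0 < a" "a < b" "A = - (a + b)" "C = a * b" using AC by blast
  interpret plane_cubic a b "a / 2" B B' X
    by unfold_locales (use ab BB X in auto)
  note result = P.L_linear_subspace Q.L_linear_subspace P_L Q_L degree_partition_P degree_partition_Q
  have sep: "\<not> (\<exists>D \<in> connected_components_of
      (subtopology grassmannian (hyperbolicity_locus (veronese ` X))). P.L \<in> D \<and> Q.L \<in> D)"
    using not_connectedin connectedin_connected_components_of by blast
  have "X1 = plane_pt B ` oval_pts a b \<and> X2 = plane_pt B ` pseudoline_pts a b \<or>
      X1 = plane_pt B ` pseudoline_pts a b \<and> X2 = plane_pt B ` oval_pts a b"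
    using assms(2) unfolding components_X by (metis doubleton_eq_iff)
  then show ?thesis
  proof
    assume "X1 = plane_pt B ` oval_pts a b \<and> X2 = plane_pt B ` pseudoline_pts a b"
    then show ?thesis unfolding assms(4) degree_partition_def
      using sep not_connected_locus result
      by (intro conjI bexI[of _ P.L] bexI[of _ Q.L]) simp_all
  next
    assume "X1 = plane_pt B ` pseudoline_pts a b \<and> X2 = plane_pt B ` oval_pts a b"
    then show ?thesis unfolding assms(4) degree_partition_def
      using sep not_connected_locus result
      by (intro conjI bexI[of _ Q.L] bexI[of _ P.L]) (simp_all add: conj_commute)
  qed
qed

end
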